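(* Let $A$ be a continuous auction of format $\mathcal{A}\in\{FP,AP\}$ (first-price or all-pay) with $N\ge2$ buyers, in quantile coordinates, with canonical equilibrium bidding strategy $\beta$, and let $(A_n)_{n\in\mathbb{N}}$ be a $\delta$-fine family of its discretisations. Suppose $A$ is either 1. an all-pay auction such that $\frac{d}{d\theta}\left(\frac{1}{v(\theta)}\right)$ has a negative upper bound on $(0,1]$, or 2. a first-price auction such that $\theta/v(\theta)$ is strictly decreasing with a negative upper bound on its derivative on $(0,1]$. Then for every $n$ and every Bayesian coarse correlated equilibrium $\sigma^n$ of $A_n$ with symmetric support (i.e. every profile $\lambda$ with $\sigma^n(\lambda)>0$ satisfies $\lambda_i=\lambda_j$ for all $i,j$), $$\sum_{\lambda\in\Lambda_n}\sigma^n(\lambda)\sum_{i\in[N]}\int_0^1 d\theta_i\cdot\theta_i^{N-2}\cdot\frac{(\lambda_i(\theta_i)-\beta(\theta_i))^2}{2}\ \le\ \frac{N\left[F(4\delta(n))+\int_{F(4\delta(n))}^1 d\theta_i\cdot\frac{4\delta(n)}{v(\theta_i)}\right]}{\min\{C^{\mathcal{A}},D^{\mathcal{A}}\}},$$ where $\Lambda_n$ is the set of symmetric profiles of $A_n$, each identified with the induced piecewise constant profile on $[0,1]$, and $$C^{FP}=\inf\left(\left\{-\frac{d}{d\mu}\left(\frac{\beta^{-1}(\mu)}{v(\beta^{-1}(\mu))}\right):\mu\in(0,\beta(1)]\right\}\cup\left\{\frac{1}{v(1)\max B}\right\}\right),\qquad D^{FP}=\inf_{\theta\in(0,1]}\frac{v'(\theta)\theta^2}{(2N-3)v(\theta)^3},$$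 $$C^{AP}=\inf\left(\left\{-\frac{d}{d\mu}\left(\frac{1}{\beta^{-1}(\mu)^{N-2}\,v(\beta^{-1}(\mu))}\right):\mu\in(0,\beta(1)]\right\}\cup\left\{\frac{1}{v(1)\max B}\right\}\right),\qquad D^{AP}=\inf_{\theta\in(0,1]}\frac{v'(\theta)}{(2N-3)v(\theta)^3}.$$
   Context: Continuous auction in quantile coordinates. There are $N\ge2$ buyers with i.i.d. valuations drawn from a c.d.f. $F$ with a probability density of full support on the interval $V=[0,v(1)]\subset\mathbb{R}_+$ ($F=1$ beyond $v(1)$); bids lie in an interval $B=[0,\max B]\supseteq V$. Set $v=F^{-1}:[0,1]\to V$, assumed continuous and strictly increasing on $[0,1]$ (so $v(0)=0$) and $C^\infty$ on $(0,1]$. Types $\theta_i$ are i.i.d. uniform on $[0,1]$, and a buyer of type $\theta_i$ has valuation $v(\theta_i)$. Allocation (uniform tie-breaking): $x_i(b)=1/|\arg\max_j b_j|$ if $i\in\arg\max_j b_j$, and $x_i(b)=0$ otherwise. First-price utility: $u_i(b|w)=x_i(b)(w-b_i)$; all-pay utility: $u_i(b|w)=x_i(b)w-b_i$, for valuation $w$. Canonical equilibrium: first-price $\beta(0)=0$, $\beta(\theta)=\frac{1}{\theta^{N-1}}\int_0^\theta (N-1)t^{N-2}v(t)\,dt$ for $\theta\in(0,1]$; all-pay $\beta(\theta)=\int_0^\theta (N-1)t^{N-2}v(t)\,dt$. Discretisations. For a decreasing $\delta:\mathbb{N}\to\mathbb{R}_+$ with $\delta(n)\to0$, a $\delta$-fine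 family of discretisations is a sequence $A_n$ given by finite sets $V_n=\{v^n_0<v^n_1<\dots<v^n_{K_n}\}\subseteq[0,v(1))$ and $B_n\subseteq B$, with $v^n_0=0$, $0\in B_n$, $\max B\in B_n$, and prior $F_n(v^n_k)=F(v^n_{k+1})-F(v^n_k)$ where $v^n_{K_n+1}:=v(1)$, such that $F_n\to F$ in probability and $\sup_{w\in V}\inf_{w'\in V_n}|w-w'|\le\delta(n)$, $\sup_{b\in B}\inf_{b'\in B_n}|b-b'|\le\delta(n)$. In $A_n$ valuations are i.i.d. from $F_n$, bids are in $B_n$, and $u_i$ is as in $A$. A Bayesian coarse correlated equilibrium (BCCE) of $A_n$ is a probability distribution $\sigma$ on pure profiles $\lambda=(\lambda_i:V_n\to B_n)_{i\in[N]}$ such that for all $i\in[N]$, $v_i\in V_n$, $b'_i\in B_n$: $\mathbb{E}_{\lambda\sim\sigma,\,v_{-i}\sim F_n^{N-1}}[u_i(b'_i,\lambda_{-i}(v_{-i})|v_i)-u_i(\lambda(v)|v_i)]\le0$. Induced profile: $\lambda_i:V_n\to B_n$ is extended to $[0,1]$ (same symbol) by $\lambda_i(\theta)=\lambda_i(v^n_k)$ whenever $v(\theta)\in[v^n_k,v^n_{k+1})$, and $\lambda_i(1)=\lambda_i(v^n_{K_n})$. *)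

theory Defs
  imports "HOL-Probability.Probability"
begin

datatype auction_format = FP | AP

(* Buyers are the indices i < N.  A bid profile is a function b on indices; only its values
   at indices below N are ever used. *)

definition alloc :: "nat \<Rightarrow> nat \<Rightarrow> (nat \<Rightarrow> real) \<Rightarrow> real" where
  "alloc N i b =
     (if is_arg_max b (\<lambda>j. j < N) i then 1 / real (card {j. is_arg_max b (\<lambda>j. j < N) j}) else 0)"

fun utility :: "auction_format \<Rightarrow> nat \<Rightarrow> nat \<Rightarrow> (nat \<Rightarrow> real) \<Rightarrow> real \<Rightarrow> real" where
  "utility FP N i b w = alloc N i b * (w - b i)"
| "utility AP N i b w = alloc N i b * w - b i"

fun canonical_bid :: "auction_format \<Rightarrow> nat \<Rightarrow> (real \<Rightarrow> real) \<Rightarrow> real \<Rightarrow> real" where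
  "canonical_bid FP N v \<theta> =
     (if \<theta> = 0 then 0
      else 1 / \<theta> ^ (N - 1) * integral {0..\<theta>} (\<lambda>t. real (N - 1) * t ^ (N - 2) * v t))"
| "canonical_bid AP N v \<theta> = integral {0..\<theta>} (\<lambda>t. real (N - 1) * t ^ (N - 2) * v t)"

definition canonical_bid_inv :: "auction_format \<Rightarrow> nat \<Rightarrow> (real \<Rightarrow> real) \<Rightarrow> real \<Rightarrow> real" where
  "canonical_bid_inv fmt N v = the_inv_into {0..1} (canonical_bid fmt N v)"

(* g is C-infinity on S; D k is the k-th derivative, taken relative to S, hence one-sided at an
   endpoint that belongs to S. *)
definition smooth_on :: "real set \<Rightarrow> (real \<Rightarrow> real) \<Rightarrow> bool" where
  "smooth_on S g \<longleftrightarrow>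
     (\<exists>D :: nat \<Rightarrow> real \<Rightarrow> real.
        (\<forall>x\<in>S. D 0 x = g x) \<and>
        (\<forall>k. \<forall>x\<in>S. (D k has_real_derivative D (Suc k) x) (at x within S)))"

definition measure_support :: "real measure \<Rightarrow> real set" where
  "measure_support M = {x. \<forall>e>0. 0 < measure M (ball x e)}"

(* f is the density and F the c.d.f. of the valuations; the valuation space is V = {0..v 1} and
   the bid space B = {0..bmax}.  The values of v outside {0..1} are irrelevant. *)
locale continuous_auction =
  fixes N :: nat and f F v :: "real \<Rightarrow> real" and bmax :: real
  assumes two_buyers: "2 \<le> N"
    and density_measurable: "f \<in> borel_measurable borel"
    and density_nonneg: "\<And>x. 0 \<le> f x"
    and density_prob: "prob_space (density lborel (\<lambda>x. ennreal (f x)))"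
    and full_support: "measure_support (density lborel (\<lambda>x. ennreal (f x))) = {0..v 1}"
    and F_cdf: "F = cdf (density lborel (\<lambda>x. ennreal (f x)))"
    and v_image: "v ` {0..1} = {0..v 1}"
    and v_inverse: "\<And>\<theta>. \<theta> \<in> {0..1} \<Longrightarrow> F (v \<theta>) = \<theta>"
    and v_continuous: "continuous_on {0..1} v"
    and v_strict_mono: "strict_mono_on {0..1} v"
    and v_smooth: "smooth_on {0<..1} v"
    and bids_cover: "{0..v 1} \<subseteq> {0..bmax}"

definition grid :: "nat \<Rightarrow> (nat \<Rightarrow> real) \<Rightarrow> real set" where
  "grid K w = w ` {..K}"

(* The n-th discretisation has valuations vn n 0 < ... < vn n (K n), bids Bn n and prior Fn n.
   The convention for the index K n + 1 is that vn n (Suc (K n)) = v 1, so that strict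
   monotonicity up to that index also expresses that all valuations lie below v 1. *)
locale fine_discretisations = continuous_auction N f F v bmax
  for N :: nat and f F v :: "real \<Rightarrow> real" and bmax :: real +
  fixes \<delta> :: "nat \<Rightarrow> real" and K :: "nat \<Rightarrow> nat" and vn :: "nat \<Rightarrow> nat \<Rightarrow> real"
    and Bn :: "nat \<Rightarrow> real set" and Fn :: "nat \<Rightarrow> real pmf"
  assumes delta_decreasing: "decseq \<delta>"
    and delta_nonneg: "\<And>n. 0 \<le> \<delta> n"
    and delta_limit: "\<delta> \<longlonglongrightarrow> 0"
    and vn_strict_mono: "\<And>n. strict_mono_on {..Suc (K n)} (vn n)"
    and vn_first: "\<And>n. vn n 0 = 0"
    and vn_last: "\<And>n. vn n (Suc (K n)) = v 1"
    and Bn_finite: "\<And>n. finite (Bn n)"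
    and Bn_subset: "\<And>n. Bn n \<subseteq> {0..bmax}"
    and Bn_zero: "\<And>n. 0 \<in> Bn n"
    and Bn_max: "\<And>n. bmax \<in> Bn n"
    and prior_support: "\<And>n. set_pmf (Fn n) \<subseteq> grid (K n) (vn n)"
    and prior: "\<And>n k. k \<le> K n \<Longrightarrow> pmf (Fn n) (vn n k) = F (vn n (Suc k)) - F (vn n k)"
    and prior_limit: "weak_conv (\<lambda>n. cdf (measure_pmf (Fn n))) F"
    and fine_valuations: "\<And>n. (SUP w\<in>{0..v 1}. INF w'\<in>grid (K n) (vn n). \<bar>w - w'\<bar>) \<le> \<delta> n"
    and fine_bids: "\<And>n. (SUP b\<in>{0..bmax}. INF b'\<in>Bn n. \<bar>b - b'\<bar>) \<le> \<delta> n"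

(* Extensional function spaces, so that a profile is determined by its values on the grid and
   finite grids give finitely many profiles. *)
definition profiles :: "nat \<Rightarrow> real set \<Rightarrow> real set \<Rightarrow> (nat \<Rightarrow> real \<Rightarrow> real) set" where
  "profiles N V B = {..<N} \<rightarrow>\<^sub>E (V \<rightarrow>\<^sub>E B)"

definition symmetric_profile :: "nat \<Rightarrow> (nat \<Rightarrow> real \<Rightarrow> real) \<Rightarrow> bool" where
  "symmetric_profile N l \<longleftrightarrow> (\<forall>i<N. \<forall>j<N. l i = l j)"

(* In the expectation, l is drawn from \<sigma> and, independently, w = v_{-i} from the (N-1)-fold product
   of the prior P. *)
definition BCCE :: "auction_format \<Rightarrow> nat \<Rightarrow> real set \<Rightarrow> real set \<Rightarrow> real pmf
    \<Rightarrow> (nat \<Rightarrow> real \<Rightarrow> real) pmf \<Rightarrow> bool" where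
  "BCCE fmt N V B P \<sigma> \<longleftrightarrow>
     set_pmf \<sigma> \<subseteq> profiles N V B \<and>
     (\<forall>i<N. \<forall>vi\<in>V. \<forall>b'\<in>B.
        measure_pmf.expectation (pair_pmf \<sigma> (Pi_pmf ({..<N} - {i}) 0 (\<lambda>_. P)))
          (\<lambda>(l, w). utility fmt N i ((\<lambda>j. l j (w j))(i := b')) vi
                   - utility fmt N i (\<lambda>j. l j ((w(i := vi)) j)) vi) \<le> 0)"

definition induced :: "(real \<Rightarrow> real) \<Rightarrow> nat \<Rightarrow> (nat \<Rightarrow> real) \<Rightarrow> (real \<Rightarrow> real) \<Rightarrow> real \<Rightarrow> real" where
  "induced v K w s \<theta> =
     (if \<theta> = 1 then s (w K) else s (w (THE k. k \<le> K \<and> w k \<le> v \<theta> \<and> v \<theta> < w (Suc k))))"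

(* Derivatives are relative to the half-open interval: two-sided in its interior and one-sided
   at its right endpoint. *)
fun const_C :: "auction_format \<Rightarrow> nat \<Rightarrow> (real \<Rightarrow> real) \<Rightarrow> real \<Rightarrow> real" where
  "const_C FP N v bmax =
     Inf ({- vector_derivative
               (\<lambda>\<mu>. canonical_bid_inv FP N v \<mu> / v (canonical_bid_inv FP N v \<mu>))
               (at \<mu> within {0<..canonical_bid FP N v 1}) | \<mu>. \<mu> \<in> {0<..canonical_bid FP N v 1}}
          \<union> {1 / (v 1 * bmax)})"
| "const_C AP N v bmax =
     Inf ({- vector_derivative
               (\<lambda>\<mu>. 1 / (canonical_bid_inv AP N v \<mu> ^ (N - 2) * v (canonical_bid_inv AP N v \<mu>)))
               (at \<mu> within {0<..canonical_bid AP N v 1}) | \<mu>. \<mu> \<in> {0<..canonical_bid AP N v 1}}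
          \<union> {1 / (v 1 * bmax)})"

fun const_D :: "auction_format \<Rightarrow> nat \<Rightarrow> (real \<Rightarrow> real) \<Rightarrow> real" where
  "const_D FP N v =
     (INF \<theta>\<in>{0<..1}. vector_derivative v (at \<theta> within {0<..1}) * \<theta>\<^sup>2 / ((2 * real N - 3) * v \<theta> ^ 3))"
| "const_D AP N v =
     (INF \<theta>\<in>{0<..1}. vector_derivative v (at \<theta> within {0<..1}) / ((2 * real N - 3) * v \<theta> ^ 3))"

end

theory Submission
  imports Defs
begin

text \<open>
  Weigh the equilibrium constraint of a buyer of type \<open>\<theta>\<close>, for the deviation to a bid of the grid just
  above \<open>\<beta> \<theta>\<close>, by \<open>1 / v \<theta>\<close> and integrate over \<open>\<theta>\<close>. The discretisation costs at most \<open>4 \<delta> / v \<theta>\<close>, and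
  also at most \<open>1\<close>, which is better for low types.

  For one symmetric profile let \<open>q\<close> be the quantile of a bid \<open>b\<close> within the bid distribution. Put
  \<open>J = \<theta> / v\<close> (first price) or \<open>J = 1 / (\<theta> ^ (N - 2) v)\<close> (all pay). The canonical bid solves
  \<open>(N - 1) w = \<beta>' J\<close>, where \<open>w\<close> is the weighted value of winning at \<open>\<beta>\<close>, so the weighted gain, as a function
  of \<open>b\<close> for fixed \<open>q\<close>, has slope \<open>J q - J (\<beta>\<^sup>-\<^sup>1 b)\<close>: it is \<open>C\<close>-strongly convex with minimum at \<open>\<beta> q\<close>. This
  settles increasing profiles. For an arbitrary profile the types with bids at least \<open>u\<close> are compared,
  for each \<open>u\<close>, with the top quantiles of the same mass, and \<open>D\<close> is exactly what makes the
  rearrangement lose at least as much as the quadratic form changes.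
\<close>

section \<open>Piecewise integrals and summation by parts\<close>

text \<open>The weight 1 / v removes the valuation from the bidder's own winning probability: what
  is left of it averages to 1 / N over the types for every symmetric profile. Only the payments,
  weighted by 1 / v, still depend on which type makes which bid. An arbitrary profile separates the
  type \<open>x\<close> of a bid from its quantile \<open>q\<close>. Since 1 / v decreases, weighted
  payments are least when high types make the high bids. Moving the quadratic form from quantiles to
  types, however, brings in the cross term M * b * x^(N-2) * \<beta> x, which grows with the type.
  The inequality r * m' + M * k' \<le> 0, with k' the derivative of x^(N-2) * \<beta> x, says that
  payments prevail; estimating k' gives summands with factors N - 2 and N - 1, whose sum is the 2N -
  3 of \<open>const_D\<close>. The recurring obstacle is quantile 0, where 1 / v is singular.
  Equilibrium makes the lowest cell bid 0, so positive bids have positive quantiles and types, and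
  elsewhere the singular integrals carry the coefficient 0. The 4 \<delta> is 2 \<delta> for
  rounding the valuation plus 2 \<delta> for rounding the bid.\<close>

lemma integrable_if_bounded_continuous:
  fixes f :: "real \<Rightarrow> real"
  assumes "continuous_on {0<..1} f" and "\<And>x. x \<in> {0..1} \<Longrightarrow> \<bar>f x\<bar> \<le> c" and "0 \<le> a" "b \<le> 1"
  shows "f integrable_on {a..b}"
proof -
  \<comment> \<open>No limit at 0 is assumed: quotients such as \<beta> / v are only shown to be
    bounded there. Integrability therefore comes from measurability and domination on (0, 1], and
    the point 0 is added as a null set.\<close>
  have "f \<in> borel_measurable (lebesgue_on {0<..1})"
    by (rule continuous_imp_measurable_on_sets_lebesgue[OF assms(1)]) auto
  moreover have "f absolutely_integrable_on {0<..1}"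
  proof (rule measurable_bounded_by_integrable_imp_absolutely_integrable)
    show "f \<in> borel_measurable (lebesgue_on {0<..1})" by fact
    have "(\<lambda>x::real. c) integrable_on {0..1}" by (intro integrable_continuous_real continuous_intros)
    then show "(\<lambda>x::real. c) integrable_on {0<..1}"
      by (rule integrable_spike_set; intro negligible_subset[OF negligible_sing[of "0::real"]]) auto
    show "norm (f x) \<le> c" if "x \<in> {0<..1}" for x
      using assms(2)[of x] that by simp
  qed simp
  then have "f integrable_on {0<..1}"
    by (rule set_lebesgue_integral_eq_integral(1))
  then have "f integrable_on {0..1}"
    by (rule integrable_spike_set; intro negligible_subset[OF negligible_sing[of "0::real"]]) auto
  then show ?thesis
    by (rule integrable_on_subinterval) (use assms in auto)
qed

text \<open>Summation by parts: a nonnegative monotone \<open>f\<close> is a combination, with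
  nonnegative coefficients, of indicators of upper sets of \<open>B\<close>. The layer at
  \<open>u\<close> has coefficient 0 when \<open>f u = 0\<close>, so nothing is asked of its tail
  sum; this spares the layer of bid 0, which would reach down to quantile 0.\<close>

lemma sum_nonneg_if_tail_sums_nonneg:
  fixes f A :: "real \<Rightarrow> real"
  assumes "finite B" and "mono_on B f" and "\<And>b. b \<in> B \<Longrightarrow> 0 \<le> f b"
    and "\<And>u. u \<in> B \<Longrightarrow> 0 < f u \<Longrightarrow> 0 \<le> (\<Sum>b\<in>{b \<in> B. u \<le> b}. A b)"
  shows "0 \<le> (\<Sum>b\<in>B. f b * A b)"
  using assms
proof (induction B arbitrary: f rule: finite_linorder_min_induct)
  case empty
  then show ?case by simp
next
  case (insert a B)
  have notin: "a \<notin> B" using insert.hyps by auto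
  have "0 \<le> (\<Sum>b\<in>B. (f b - f a) * A b)"
  proof (rule insert.IH)
    show "mono_on B (\<lambda>b. f b - f a)"
      using insert.prems(1) by (auto simp: mono_on_def)
    show "0 \<le> f b - f a" if "b \<in> B" for b
      using insert.prems(1) insert.hyps that by (auto simp: mono_on_def)
    show "0 \<le> (\<Sum>b\<in>{b \<in> B. u \<le> b}. A b)" if "u \<in> B" "0 < f u - f a" for u
    proof -
      have "{b \<in> insert a B. u \<le> b} = {b \<in> B. u \<le> b}"
        using insert.hyps that by auto
      then show ?thesis
        using insert.prems(3)[of u] insert.prems(2)[of a] that by simp
    qed
  qed
  moreover have "0 \<le> f a * (\<Sum>b\<in>insert a B. A b)"
  proof (cases "f a = 0")
    case False
    then have "0 < f a" using insert.prems(2)[of a] by simp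
    moreover have "{b \<in> insert a B. a \<le> b} = insert a B" using insert.hyps by auto
    ultimately show ?thesis using insert.prems(3)[of a] by simp
  qed simp
  moreover have "(\<Sum>b\<in>insert a B. f b * A b)
      = f a * (\<Sum>b\<in>insert a B. A b) + (\<Sum>b\<in>B. (f b - f a) * A b)"
    using insert.hyps notin
    by (simp add: algebra_simps sum_distrib_left sum_subtractf)
  ultimately show ?case by linarith
qed

text \<open>The upper cumulative sum at one element of \<open>B\<close> is the lower one at the next
  element, so the intervals between them tile the range from 0 to \<open>sum P B\<close>.\<close>

lemma sum_telescope_cumulative:
  fixes P g :: "real \<Rightarrow> real"
  assumes "finite B"
  shows "(\<Sum>b\<in>B. g (sum P {b' \<in> B. b' \<le> b}) - g (sum P {b' \<in> B. b' < b})) = g (sum P B) - g 0"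
  using assms
proof (induction B rule: finite_linorder_max_induct)
  case empty
  then show ?case by simp
next
  case (insert a B)
  have a: "a \<notin> B" using insert.hyps by auto
  have 1: "{b' \<in> insert a B. b' \<le> a} = insert a B" "{b' \<in> insert a B. b' < a} = B"
    using insert.hyps by auto
  have "{b' \<in> insert a B. b' \<le> b} = {b' \<in> B. b' \<le> b}" "{b' \<in> insert a B. b' < b} = {b' \<in> B. b' < b}"
    if "b \<in> B" for b using insert.hyps that by force+
  then have "(\<Sum>b\<in>B. g (sum P {b' \<in> insert a B. b' \<le> b}) - g (sum P {b' \<in> insert a B. b' < b}))
     = g (sum P B) - g 0"
    using insert.IH by (metis (no_types, lifting) sum.cong)
  then show ?case using insert.hyps(1) a 1 by simp
qed

text \<open>Agreement on the open cells suffices, so the values of a step strategy at its cut points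
  never matter.\<close>

lemma has_integral_piecewise:
  fixes f :: "real \<Rightarrow> real" and t :: "nat \<Rightarrow> real"
  assumes "\<And>k. k < n \<Longrightarrow> t k < t (Suc k)"
    and "\<And>k. k < n \<Longrightarrow> (g k has_integral I k) {t k..t (Suc k)}"
    and "\<And>k x. k < n \<Longrightarrow> t k < x \<Longrightarrow> x < t (Suc k) \<Longrightarrow> f x = g k x"
  shows "(f has_integral (\<Sum>k<n. I k)) {t 0..t n}"
  using assms
proof (induction n)
  case 0
  then show ?case by (simp add: has_integral_refl)
next
  case (Suc n)
  have mono: "t 0 \<le> t n"
  proof -
    have "m \<le> n \<Longrightarrow> t 0 \<le> t m" for m
    proof (induction m)
      case (Suc m)
      then show ?case using Suc.prems \<open>\<And>k. k < Suc n \<Longrightarrow> t k < t (Suc k)\<close>[of m] by simp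
    qed simp
    then show ?thesis by simp
  qed
  have "(f has_integral (\<Sum>k<n. I k)) {t 0..t n}"
    by (rule Suc.IH) (use Suc.prems in auto)
  moreover have "(f has_integral I n) {t n..t (Suc n)}"
  proof (rule has_integral_spike_finite[OF _ _ Suc.prems(2)])
    show "finite {t n, t (Suc n)}" by simp
  qed (use Suc.prems(3)[of n] in auto)
  ultimately show ?case
    using has_integral_combine[OF mono less_imp_le[OF Suc.prems(1)[of n]]] by simp
qed

section \<open>The dual certificate along the quantiles\<close>

text \<open>Below \<open>m = 1 / v\<close>, and a bid \<open>b\<close> of quantile \<open>q\<close> pays \<open>b * r q\<close> on average: \<open>r q = q ^ (N - 1)\<close> for
  the first-price and \<open>r = 1\<close> for the all-pay format. \<open>M\<close> plays the role of both constants \<open>C\<close> (in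
  \<open>J_drop\<close> and \<open>M_bmax\<close>) and \<open>D\<close> (in \<open>D_bound\<close>).\<close>

locale dual_core =
  fixes N :: nat and M bmax :: real and \<beta> \<beta>' m m' J w r r' k' :: "real \<Rightarrow> real"
  assumes two_le_N: "2 \<le> N"
    and M_nonneg: "0 \<le> M"
    and M_bmax: "M * bmax \<le> J 1"
    and beta_continuous: "continuous_on {0..1} \<beta>"
    and beta_0: "\<beta> 0 = 0"
    and beta_strict_mono: "\<And>x y. 0 \<le> x \<Longrightarrow> x < y \<Longrightarrow> y \<le> 1 \<Longrightarrow> \<beta> x < \<beta> y"
    and beta_deriv: "\<And>x. 0 < x \<Longrightarrow> x < 1 \<Longrightarrow> (\<beta> has_real_derivative \<beta>' x) (at x)"
    and beta'_nonneg: "\<And>x. 0 < x \<Longrightarrow> x < 1 \<Longrightarrow> 0 \<le> \<beta>' x"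
    and w_continuous: "continuous_on {0<..1} w"
    and w_bounds: "\<And>x. 0 \<le> x \<Longrightarrow> x \<le> 1 \<Longrightarrow> 0 \<le> w x \<and> w x \<le> 1"
    and w_eq: "\<And>x. 0 < x \<Longrightarrow> x < 1 \<Longrightarrow> real (N - 1) * w x = \<beta>' x * J x"
    and J_drop: "\<And>q s. 0 < q \<Longrightarrow> q \<le> s \<Longrightarrow> s \<le> 1 \<Longrightarrow> M * (\<beta> s - \<beta> q) \<le> J q - J s"
    and J_eq: "\<And>x. 0 < x \<Longrightarrow> x \<le> 1 \<Longrightarrow> x ^ (N - 2) * J x = r x * m x"
    and payment_bounds: "\<And>x. 0 \<le> x \<Longrightarrow> x \<le> 1 \<Longrightarrow> 0 \<le> r x * m x * \<beta> x \<and> r x * m x * \<beta> x \<le> 1"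
    and m_continuous: "continuous_on {0<..1} m"
    and m_deriv: "\<And>x. 0 < x \<Longrightarrow> x < 1 \<Longrightarrow> (m has_real_derivative m' x) (at x)"
    and m'_nonpos: "\<And>x. 0 < x \<Longrightarrow> x < 1 \<Longrightarrow> m' x \<le> 0"
    and r_deriv: "\<And>x. (r has_real_derivative r' x) (at x)"
    and r'_continuous: "continuous_on {0..1} r'"
    and r'_nonneg: "\<And>x. 0 \<le> x \<Longrightarrow> 0 \<le> r' x"
    and k_deriv: "\<And>x. 0 < x \<Longrightarrow> x < 1 \<Longrightarrow> ((\<lambda>x. x ^ (N - 2) * \<beta> x) has_real_derivative k' x) (at x)"
    and D_bound: "\<And>x. 0 < x \<Longrightarrow> x < 1 \<Longrightarrow> r x * m' x + M * k' x \<le> 0"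
begin

lemma beta_continuous_on: "S \<subseteq> {0..1} \<Longrightarrow> continuous_on S \<beta>"
  by (rule continuous_on_subset[OF beta_continuous])

lemma m_continuous_on: "S \<subseteq> {0<..1} \<Longrightarrow> continuous_on S m"
  by (rule continuous_on_subset[OF m_continuous])

lemma r_continuous_on: "continuous_on S r"
  using r_deriv by (auto intro: DERIV_continuous_on has_field_derivative_at_within)

text \<open>Weighted value that the canonical bids collect against a highest opposing bid
  \<open>b\<close>: the types that win are those whose canonical bid exceeds
  \<open>b\<close>.\<close>

definition W :: "real \<Rightarrow> real" where
  "W b = integral {0..1} (\<lambda>x. if b < \<beta> x then w x else 0)"

lemma w_integrable: "0 \<le> a \<Longrightarrow> b \<le> 1 \<Longrightarrow> w integrable_on {a..b}"
  by (rule integrable_if_bounded_continuous[OF w_continuous, of 1]) (use w_bounds in auto)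

lemma beta_mono: "0 \<le> x \<Longrightarrow> x \<le> y \<Longrightarrow> y \<le> 1 \<Longrightarrow> \<beta> x \<le> \<beta> y"
  using beta_strict_mono[of x y] by (cases "x = y") auto

lemma beta_nonneg: "0 \<le> x \<Longrightarrow> x \<le> 1 \<Longrightarrow> 0 \<le> \<beta> x"
  using beta_mono[of 0 x] beta_0 by simp

lemma beta_less_iff: "x \<in> {0..1} \<Longrightarrow> y \<in> {0..1} \<Longrightarrow> \<beta> x < \<beta> y \<longleftrightarrow> x < y"
  using beta_strict_mono[of x y] beta_mono[of y x] by force

lemma has_integral_W_beta:
  assumes "s \<in> {0..1}"
  shows "((\<lambda>x. if \<beta> s < \<beta> x then w x else 0) has_integral integral {s..1} w) {0..1}"
proof -
  have "((\<lambda>x. if \<beta> s < \<beta> x then w x else 0) has_integral 0) {0..s}"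
    by (rule has_integral_is_0) (use assms beta_less_iff in auto)
  moreover have "((\<lambda>x. if \<beta> s < \<beta> x then w x else 0) has_integral integral {s..1} w) {s..1}"
  proof (rule has_integral_spike_finite[of "{s}"])
    show "(w has_integral integral {s..1} w) {s..1}"
      using assms by (intro integrable_integral w_integrable) auto
  qed (use assms beta_less_iff in auto)
  ultimately show ?thesis
    using has_integral_combine[of 0 s 1] assms by fastforce
qed

lemma W_beta: "s \<in> {0..1} \<Longrightarrow> W (\<beta> s) = integral {s..1} w"
  unfolding W_def using has_integral_W_beta by blast

lemma integrable_W:
  assumes "0 \<le> b"
  shows "(\<lambda>x. if b < \<beta> x then w x else 0) integrable_on {0..1}"
proof (cases "b \<le> \<beta> 1")
  case True
  then obtain s where "s \<in> {0..1}" "\<beta> s = b"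
    using IVT'[of \<beta> 0 b 1] beta_0 beta_continuous assms by auto
  then show ?thesis using has_integral_W_beta by blast
next
  case False
  then have "((\<lambda>x. if b < \<beta> x then w x else 0) has_integral 0) {0..1}"
    by (intro has_integral_is_0) (use beta_mono[of _ 1] in force)
  then show ?thesis by blast
qed

lemma W_above: "\<beta> 1 \<le> b \<Longrightarrow> W b = 0"
  unfolding W_def
  by (intro integral_unique has_integral_is_0) (use beta_mono[of _ 1] in force)

lemma tail_integral_continuous: "continuous_on {0..1} (\<lambda>x. integral {x..1} w)"
  by (rule indefinite_integral_continuous_1') (rule w_integrable, auto)

lemma tail_integral_deriv:
  assumes "0 < x" "x < 1"
  shows "((\<lambda>x. integral {x..1} w) has_real_derivative - w x) (at x)"
proof -
  \<comment> \<open>\<open>w\<close> is continuous only away from 0, so the fundamental theorem is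
    applied on [e, 1] and the tail integral is recovered by subtraction.\<close>
  define e where "e = x / 2"
  have e: "0 < e" "e < x" using assms by (auto simp: e_def)
  have "((\<lambda>x. integral {e..x} w) has_real_derivative w x) (at x within {e..1})"
    by (rule integral_has_real_derivative)
       (use e assms in \<open>auto intro!: continuous_on_subset[OF w_continuous]\<close>)
  then have "((\<lambda>x. integral {e..x} w) has_real_derivative w x) (at x)"
    using e assms by (simp add: at_within_Icc_at)
  then have "((\<lambda>x. integral {e..1} w - integral {e..x} w) has_real_derivative - w x) (at x)"
    by (auto intro!: derivative_eq_intros)
  then show ?thesis
  proof (rule has_field_derivative_transform_within_open[where S="{e<..<1}"])
    fix y assume "y \<in> {e<..<1}"
    then have "integral {e..y} w + integral {y..1} w = integral {e..1} w"
      using e by (intro Henstock_Kurzweil_Integration.integral_combine w_integrable) auto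
    then show "integral {e..1} w - integral {e..y} w = integral {y..1} w" by simp
  qed (use e assms in auto)
qed

text \<open>Writing the bid as \<open>\<beta> s\<close> avoids differentiating the inverse of
  \<beta>. By \<open>w_eq\<close> the slack has derivative \<beta>' x * (J q - J x - M * (\<beta> x
  - \<beta> q)) at the bid \<beta> x. \<open>J_drop\<close> makes it nonpositive before
  \<open>q\<close> and nonnegative after, so the slack is least at \<open>q\<close>, where it is
  0.\<close>

lemma convexity_beta:
  assumes q: "0 < q" "q \<le> 1" and s: "0 \<le> s" "s \<le> 1"
  shows "real (N - 1) * integral {q..1} w + (\<beta> q - \<beta> s) * J q + M * (\<beta> s - \<beta> q)\<^sup>2 / 2
           \<le> real (N - 1) * integral {s..1} w"
proof -
  define f where "f x = real (N - 1) * integral {x..1} w + (\<beta> x - \<beta> q) * J q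
      - M / 2 * (\<beta> x - \<beta> q)\<^sup>2" for x
  have cont: "continuous_on {0..1} f"
    unfolding f_def by (intro continuous_intros tail_integral_continuous beta_continuous) auto
  have deriv: "(f has_real_derivative \<beta>' x * (J q - J x - M * (\<beta> x - \<beta> q))) (at x)"
    if "0 < x" "x < 1" for x
    unfolding f_def
    using w_eq[OF that]
    by (auto intro!: derivative_eq_intros tail_integral_deriv beta_deriv that simp: field_simps)
  have "f q \<le> f s"
  proof (cases "s \<le> q")
    case True
    show ?thesis
    proof (rule DERIV_nonpos_imp_decreasing_open[OF True])
      show "\<exists>y. (f has_real_derivative y) (at x) \<and> y \<le> 0" if x: "s < x" "x < q" for x
      proof -
        have "J q - J x - M * (\<beta> x - \<beta> q) \<le> 0"
          using J_drop[of x q] x s q by (simp add: algebra_simps)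
        then have "\<beta>' x * (J q - J x - M * (\<beta> x - \<beta> q)) \<le> 0"
          using beta'_nonneg[of x] x s q by (intro mult_nonneg_nonpos) auto
        then show ?thesis using deriv[of x] x s q by auto
      qed
    qed (use cont s q in \<open>auto intro: continuous_on_subset\<close>)
  next
    case False
    show ?thesis
    proof (rule DERIV_nonneg_imp_increasing_open[of q s f])
      show "\<exists>y. (f has_real_derivative y) (at x) \<and> 0 \<le> y" if x: "q < x" "x < s" for x
      proof -
        have "0 \<le> J q - J x - M * (\<beta> x - \<beta> q)"
          using J_drop[of q x] x s q by (simp add: algebra_simps)
        then have "0 \<le> \<beta>' x * (J q - J x - M * (\<beta> x - \<beta> q))"
          using beta'_nonneg[of x] x s q by (intro mult_nonneg_nonneg) auto
        then show ?thesis using deriv[of x] x s q by auto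
      qed
    qed (use cont s q False in \<open>auto intro: continuous_on_subset\<close>)
  qed
  then show ?thesis by (simp add: f_def algebra_simps)
qed

lemma convexity:
  assumes q: "0 < q" "q \<le> 1" and b: "0 \<le> b" "b \<le> bmax"
  shows "real (N - 1) * integral {q..1} w + (\<beta> q - b) * J q + M * (b - \<beta> q)\<^sup>2 / 2
           \<le> real (N - 1) * W b"
proof (cases "b \<le> \<beta> 1")
  case True
  then obtain s where "s \<in> {0..1}" "\<beta> s = b"
    using IVT'[of \<beta> 0 b 1] beta_0 beta_continuous b by auto
  then show ?thesis using convexity_beta[OF q, of s] W_beta[of s] by simp
next
  case False
  \<comment> \<open>Above \<beta> 1 no canonical bid wins and \<open>W\<close> stays 0, so the
    linear term with slope \<open>J q\<close> alone has to pay for the quadratic. It does, since M *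
    b \<le> M * bmax \<le> J 1 \<le> J q; this is what the element 1 / (v 1 * bmax) of
    \<open>const_C\<close> provides.\<close>
  define d where "d = b - \<beta> 1"
  have d: "0 \<le> d" using False by (simp add: d_def)
  have "M * b \<le> M * bmax" using M_nonneg b by (intro mult_left_mono) auto
  also have "\<dots> \<le> J q"
    using M_bmax J_drop[of q 1] q mult_nonneg_nonneg[OF M_nonneg, of "\<beta> 1 - \<beta> q"] beta_mono[of q 1]
    by simp
  finally have Mb: "M * b \<le> J q" .
  have "M * (b - \<beta> q)\<^sup>2 / 2 - M * (\<beta> 1 - \<beta> q)\<^sup>2 / 2 = d * (M * (b + \<beta> 1 - 2 * \<beta> q) / 2)"
    by (simp add: d_def power2_eq_square field_simps)
  also have "\<dots> \<le> d * (M * b)"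
  proof -
    have "M * (b + \<beta> 1 - 2 * \<beta> q) \<le> M * (2 * b)"
      using M_nonneg beta_nonneg[of q] q False by (intro mult_left_mono) auto
    then show ?thesis using d by (intro mult_left_mono) auto
  qed
  also have "\<dots> \<le> d * J q" using Mb d by (intro mult_left_mono)
  finally have "M * (b - \<beta> q)\<^sup>2 / 2 - M * (\<beta> 1 - \<beta> q)\<^sup>2 / 2 \<le> (b - \<beta> 1) * J q"
    by (simp add: d_def)
  moreover have "W b = 0" using W_above False by simp
  ultimately show ?thesis
    using convexity_beta[OF q, of 1] by (simp add: algebra_simps)
qed

lemma payment_integrable: "0 \<le> a \<Longrightarrow> b \<le> 1 \<Longrightarrow> (\<lambda>x. r x * m x * \<beta> x) integrable_on {a..b}"
proof (rule integrable_if_bounded_continuous[where c=1])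
  show "continuous_on {0<..1} (\<lambda>x. r x * m x * \<beta> x)"
    by (intro continuous_on_mult r_continuous_on m_continuous_on beta_continuous_on) auto
  show "\<bar>r x * m x * \<beta> x\<bar> \<le> 1" if "x \<in> {0..1}" for x
    using payment_bounds[of x] that by simp
qed

lemma weighted_w_integrable: "(\<lambda>q. q ^ (N - 1) * w q) integrable_on {0..1}"
proof (rule integrable_if_bounded_continuous[where c=1])
  show "continuous_on {0<..1} (\<lambda>q. q ^ (N - 1) * w q)"
    by (intro continuous_intros w_continuous)
  show "\<bar>q ^ (N - 1) * w q\<bar> \<le> 1" if "q \<in> {0..1}" for q
    using that w_bounds[of q] by (auto simp: abs_mult intro!: mult_le_one power_le_one)
qed auto

text \<open>Integration by parts. The boundary terms vanish because the tail integral is 0 at 1 and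
  N - 1 > 0. The right side is the weighted value of winning when type and quantile
  coincide.\<close>

lemma quantile_value:
  "integral {0..1} (\<lambda>q. real (N - 1) * q ^ (N - 2) * integral {q..1} w)
     = integral {0..1} (\<lambda>q. q ^ (N - 1) * w q)"
proof -
  define U where "U q = q ^ (N - 1) * integral {q..1} w" for q :: real
  have "((\<lambda>q. real (N - 1) * q ^ (N - 2) * integral {q..1} w - q ^ (N - 1) * w q)
      has_integral U 1 - U 0) {0..1}"
  proof (rule fundamental_theorem_of_calculus_interior)
    show "continuous_on {0..1} U"
      unfolding U_def by (intro continuous_intros tail_integral_continuous)
    fix x :: real assume "x \<in> {0<..<1}"
    then have x: "0 < x" "x < 1" by auto
    have "(U has_real_derivative
        real (N - 1) * x ^ (N - 2) * integral {x..1} w - x ^ (N - 1) * w x) (at x)"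
      unfolding U_def
      by (auto intro!: derivative_eq_intros tail_integral_deriv x simp: numeral_2_eq_2)
    then show "(U has_vector_derivative
        real (N - 1) * x ^ (N - 2) * integral {x..1} w - x ^ (N - 1) * w x) (at x)"
      by (simp add: has_real_derivative_iff_has_vector_derivative)
  qed simp
  moreover have "U 1 - U 0 = 0" using two_le_N by (simp add: U_def)
  ultimately have "integral {0..1}
      (\<lambda>q. real (N - 1) * q ^ (N - 2) * integral {q..1} w - q ^ (N - 1) * w q) = 0"
    by (simp add: integral_unique)
  moreover have "(\<lambda>q. real (N - 1) * q ^ (N - 2) * integral {q..1} w) integrable_on {0..1}"
    by (intro integrable_continuous_real continuous_intros tail_integral_continuous)
  ultimately show ?thesis using weighted_w_integrable by (simp add: Henstock_Kurzweil_Integration.integral_diff)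
qed

text \<open>If [h, h'] are the quantiles of \<open>b\<close>, the highest opposing bid is
  \<open>b\<close> with probability h'^(N-1) - h^(N-1), and (N-1) * q^(N-2) is the density of the
  highest opposing quantile. The claim is \<open>convexity\<close> times q^(N-2), integrated over
  these quantiles; \<open>J_eq\<close> turns the slope \<open>J\<close> into a payment. The
  hypothesis \<open>pos\<close> keeps \<open>r * m\<close> integrable whenever its coefficient
  \<open>b\<close> is not 0.\<close>

lemma deviation_value_cell:
  assumes h: "0 \<le> h" "h \<le> h'" "h' \<le> 1" and b: "0 \<le> b" "b \<le> bmax" and pos: "0 < b \<Longrightarrow> 0 < h"
  shows "integral {h..h'} (\<lambda>q. real (N - 1) * q ^ (N - 2) * integral {q..1} w + r q * m q * \<beta> q)
      - b * integral {h..h'} (\<lambda>q. r q * m q)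
      + M * integral {h..h'} (\<lambda>q. q ^ (N - 2) * ((b - \<beta> q)\<^sup>2 / 2))
    \<le> (h' ^ (N - 1) - h ^ (N - 1)) * W b"
proof -
  let ?A = "\<lambda>q. real (N - 1) * q ^ (N - 2) * integral {q..1} w + r q * m q * \<beta> q"
  have A: "?A integrable_on {h..h'}"
    by (intro integrable_add payment_integrable integrable_continuous_real continuous_intros
        continuous_on_subset[OF tail_integral_continuous]) (use h in auto)
  have R: "((\<lambda>q. b * (r q * m q)) has_integral b * integral {h..h'} (\<lambda>q. r q * m q)) {h..h'}"
  proof (cases "b = 0")
    case False
    then have "0 < h" using pos b by simp
    then show ?thesis
      by (intro has_integral_mult_right integrable_integral integrable_continuous_real
          continuous_intros r_continuous_on m_continuous_on) (use h in auto)
  qed simp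
  have Q: "(\<lambda>q. q ^ (N - 2) * ((b - \<beta> q)\<^sup>2 / 2)) integrable_on {h..h'}"
    by (intro integrable_continuous_real continuous_intros beta_continuous_on)
       (use h in auto)
  have lower: "((\<lambda>q. ?A q - b * (r q * m q) + M * (q ^ (N - 2) * ((b - \<beta> q)\<^sup>2 / 2))) has_integral
     integral {h..h'} ?A - b * integral {h..h'} (\<lambda>q. r q * m q)
      + M * integral {h..h'} (\<lambda>q. q ^ (N - 2) * ((b - \<beta> q)\<^sup>2 / 2))) {h..h'}"
    by (intro has_integral_add has_integral_diff has_integral_mult_right integrable_integral A R Q)
  have pw: "((\<lambda>q. real (N - 1) * q ^ (N - 2)) has_integral h' ^ (N - 1) - h ^ (N - 1)) {h..h'}"
  proof (rule fundamental_theorem_of_calculus[OF h(2)])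
    fix x :: real
    have "((\<lambda>q. q ^ (N - 1)) has_real_derivative real (N - 1) * x ^ (N - 2)) (at x within {h..h'})"
      by (auto intro!: derivative_eq_intros simp: numeral_2_eq_2)
    then show "((\<lambda>q. q ^ (N - 1)) has_vector_derivative real (N - 1) * x ^ (N - 2)) (at x within {h..h'})"
      by (simp add: has_real_derivative_iff_has_vector_derivative)
  qed
  have "((\<lambda>q. real (N - 1) * q ^ (N - 2) * W b) has_integral (h' ^ (N - 1) - h ^ (N - 1)) * W b) {h..h'}"
    by (rule has_integral_mult_left[OF pw])
  moreover have "?A q - b * (r q * m q) + M * (q ^ (N - 2) * ((b - \<beta> q)\<^sup>2 / 2))
      \<le> real (N - 1) * q ^ (N - 2) * W b" if q: "0 < q" "q \<le> 1" for q
  proof -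
    have "q ^ (N - 2) * (real (N - 1) * integral {q..1} w + (\<beta> q - b) * J q + M * (b - \<beta> q)\<^sup>2 / 2)
       \<le> q ^ (N - 2) * (real (N - 1) * W b)"
      by (rule mult_left_mono[OF convexity[OF q b]]) (use q in auto)
    moreover have "q ^ (N - 2) * ((\<beta> q - b) * J q) = (\<beta> q - b) * (r q * m q)"
      using J_eq[OF q] by (simp add: algebra_simps)
    ultimately show ?thesis by (simp add: algebra_simps)
  qed
  \<comment> \<open>The pointwise bound is available only for q > 0, so at the single point 0 the
    integrand is replaced by the upper bound itself.\<close>
  moreover have "((\<lambda>q. if q = 0 then real (N - 1) * q ^ (N - 2) * W b else
      ?A q - b * (r q * m q) + M * (q ^ (N - 2) * ((b - \<beta> q)\<^sup>2 / 2))) has_integral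
     integral {h..h'} ?A - b * integral {h..h'} (\<lambda>q. r q * m q)
      + M * integral {h..h'} (\<lambda>q. q ^ (N - 2) * ((b - \<beta> q)\<^sup>2 / 2))) {h..h'}"
    by (rule has_integral_spike_finite[OF _ _ lower, of "{0}"]) auto
  ultimately show ?thesis
    by (elim has_integral_le[rotated]) (use h in \<open>auto simp: less_le\<close>)
qed

end

section \<open>Quantile cells and the distribution of bids\<close>

text \<open>The types between \<open>t k\<close> and \<open>t (Suc k)\<close> all bid
  \<open>s k\<close>, and \<open>s\<close> need not be monotone. Sorting the types by their bids
  gives \<open>b\<close> the quantiles from \<open>below b\<close> to \<open>upto b\<close>, an
  interval of length \<open>mass b\<close>.\<close>

locale bid_cells =
  fixes K :: nat and t s :: "nat \<Rightarrow> real"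
  assumes t_0: "t 0 = 0" and t_last: "t (Suc K) = 1"
    and t_less: "\<And>k. k \<le> K \<Longrightarrow> t k < t (Suc k)"
begin

definition bids :: "real set" where "bids = s ` {..K}"
definition mass :: "real \<Rightarrow> real" where "mass b = (\<Sum>k\<in>{k\<in>{..K}. s k = b}. t (Suc k) - t k)"
definition below :: "real \<Rightarrow> real" where "below b = (\<Sum>k\<in>{k\<in>{..K}. s k < b}. t (Suc k) - t k)"
definition upto :: "real \<Rightarrow> real" where "upto b = (\<Sum>k\<in>{k\<in>{..K}. s k \<le> b}. t (Suc k) - t k)"

lemma finite_bids [simp]: "finite bids"
  by (simp add: bids_def)

lemma sum_bids:
  "(\<Sum>b\<in>{b \<in> bids. Q b}. \<Sum>k\<in>{k\<in>{..K}. s k = b}. f k) = (\<Sum>k\<in>{k\<in>{..K}. Q (s k)}. f k :: real)"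
proof -
  have "{k \<in> {..K}. s k = b} = {k \<in> {k \<in> {..K}. Q (s k)}. s k = b}" if "Q b" for b
    using that by auto
  then have "(\<Sum>b\<in>{b \<in> bids. Q b}. \<Sum>k\<in>{k\<in>{..K}. s k = b}. f k)
     = (\<Sum>b\<in>{b \<in> bids. Q b}. \<Sum>k\<in>{k\<in>{k\<in>{..K}. Q (s k)}. s k = b}. f k)"
    by (intro sum.cong) auto
  also have "\<dots> = (\<Sum>k\<in>{k\<in>{..K}. Q (s k)}. f k)"
    by (intro sum.group) (auto simp: bids_def)
  finally show ?thesis .
qed

lemma sum_bids_all: "(\<Sum>b\<in>bids. \<Sum>k\<in>{k\<in>{..K}. s k = b}. f k) = (\<Sum>k\<le>K. f k :: real)"
  using sum_bids[where Q="\<lambda>_. True" and f=f] by (simp add: atMost_def)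

lemma below_eq: "below b = sum mass {b' \<in> bids. b' < b}"
  unfolding below_def mass_def by (rule sum_bids[symmetric])

lemma upto_eq: "upto b = sum mass {b' \<in> bids. b' \<le> b}"
  unfolding upto_def mass_def by (rule sum_bids[symmetric])

lemma sum_lengths: "(\<Sum>k\<le>K. t (Suc k) - t k) = 1"
  using sum_lessThan_telescope[of t "Suc K"] t_0 t_last by (simp add: lessThan_Suc_atMost)

lemma sum_mass: "sum mass bids = 1"
  unfolding mass_def by (simp only: sum_bids_all sum_lengths)

lemma mass_pos: "b \<in> bids \<Longrightarrow> 0 < mass b"
  unfolding mass_def bids_def by (rule sum_pos) (auto simp: t_less)

lemma mass_nonneg: "0 \<le> mass b"
  unfolding mass_def by (rule sum_nonneg) (auto simp: t_less less_imp_le)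

lemma upto_eq_below: "upto b = below b + mass b"
proof -
  have "{k\<in>{..K}. s k \<le> b} = {k\<in>{..K}. s k < b} \<union> {k\<in>{..K}. s k = b}" by auto
  then show ?thesis
    unfolding upto_def below_def mass_def by (simp add: sum.union_disjoint[symmetric] disjoint_iff)
qed

lemma below_nonneg: "0 \<le> below b"
  unfolding below_def by (rule sum_nonneg) (auto simp: t_less less_imp_le)

lemma upto_le_1: "upto b \<le> 1"
  unfolding sum_lengths[symmetric] upto_def
  by (rule sum_mono2) (auto simp: t_less less_imp_le)

lemma below_mono: "b \<le> b' \<Longrightarrow> below b \<le> below b'"
  unfolding below_def by (rule sum_mono2) (auto simp: t_less less_imp_le)

lemma below_le_upto: "below b \<le> upto b"
  using upto_eq_below mass_nonneg[of b] by simp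

lemma sum_telescope_all: "(\<Sum>b\<in>bids. g (upto b) - g (below b)) = g 1 - g 0" for g :: "real \<Rightarrow> real"
  unfolding upto_eq below_eq sum_mass[symmetric] by (rule sum_telescope_cumulative) simp

lemma sum_telescope_below:
  "(\<Sum>b\<in>{b\<in>bids. b < u}. g (upto b) - g (below b)) = g (below u) - g 0" for g :: "real \<Rightarrow> real"
proof -
  let ?B = "{b\<in>bids. b < u}"
  have "(\<Sum>b\<in>?B. g (sum mass {b' \<in> ?B. b' \<le> b}) - g (sum mass {b' \<in> ?B. b' < b}))
      = g (sum mass ?B) - g 0"
    by (rule sum_telescope_cumulative) simp
  moreover have "{b' \<in> ?B. b' \<le> b} = {b' \<in> bids. b' \<le> b}" "{b' \<in> ?B. b' < b} = {b' \<in> bids. b' < b}"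
    if "b < u" for b using that by auto
  ultimately show ?thesis unfolding upto_eq below_eq by simp
qed

lemma sum_telescope_above:
  "(\<Sum>b\<in>{b\<in>bids. u \<le> b}. g (upto b) - g (below b)) = g 1 - g (below u)" for g :: "real \<Rightarrow> real"
proof -
  have "bids = {b\<in>bids. b < u} \<union> {b\<in>bids. u \<le> b}" by auto
  then have "(\<Sum>b\<in>bids. g (upto b) - g (below b)) =
     (\<Sum>b\<in>{b\<in>bids. b < u}. g (upto b) - g (below b)) + (\<Sum>b\<in>{b\<in>bids. u \<le> b}. g (upto b) - g (below b))"
    by (subst sum.union_disjoint[symmetric]) auto
  then show ?thesis using sum_telescope_all[of g] sum_telescope_below[of g u] by simp
qed

lemma t_le: "i \<le> j \<Longrightarrow> j \<le> Suc K \<Longrightarrow> t i \<le> t j"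
proof (induction j)
  case (Suc j)
  then show ?case using t_less[of j] by (cases "i = Suc j") auto
qed simp

lemma t_range: "k \<le> Suc K \<Longrightarrow> 0 \<le> t k \<and> t k \<le> 1"
  using t_le[of 0 k] t_le[of k "Suc K"] t_0 t_last by simp

lemma sum_integral_cells:
  fixes f :: "real \<Rightarrow> real"
  assumes "f integrable_on {0..1}"
  shows "(\<Sum>k\<le>K. integral {t k..t (Suc k)} f) = integral {0..1} f"
proof -
  have "(f has_integral (\<Sum>k<Suc K. integral {t k..t (Suc k)} f)) {t 0..t (Suc K)}"
  proof (rule has_integral_piecewise[where g="\<lambda>_. f"])
    fix k assume "k < Suc K"
    then show "(f has_integral integral {t k..t (Suc k)} f) {t k..t (Suc k)}"
      using integrable_on_subinterval[OF assms] t_range by (intro integrable_integral) auto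
  qed (use t_less in auto)
  then show ?thesis
    by (simp only: t_0 t_last lessThan_Suc_atMost integral_unique)
qed

text \<open>Minus the tail integral up to 1 is the antiderivative that telescopes. Starting at
  \<open>below u\<close> instead of 0 admits integrands that are singular at 0.\<close>

lemma sum_integral_quantile_cells:
  fixes f :: "real \<Rightarrow> real"
  assumes "f integrable_on {below u..1}"
  shows "(\<Sum>b\<in>{b\<in>bids. u \<le> b}. integral {below b..upto b} f) = integral {below u..1} f"
proof -
  have "integral {below b..upto b} f = - integral {upto b..1} f - (- integral {below b..1} f)"
    if "u \<le> b" for b
  proof -
    have "f integrable_on {below b..1}"
      by (rule integrable_on_subinterval[OF assms]) (use that below_mono in auto)
    then have "integral {below b..upto b} f + integral {upto b..1} f = integral {below b..1} f"
      by (intro Henstock_Kurzweil_Integration.integral_combine below_le_upto upto_le_1)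
    then show ?thesis by simp
  qed
  then have "(\<Sum>b\<in>{b\<in>bids. u \<le> b}. integral {below b..upto b} f)
     = (\<Sum>b\<in>{b\<in>bids. u \<le> b}. - integral {upto b..1} f - (- integral {below b..1} f))"
    by (intro sum.cong) auto
  also have "\<dots> = integral {below u..1} f"
    by (subst sum_telescope_above) (simp add: integral_refl)
  finally show ?thesis .
qed

end

section \<open>Rearrangement layer by layer\<close>

text \<open>\<open>\<rho> b\<close> is the mean of \<open>r\<close> over the quantiles of
  \<open>b\<close>. In the first-price format this is the probability of winning with
  \<open>b\<close> under uniform tie-breaking, in the all-pay format it is 1, so b * \<rho> b is the
  expected payment in both. \<open>s_0\<close> gives positive bids positive quantiles, where
  \<open>m\<close> is continuous.\<close>

locale layers = dual_core + bid_cells +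
  fixes \<rho> :: "real \<Rightarrow> real"
  assumes s_0: "s 0 = 0"
    and s_range: "\<And>k. k \<le> K \<Longrightarrow> 0 \<le> s k \<and> s k \<le> bmax"
    and rho_eq: "\<And>b. b \<in> bids \<Longrightarrow> \<rho> b * mass b = integral {below b..upto b} r"
begin

lemma r_mono: "0 \<le> x \<Longrightarrow> x \<le> y \<Longrightarrow> r x \<le> r y"
  by (rule DERIV_nonneg_imp_nondecreasing[of x y r]) (use r_deriv r'_nonneg in \<open>auto intro!: exI\<close>)

lemma below_pos: "0 < u \<Longrightarrow> 0 < below u"
  unfolding below_def by (rule sum_pos2[of _ 0]) (auto simp: s_0 t_less less_imp_le)

text \<open>A lower bound for the transport cost \<open>r q * m x + M * kf x\<close> between a quantile \<open>q\<close> and a type \<open>x\<close> by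
  potentials \<open>\<phi> q + \<psi> x\<close> with equality at \<open>x = q\<close>: here \<open>\<phi> = G - P\<close>, and \<open>\<psi>\<close> vanishes up to the
  quantile of \<open>u\<close> and decreases from there.\<close>

lemma layer_payment:
  assumes u: "u \<in> bids" "0 < u"
  shows "integral {below u..1} (\<lambda>q. r q * m q + M * (q ^ (N - 2) * \<beta> q))
    \<le> (\<Sum>k\<in>{k\<in>{..K}. u \<le> s k}.
          integral {t k..t (Suc k)} (\<lambda>x. \<rho> (s k) * m x + M * (x ^ (N - 2) * \<beta> x)))"
proof -
  define c where "c = below u"
  define kf where "kf x = x ^ (N - 2) * \<beta> x" for x
  define G where "G x = r x * m x + M * kf x" for x
  \<comment> \<open>The derivative r * m' + M * k' of \<open>P\<close> is the derivative of the
    transport cost in the type, taken at x = q. The other potential G - P then has derivative r' *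
    m, the one in the quantile.\<close>
  define P where "P x = G x - G c - integral {c..x} (\<lambda>y. r' y * m y)" for x
  define \<psi> where "\<psi> x = P (max c x)" for x
  have c0: "0 < c" unfolding c_def using below_pos u by simp
  have c1: "c < 1" unfolding c_def using mass_pos[OF u(1)] upto_le_1[of u] upto_eq_below[of u] by simp
  have kf_cont: "continuous_on S kf" if "S \<subseteq> {0..1}" for S
    unfolding kf_def by (intro continuous_intros beta_continuous_on that)
  have G_cont: "continuous_on S G" if "S \<subseteq> {0<..1}" for S
    unfolding G_def by (intro continuous_intros r_continuous_on m_continuous_on kf_cont that) (use that in auto)
  have r'm_cont: "continuous_on {c..1} (\<lambda>y. r' y * m y)"
    by (intro continuous_intros m_continuous_on continuous_on_subset[OF r'_continuous]) (use c0 in auto)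
  have P_cont: "continuous_on {c..1} P"
    unfolding P_def
    by (intro continuous_intros G_cont indefinite_integral_continuous_1 integrable_continuous_real r'm_cont)
       (use c0 in auto)
  have \<psi>_cont: "continuous_on {0..1} \<psi>"
    unfolding \<psi>_def
    by (rule continuous_on_compose2[OF P_cont]) (use c1 in \<open>auto intro!: continuous_intros\<close>)
  have kf_deriv: "(kf has_real_derivative k' x) (at x)" if "0 < x" "x < 1" for x
    unfolding kf_def using k_deriv that by auto
  have P_deriv: "(P has_real_derivative r x * m' x + M * k' x) (at x)" if x: "c < x" "x < 1" for x
  proof -
    have "((\<lambda>x. integral {c..x} (\<lambda>y. r' y * m y)) has_real_derivative r' x * m x) (at x within {c..1})"
      by (rule integral_has_real_derivative[OF r'm_cont]) (use x in auto)
    then have "((\<lambda>x. integral {c..x} (\<lambda>y. r' y * m y)) has_real_derivative r' x * m x) (at x)"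
      using x by (simp add: at_within_Icc_at)
    then show ?thesis
      unfolding P_def G_def using x c0
      by (auto intro!: derivative_eq_intros r_deriv m_deriv kf_deriv)
  qed
  have P_c: "P c = 0" by (simp add: P_def)
  \<comment> \<open>\<open>D_bound\<close> makes \<open>P\<close> decrease from 0. This sign is what
    later allows the types outside the layer to be added.\<close>
  have P_nonpos: "P x \<le> 0" if "c \<le> x" "x \<le> 1" for x
  proof -
    have "P x \<le> P c"
    proof (rule DERIV_nonpos_imp_decreasing_open[OF that(1)])
      fix y assume "c < y" "y < x"
      then show "\<exists>z. (P has_real_derivative z) (at y) \<and> z \<le> 0"
        using P_deriv[of y] D_bound[of y] that c0 by auto
    qed (use that P_cont in \<open>auto intro: continuous_on_subset\<close>)
    then show ?thesis using P_c by simp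
  qed
  have \<psi>_nonpos: "\<psi> x \<le> 0" if "x \<le> 1" for x
    unfolding \<psi>_def using P_nonpos[of "max c x"] c1 that by simp
  have coupling: "G q - P q \<le> r q * m x + M * kf x - \<psi> x" if q: "c \<le> q" "q \<le> 1" and x: "0 < x" "x \<le> 1" for q x
  proof -
    define Z where "Z x = r q * m x + M * kf x - P x" for x
    have Z_cont: "continuous_on {c..1} Z"
      unfolding Z_def by (intro continuous_intros m_continuous_on kf_cont P_cont) (use c0 in auto)
    have Z_deriv: "(Z has_real_derivative (r q - r y) * m' y) (at y)" if "c < y" "y < 1" for y
      unfolding Z_def using that c0
      by (auto intro!: derivative_eq_intros m_deriv kf_deriv P_deriv simp: algebra_simps)
    \<comment> \<open>As \<open>r\<close> increases and \<open>m\<close> decreases, the slope (r q -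
      r y) * m' y is nonpositive before \<open>q\<close> and nonnegative after it: the cost is
      submodular, so pairing equal quantile and type is optimal.\<close>
    have Z_min: "Z q \<le> Z y" if y: "c \<le> y" "y \<le> 1" for y
    proof (cases "y \<le> q")
      case True
      show ?thesis
      proof (rule DERIV_nonpos_imp_decreasing_open[OF True])
        fix z assume z: "y < z" "z < q"
        have "(r q - r z) * m' z \<le> 0"
          using r_mono[of z q] m'_nonpos[of z] z y q c0 by (intro mult_nonneg_nonpos) auto
        then show "\<exists>d. (Z has_real_derivative d) (at z) \<and> d \<le> 0"
          using Z_deriv[of z] z y q by auto
      qed (use q y Z_cont in \<open>auto intro: continuous_on_subset\<close>)
    next
      case False
      then have "q \<le> y" by simp
      then show ?thesis
      proof (rule DERIV_nonneg_imp_increasing_open)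
        fix z assume z: "q < z" "z < y"
        have "0 \<le> (r q - r z) * m' z"
          using r_mono[of q z] m'_nonpos[of z] z y q c0 by (intro mult_nonpos_nonpos) auto
        then show "\<exists>d. (Z has_real_derivative d) (at z) \<and> 0 \<le> d"
          using Z_deriv[of z] z y q by auto
      qed (use q y Z_cont in \<open>auto intro: continuous_on_subset\<close>)
    qed
    have "Z q \<le> r q * m x + M * kf x - \<psi> x"
    proof (cases "c \<le> x")
      case True
      then show ?thesis using Z_min[OF True x(2)] by (simp add: \<psi>_def Z_def)
    next
      case False
      \<comment> \<open>Left of \<open>c\<close> the potential \<psi> is constantly 0. The cost
        falls towards \<open>c\<close> there, since r q \<ge> r y only strengthens
        \<open>D_bound\<close>, so moving the type up to \<open>c\<close> leads back to the previous
        case.\<close>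
      have "r q * m c + M * kf c \<le> r q * m x + M * kf x"
      proof (rule DERIV_nonpos_imp_decreasing_open[of x c "\<lambda>x. r q * m x + M * kf x"])
        fix y assume y: "x < y" "y < c"
        have "r q * m' y \<le> r y * m' y"
          using r_mono[of y q] m'_nonpos[of y] y x q c1 by (intro mult_right_mono_neg) auto
        then have "r q * m' y + M * k' y \<le> 0"
          using D_bound[of y] y x c1 by simp
        moreover have "((\<lambda>x. r q * m x + M * kf x) has_real_derivative r q * m' y + M * k' y) (at y)"
          using y x c1 by (auto intro!: derivative_eq_intros m_deriv kf_deriv)
        ultimately show "\<exists>d. ((\<lambda>x. r q * m x + M * kf x) has_real_derivative d) (at y) \<and> d \<le> 0" by blast
      next
        show "continuous_on {x..c} (\<lambda>x. r q * m x + M * kf x)"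
          by (intro continuous_intros m_continuous_on kf_cont) (use x c1 in auto)
      qed (use False in simp)
      moreover have "Z c = r q * m c + M * kf c" "\<psi> x = 0" using P_c False by (auto simp: Z_def \<psi>_def)
      ultimately show ?thesis using Z_min[of c] c1 by simp
    qed
    then show ?thesis by (simp add: Z_def G_def)
  qed
  define I where "I k = integral {t k..t (Suc k)} (\<lambda>x. \<rho> (s k) * m x + M * kf x)" for k
  have GP_cont: "continuous_on {c..1} (\<lambda>q. G q - P q)"
    by (intro continuous_intros G_cont P_cont) (use c0 in auto)
  \<comment> \<open>The quantiles of \<open>b\<close> and the types bidding \<open>b\<close> have
    the same total length \<open>mass b\<close> and are coupled independently. Averaging
    \<open>coupling\<close> over the quantiles for a fixed type turns \<open>r\<close> into
    \<open>\<rho> b\<close>; integrating over the types then leaves a common factor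
    \<open>mass b\<close>, which cancels.\<close>
  have bid_layer: "integral {below b..upto b} (\<lambda>q. G q - P q)
      \<le> (\<Sum>k\<in>{k\<in>{..K}. s k = b}. I k - integral {t k..t (Suc k)} \<psi>)" if b: "b \<in> bids" "u \<le> b" for b
  proof -
    define \<Phi> where "\<Phi> = integral {below b..upto b} (\<lambda>q. G q - P q)"
    have cb: "c \<le> below b" using below_mono[OF b(2)] by (simp add: c_def)
    have sub: "{below b..upto b} \<subseteq> {c..1}" using cb upto_le_1[of b] by auto
    have point: "\<Phi> \<le> mass b * (\<rho> b * m x + M * kf x - \<psi> x)" if x: "0 < x" "x \<le> 1" for x
    proof -
      have "\<Phi> \<le> integral {below b..upto b} (\<lambda>q. r q * m x + (M * kf x - \<psi> x))"
        unfolding \<Phi>_def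
      proof (rule integral_le)
        show "(\<lambda>q. G q - P q) integrable_on {below b..upto b}"
          by (intro integrable_continuous_real continuous_on_subset[OF GP_cont] sub)
        show "(\<lambda>q. r q * m x + (M * kf x - \<psi> x)) integrable_on {below b..upto b}"
          by (intro integrable_continuous_real continuous_intros r_continuous_on)
        fix q assume "q \<in> {below b..upto b}"
        then have "c \<le> q" "q \<le> 1" using sub by auto
        then show "G q - P q \<le> r q * m x + (M * kf x - \<psi> x)"
          using coupling[of q x] x by simp
      qed
      also have "\<dots> = integral {below b..upto b} r * m x + mass b * (M * kf x - \<psi> x)"
      proof -
        have "((\<lambda>q. r q * m x + (M * kf x - \<psi> x)) has_integral
           integral {below b..upto b} r * m x + (upto b - below b) * (M * kf x - \<psi> x)) {below b..upto b}"
          using has_integral_const_real[of "M * kf x - \<psi> x" "below b" "upto b"] below_le_upto[of b]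
          by (intro has_integral_add has_integral_mult_left integrable_integral
               integrable_continuous_real r_continuous_on) auto
        then show ?thesis by (simp add: integral_unique upto_eq_below)
      qed
      also have "\<dots> = mass b * (\<rho> b * m x + M * kf x - \<psi> x)"
        by (simp add: rho_eq[OF b(1), symmetric] algebra_simps)
      finally show ?thesis .
    qed
    have cell: "(t (Suc k) - t k) * \<Phi> \<le> mass b * (I k - integral {t k..t (Suc k)} \<psi>)"
      if k: "k \<le> K" "s k = b" for k
    proof -
      have "k \<noteq> 0" using k u b s_0 by (metis leD)
      then have tk: "0 < t k" using t_le[of 1 k] t_less[of 0] t_0 k by simp
      have tk': "t (Suc k) \<le> 1" using t_range[of "Suc k"] k by simp
      have i1: "(\<lambda>x. \<rho> b * m x + M * kf x) integrable_on {t k..t (Suc k)}"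
        by (intro integrable_continuous_real continuous_intros m_continuous_on kf_cont)
           (use tk tk' in auto)
      have i2: "\<psi> integrable_on {t k..t (Suc k)}"
        by (intro integrable_continuous_real continuous_on_subset[OF \<psi>_cont]) (use tk tk' in auto)
      have "((\<lambda>x. mass b * (\<rho> b * m x + M * kf x - \<psi> x)) has_integral
          mass b * (I k - integral {t k..t (Suc k)} \<psi>)) {t k..t (Suc k)}"
        unfolding I_def k(2)
        by (intro has_integral_mult_right has_integral_diff integrable_integral i1 i2)
      moreover have "((\<lambda>x. \<Phi>) has_integral (t (Suc k) - t k) * \<Phi>) {t k..t (Suc k)}"
        using has_integral_const_real[of \<Phi> "t k" "t (Suc k)"] t_less[OF k(1)] by simp
      ultimately show ?thesis
        by (elim has_integral_le[rotated]) (use point tk tk' in auto)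
    qed
    have "mass b * \<Phi> = (\<Sum>k\<in>{k\<in>{..K}. s k = b}. (t (Suc k) - t k) * \<Phi>)"
      by (simp add: mass_def sum_distrib_right)
    also have "\<dots> \<le> (\<Sum>k\<in>{k\<in>{..K}. s k = b}. mass b * (I k - integral {t k..t (Suc k)} \<psi>))"
      by (rule sum_mono) (use cell in auto)
    also have "\<dots> = mass b * (\<Sum>k\<in>{k\<in>{..K}. s k = b}. I k - integral {t k..t (Suc k)} \<psi>)"
      by (simp add: sum_distrib_left)
    finally show ?thesis
      using mass_pos[OF b(1)] by (simp add: \<Phi>_def)
  qed
  have \<psi>_int: "\<psi> integrable_on {0..1}"
    by (rule integrable_continuous_real[OF \<psi>_cont])
  have "integral {c..1} (\<lambda>q. G q - P q)
      = (\<Sum>b\<in>{b\<in>bids. u \<le> b}. integral {below b..upto b} (\<lambda>q. G q - P q))"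
    unfolding c_def
    by (rule sum_integral_quantile_cells[symmetric])
       (use GP_cont in \<open>auto simp: c_def intro!: integrable_continuous_real\<close>)
  also have "\<dots> \<le> (\<Sum>b\<in>{b\<in>bids. u \<le> b}. \<Sum>k\<in>{k\<in>{..K}. s k = b}. I k - integral {t k..t (Suc k)} \<psi>)"
    by (rule sum_mono) (use bid_layer in auto)
  also have "\<dots> = (\<Sum>k\<in>{k\<in>{..K}. u \<le> s k}. I k - integral {t k..t (Suc k)} \<psi>)"
    by (rule sum_bids)
  also have "\<dots> = (\<Sum>k\<in>{k\<in>{..K}. u \<le> s k}. I k) - (\<Sum>k\<in>{k\<in>{..K}. u \<le> s k}. integral {t k..t (Suc k)} \<psi>)"
    by (rule sum_subtractf)
  \<comment> \<open>Types outside the layer contribute -\<psi> \<ge> 0. With all cells included the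
    sum depends on the profile only through \<open>c\<close>.\<close>
  also have "(\<Sum>k\<in>{k\<in>{..K}. u \<le> s k}. - integral {t k..t (Suc k)} \<psi>) \<le> (\<Sum>k\<le>K. - integral {t k..t (Suc k)} \<psi>)"
  proof (rule sum_mono2)
    fix k assume "k \<in> {..K} - {k\<in>{..K}. u \<le> s k}"
    then have "integral {t k..t (Suc k)} \<psi> \<le> integral {t k..t (Suc k)} (\<lambda>x. 0)"
      using t_range[of k] t_range[of "Suc k"]
      by (intro integral_le integrable_on_subinterval[OF \<psi>_int]) (auto intro!: \<psi>_nonpos)
    then show "0 \<le> - integral {t k..t (Suc k)} \<psi>" by simp
  qed auto
  then have "(\<Sum>k\<in>{k\<in>{..K}. u \<le> s k}. I k) - (\<Sum>k\<in>{k\<in>{..K}. u \<le> s k}. integral {t k..t (Suc k)} \<psi>)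
      \<le> (\<Sum>k\<in>{k\<in>{..K}. u \<le> s k}. I k) - integral {0..1} \<psi>"
    using sum_integral_cells[OF \<psi>_int] by (simp add: sum_negf)
  also have "integral {0..1} \<psi> = integral {c..1} P"
  proof -
    have "integral {0..c} \<psi> = integral {0..c} (\<lambda>_. 0)"
      by (rule integral_cong) (auto simp: \<psi>_def P_c max_def)
    moreover have "integral {c..1} \<psi> = integral {c..1} P"
      by (rule integral_cong) (auto simp: \<psi>_def max_def)
    ultimately show ?thesis
      using Henstock_Kurzweil_Integration.integral_combine[of 0 c 1 \<psi>] \<psi>_int c0 c1 by simp
  qed
  finally have "integral {c..1} (\<lambda>q. G q - P q) + integral {c..1} P \<le> (\<Sum>k\<in>{k\<in>{..K}. u \<le> s k}. I k)"
    by simp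
  moreover have "integral {c..1} (\<lambda>q. G q - P q) = integral {c..1} G - integral {c..1} P"
    by (intro Henstock_Kurzweil_Integration.integral_diff integrable_continuous_real P_cont G_cont) (use c0 in auto)
  moreover have "G = (\<lambda>q. r q * m q + M * (q ^ (N - 2) * \<beta> q))"
    by (simp add: G_def kf_def fun_eq_iff)
  ultimately show ?thesis
    by (simp add: I_def kf_def c_def)
qed

end

section \<open>Bathtub estimate for the square term\<close>

context bid_cells
begin

text \<open>The types bidding at least \<open>u\<close> have total length 1 - below u, and among
  sets of that length the top interval has the largest integral of an increasing function.
  Subtracting the value at the cutoff and passing to the positive part \<open>h\<close> allows the
  sum to be extended to all cells.\<close>

lemma layer_weight:
  assumes "0 \<le> u"
  shows "(\<Sum>k\<in>{k\<in>{..K}. u \<le> s k}. integral {t k..t (Suc k)} (\<lambda>x. x ^ n))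
    \<le> integral {below u..1} (\<lambda>x. x ^ n)"
proof -
  define c where "c = below u"
  define h where "h x = max (x ^ n - c ^ n) 0" for x :: real
  have c: "0 \<le> c" "c \<le> 1"
    using below_nonneg[of u] below_le_upto[of u] upto_le_1[of u] by (auto simp: c_def)
  have h_int: "h integrable_on {a..b}" for a b
    unfolding h_def by (intro integrable_continuous_real continuous_intros)
  have p_int: "(\<lambda>x::real. x ^ n) integrable_on {a..b}" for a b
    by (intro integrable_continuous_real continuous_intros)
  have cell: "integral {t k..t (Suc k)} (\<lambda>x. x ^ n) - (t (Suc k) - t k) * c ^ n \<le> integral {t k..t (Suc k)} h"
    if "k \<le> K" for k
  proof -
    have "((\<lambda>x. x ^ n - c ^ n) has_integral
        integral {t k..t (Suc k)} (\<lambda>x. x ^ n) - (t (Suc k) - t k) * c ^ n) {t k..t (Suc k)}"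
      using has_integral_const_real[of "c ^ n" "t k" "t (Suc k)"] t_less[OF that]
      by (intro has_integral_diff integrable_integral p_int) auto
    then show ?thesis
      by (rule has_integral_le[OF _ integrable_integral[OF h_int]]) (simp add: h_def)
  qed
  have "(\<Sum>k\<in>{k\<in>{..K}. u \<le> s k} \<union> {k\<in>{..K}. s k < u}. t (Suc k) - t k) =
      (\<Sum>k\<in>{k\<in>{..K}. u \<le> s k}. t (Suc k) - t k) + (\<Sum>k\<in>{k\<in>{..K}. s k < u}. t (Suc k) - t k)"
    by (rule sum.union_disjoint) auto
  also have "{k\<in>{..K}. u \<le> s k} \<union> {k\<in>{..K}. s k < u} = {..K}" by auto
  finally have len: "(\<Sum>k\<in>{k\<in>{..K}. u \<le> s k}. t (Suc k) - t k) = 1 - c"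
    unfolding sum_lengths by (simp add: c_def below_def)
  have "(\<Sum>k\<in>{k\<in>{..K}. u \<le> s k}. integral {t k..t (Suc k)} (\<lambda>x. x ^ n)) - (1 - c) * c ^ n
     = (\<Sum>k\<in>{k\<in>{..K}. u \<le> s k}. integral {t k..t (Suc k)} (\<lambda>x. x ^ n) - (t (Suc k) - t k) * c ^ n)"
    unfolding len[symmetric] sum_distrib_right by (rule sum_subtractf[symmetric])
  also have "\<dots> \<le> (\<Sum>k\<in>{k\<in>{..K}. u \<le> s k}. integral {t k..t (Suc k)} h)"
    by (rule sum_mono) (use cell in auto)
  also have "\<dots> \<le> (\<Sum>k\<le>K. integral {t k..t (Suc k)} h)"
    by (rule sum_mono2) (auto intro!: integral_nonneg h_int simp: h_def)
  also have "\<dots> = integral {0..1} h"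
    by (rule sum_integral_cells[OF h_int])
  also have "\<dots> = integral {0..c} h + integral {c..1} h"
    by (rule Henstock_Kurzweil_Integration.integral_combine[symmetric]) (use c h_int in auto)
  also have "integral {0..c} h = integral {0..c} (\<lambda>_. 0)"
    by (rule integral_cong) (auto simp: h_def max_def intro: antisym power_mono)
  also have "integral {c..1} h = integral {c..1} (\<lambda>x. x ^ n - c ^ n)"
    by (rule integral_cong) (use c in \<open>auto simp: h_def max_def intro: antisym power_mono\<close>)
  also have "\<dots> = integral {c..1} (\<lambda>x. x ^ n) - (1 - c) * c ^ n"
    using c p_int[of c 1] by (subst Henstock_Kurzweil_Integration.integral_diff) auto
  finally show ?thesis by (simp add: c_def)
qed

end

section \<open>The duality inequality for one symmetric profile\<close>

context layers
begin

text \<open>For fixed \<open>x\<close> the increments over the bids below \<beta> x telescope to the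
  probability that all N - 1 opponents bid strictly less than \<beta> x.\<close>

lemma value_below_eq:
  "((\<lambda>x. below (\<beta> x) ^ (N - 1) * w x) has_integral
     (\<Sum>b\<in>bids. (upto b ^ (N - 1) - below b ^ (N - 1)) * W b)) {0..1}"
proof -
  have nonneg: "0 \<le> b" if "b \<in> bids" for b
    using that s_range by (auto simp: bids_def)
  have "((\<lambda>x. \<Sum>b\<in>bids. (upto b ^ (N - 1) - below b ^ (N - 1)) * (if b < \<beta> x then w x else 0)) has_integral
     (\<Sum>b\<in>bids. (upto b ^ (N - 1) - below b ^ (N - 1)) * W b)) {0..1}"
    unfolding W_def
    by (intro has_integral_sum has_integral_mult_right integrable_integral integrable_W nonneg) auto
  moreover have "(\<Sum>b\<in>bids. (upto b ^ (N - 1) - below b ^ (N - 1)) * (if b < \<beta> x then w x else 0))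
      = below (\<beta> x) ^ (N - 1) * w x" for x
  proof -
    have "(\<Sum>b\<in>bids. (upto b ^ (N - 1) - below b ^ (N - 1)) * (if b < \<beta> x then w x else 0))
       = (\<Sum>b\<in>{b\<in>bids. b < \<beta> x}. (upto b ^ (N - 1) - below b ^ (N - 1)) * w x)"
      by (rule sum.mono_neutral_cong_right) auto
    also have "\<dots> = below (\<beta> x) ^ (N - 1) * w x"
      using sum_telescope_below[of "\<lambda>x. x ^ (N - 1)" "\<beta> x"] two_le_N
      by (simp add: sum_distrib_right[symmetric])
    finally show ?thesis .
  qed
  ultimately show ?thesis by simp
qed

lemma below_0: "below 0 = 0"
  unfolding below_def using s_range by (intro sum.neutral) force

text \<open>The bounds of \<open>deviation_value_cell\<close> are summed over all bids, which places
  the quadratic form at quantiles, and it is then moved to types. Of its three terms, the square of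
  \<beta> has the same total in both places, the square of the bid can only decrease by
  \<open>layer_weight\<close>, and the cross term is treated jointly with the payments by
  \<open>layer_payment\<close>. The coefficients b and b^2 / 2 are monotone, so layers
  suffice.\<close>

theorem duality_gap:
  "M * (\<Sum>k\<le>K. integral {t k..t (Suc k)} (\<lambda>x. x ^ (N - 2) * ((s k - \<beta> x)\<^sup>2 / 2)))
      + integral {0..1} (\<lambda>x. x ^ (N - 1) * w x + r x * m x * \<beta> x)
    \<le> integral {0..1} (\<lambda>x. below (\<beta> x) ^ (N - 1) * w x)
      + (\<Sum>k\<le>K. s k * (\<rho> (s k) * integral {t k..t (Suc k)} m))"
proof -
  define qi where "qi f b = integral {below b..upto b} f" for f :: "real \<Rightarrow> real" and b
  define ci where "ci f k = integral {t k..t (Suc k)} f" for f :: "real \<Rightarrow> real" and k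
  define cb where "cb f b = (\<Sum>k\<in>{k\<in>{..K}. s k = b}. ci f k)" for f b
  define rm where "rm x = r x * m x" for x
  define kf where "kf x = x ^ (N - 2) * \<beta> x" for x
  define sq where "sq x = x ^ (N - 2) * ((\<beta> x)\<^sup>2 / 2)" for x
  define pw where "pw = (\<lambda>x::real. x ^ (N - 2))"
  define A where "A q = real (N - 1) * q ^ (N - 2) * integral {q..1} w + r q * m q * \<beta> q" for q
  have bids_range: "0 \<le> b" "b \<le> bmax" if "b \<in> bids" for b
    using that s_range by (auto simp: bids_def)
  have kf_int: "kf integrable_on {x..y}" if "0 \<le> x" "y \<le> 1" for x y
    unfolding kf_def by (intro integrable_continuous_real continuous_intros beta_continuous_on) (use that in auto)
  have sq_int: "sq integrable_on {x..y}" if "0 \<le> x" "y \<le> 1" for x y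
    unfolding sq_def by (intro integrable_continuous_real continuous_intros beta_continuous_on) (use that in auto)
  have pw_int: "pw integrable_on {x..y}" for x y
    unfolding pw_def by (intro integrable_continuous_real continuous_intros)
  have quad: "integral {x..y} (\<lambda>q. q ^ (N - 2) * ((b - \<beta> q)\<^sup>2 / 2))
      = b\<^sup>2 / 2 * integral {x..y} pw - b * integral {x..y} kf + integral {x..y} sq"
    if "0 \<le> x" "y \<le> 1" for x y b
  proof -
    have "((\<lambda>q. b\<^sup>2 / 2 * pw q - b * kf q + sq q) has_integral
       b\<^sup>2 / 2 * integral {x..y} pw - b * integral {x..y} kf + integral {x..y} sq) {x..y}"
      by (intro has_integral_add has_integral_diff has_integral_mult_right integrable_integral
          pw_int kf_int sq_int that)
    also have "(\<lambda>q. b\<^sup>2 / 2 * pw q - b * kf q + sq q) = (\<lambda>q. q ^ (N - 2) * ((b - \<beta> q)\<^sup>2 / 2))"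
      by (simp add: fun_eq_iff pw_def kf_def sq_def power2_eq_square field_simps)
    finally show ?thesis by (rule integral_unique)
  qed
  have A_int: "A integrable_on {0..1}"
    unfolding A_def
    by (intro integrable_add payment_integrable integrable_continuous_real continuous_intros
        tail_integral_continuous) auto
  have all_q: "(\<Sum>b\<in>bids. qi f b) = integral {0..1} f" if "f integrable_on {0..1}" for f
  proof -
    have "{b\<in>bids. 0 \<le> b} = bids" using bids_range by auto
    then show ?thesis
      using sum_integral_quantile_cells[of f 0] that by (simp add: below_0 qi_def)
  qed
  have all_c: "(\<Sum>b\<in>bids. cb f b) = (\<Sum>k\<le>K. ci f k)" for f
    unfolding cb_def by (rule sum_bids_all)
  have sq_eq: "(\<Sum>b\<in>bids. qi sq b) = (\<Sum>k\<le>K. ci sq k)"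
    using all_q[of sq] sum_integral_cells[of sq] sq_int by (simp add: ci_def)

  have "(\<Sum>b\<in>bids. qi A b - b * qi rm b + M * (b\<^sup>2 / 2 * qi pw b - b * qi kf b + qi sq b))
      \<le> (\<Sum>b\<in>bids. (upto b ^ (N - 1) - below b ^ (N - 1)) * W b)"
  proof (rule sum_mono)
    fix b assume b: "b \<in> bids"
    show "qi A b - b * qi rm b + M * (b\<^sup>2 / 2 * qi pw b - b * qi kf b + qi sq b)
       \<le> (upto b ^ (N - 1) - below b ^ (N - 1)) * W b"
      unfolding qi_def rm_def A_def quad[OF below_nonneg upto_le_1, symmetric]
      by (rule deviation_value_cell) (use bids_range[OF b] below_nonneg below_le_upto upto_le_1 below_pos in auto)
  qed
  also have "\<dots> = integral {0..1} (\<lambda>x. below (\<beta> x) ^ (N - 1) * w x)"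
    using value_below_eq by (simp add: integral_unique)
  finally have deviation: "integral {0..1} A + M * (\<Sum>k\<le>K. ci sq k)
      + (\<Sum>b\<in>bids. M * (b\<^sup>2 / 2 * qi pw b) - b * (qi rm b + M * qi kf b))
     \<le> integral {0..1} (\<lambda>x. below (\<beta> x) ^ (N - 1) * w x)"
    by (simp add: all_q[OF A_int, symmetric] sq_eq[symmetric] sum.distrib sum_subtractf
        sum_distrib_left algebra_simps)

  have layer1: "0 \<le> (\<Sum>b\<in>bids. b * ((\<Sum>k\<in>{k\<in>{..K}. s k = b}. ci (\<lambda>x. \<rho> (s k) * m x + M * kf x) k)
      - qi (\<lambda>q. rm q + M * kf q) b))"
  proof (rule sum_nonneg_if_tail_sums_nonneg)
    fix u assume u: "u \<in> bids" "0 < u"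
    have "(\<Sum>b\<in>{b\<in>bids. u \<le> b}. qi (\<lambda>q. rm q + M * kf q) b) = integral {below u..1} (\<lambda>q. rm q + M * kf q)"
      unfolding qi_def
    proof (rule sum_integral_quantile_cells)
      show "(\<lambda>q. rm q + M * kf q) integrable_on {below u..1}"
        unfolding rm_def kf_def
        by (intro integrable_continuous_real continuous_intros r_continuous_on m_continuous_on beta_continuous_on)
           (use below_pos[OF u(2)] in auto)
    qed
    then show "0 \<le> (\<Sum>b\<in>{b\<in>bids. u \<le> b}. (\<Sum>k\<in>{k\<in>{..K}. s k = b}. ci (\<lambda>x. \<rho> (s k) * m x + M * kf x) k)
      - qi (\<lambda>q. rm q + M * kf q) b)"
      using layer_payment[OF u] unfolding sum_subtractf sum_bids
      by (simp add: ci_def rm_def kf_def)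
  qed (use bids_range in \<open>auto simp: mono_on_def\<close>)
  have layer1_b: "b * ((\<Sum>k\<in>{k\<in>{..K}. s k = b}. ci (\<lambda>x. \<rho> (s k) * m x + M * kf x) k)
      - qi (\<lambda>q. rm q + M * kf q) b)
     = (\<Sum>k\<in>{k\<in>{..K}. s k = b}. s k * (\<rho> (s k) * ci m k)) + M * (b * cb kf b) - b * (qi rm b + M * qi kf b)"
    if b: "b \<in> bids" for b
  \<comment> \<open>For b = 0 every term has the factor 0, so no integral of \<open>m\<close> near
    quantile 0 has to be split.\<close>
  proof (cases "b = 0")
    case False
    then have b0: "0 < b" using bids_range[OF b] by simp
    have "ci (\<lambda>x. \<rho> (s k) * m x + M * kf x) k = \<rho> (s k) * ci m k + M * ci kf k" if k: "k \<le> K" "s k = b" for k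
    proof -
      have "k \<noteq> 0" using k b0 s_0 by (metis less_irrefl)
      then have "0 < t k" using t_le[of 1 k] t_less[of 0] t_0 k by simp
      then have "m integrable_on {t k..t (Suc k)}"
        by (intro integrable_continuous_real m_continuous_on) (use t_range[of "Suc k"] k in auto)
      then have "((\<lambda>x. \<rho> (s k) * m x + M * kf x) has_integral \<rho> (s k) * ci m k + M * ci kf k) {t k..t (Suc k)}"
        unfolding ci_def using t_range[of k] t_range[of "Suc k"] k
        by (intro has_integral_add has_integral_mult_right integrable_integral kf_int) auto
      then show ?thesis by (simp add: ci_def integral_unique)
    qed
    then have "(\<Sum>k\<in>{k\<in>{..K}. s k = b}. ci (\<lambda>x. \<rho> (s k) * m x + M * kf x) k)
       = (\<Sum>k\<in>{k\<in>{..K}. s k = b}. \<rho> (s k) * ci m k + M * ci kf k)"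
      by (intro sum.cong) auto
    moreover have "qi (\<lambda>q. rm q + M * kf q) b = qi rm b + M * qi kf b"
    proof -
      have "rm integrable_on {below b..upto b}"
        unfolding rm_def
        by (intro integrable_continuous_real continuous_intros r_continuous_on m_continuous_on)
           (use below_pos[OF b0] upto_le_1[of b] in auto)
      then have "((\<lambda>q. rm q + M * kf q) has_integral qi rm b + M * qi kf b) {below b..upto b}"
        unfolding qi_def
        by (intro has_integral_add has_integral_mult_right integrable_integral kf_int below_nonneg upto_le_1)
      then show ?thesis by (simp add: qi_def integral_unique)
    qed
    moreover have "(\<Sum>k\<in>{k\<in>{..K}. s k = b}. s k * (\<rho> (s k) * ci m k))
       = (\<Sum>k\<in>{k\<in>{..K}. s k = b}. b * (\<rho> (s k) * ci m k))"
      by (intro sum.cong) auto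
    ultimately show ?thesis
      by (simp add: cb_def sum.distrib sum_distrib_left algebra_simps)
  qed simp
  have layer1': "(\<Sum>b\<in>bids. b * (qi rm b + M * qi kf b)) \<le>
     (\<Sum>k\<le>K. s k * (\<rho> (s k) * ci m k)) + M * (\<Sum>k\<le>K. s k * ci kf k)"
  proof -
    have "(\<Sum>b\<in>bids. b * cb kf b) = (\<Sum>b\<in>bids. \<Sum>k\<in>{k\<in>{..K}. s k = b}. s k * ci kf k)"
      unfolding cb_def by (intro sum.cong) (auto simp: sum_distrib_left)
    then have "(\<Sum>b\<in>bids. b * cb kf b) = (\<Sum>k\<le>K. s k * ci kf k)"
      by (simp only: sum_bids_all)
    moreover have "0 \<le> (\<Sum>b\<in>bids. (\<Sum>k\<in>{k\<in>{..K}. s k = b}. s k * (\<rho> (s k) * ci m k))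
        + M * (b * cb kf b) - b * (qi rm b + M * qi kf b))"
      using layer1 layer1_b by simp
    ultimately show ?thesis
      unfolding sum_subtractf sum.distrib sum_bids_all by (simp add: sum_distrib_left[symmetric])
  qed

  have layer2: "0 \<le> (\<Sum>b\<in>bids. b\<^sup>2 / 2 * (qi pw b - cb pw b))"
  proof (rule sum_nonneg_if_tail_sums_nonneg)
    fix u assume u: "u \<in> bids"
    have "(\<Sum>b\<in>{b\<in>bids. u \<le> b}. qi pw b) = integral {below u..1} pw"
      unfolding qi_def by (rule sum_integral_quantile_cells[OF pw_int])
    then show "0 \<le> (\<Sum>b\<in>{b\<in>bids. u \<le> b}. qi pw b - cb pw b)"
      using layer_weight[OF bids_range(1)[OF u], of "N - 2"]
      unfolding cb_def sum_subtractf sum_bids by (simp add: ci_def pw_def)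
  qed (use bids_range in \<open>auto simp: mono_on_def power_mono\<close>)
  have "(\<Sum>b\<in>bids. b\<^sup>2 / 2 * cb pw b) = (\<Sum>b\<in>bids. \<Sum>k\<in>{k\<in>{..K}. s k = b}. (s k)\<^sup>2 / 2 * ci pw k)"
    unfolding cb_def by (intro sum.cong) (auto simp: sum_distrib_left)
  then have "(\<Sum>b\<in>bids. b\<^sup>2 / 2 * cb pw b) = (\<Sum>k\<le>K. (s k)\<^sup>2 / 2 * ci pw k)"
    by (simp only: sum_bids_all)
  then have "(\<Sum>k\<le>K. (s k)\<^sup>2 / 2 * ci pw k) \<le> (\<Sum>b\<in>bids. b\<^sup>2 / 2 * qi pw b)"
    using layer2 by (simp add: right_diff_distrib sum_subtractf)
  then have layer2': "M * (\<Sum>k\<le>K. (s k)\<^sup>2 / 2 * ci pw k) \<le> M * (\<Sum>b\<in>bids. b\<^sup>2 / 2 * qi pw b)"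
    using M_nonneg by (rule mult_left_mono)

  have A_value: "integral {0..1} A = integral {0..1} (\<lambda>x. x ^ (N - 1) * w x + r x * m x * \<beta> x)"
  proof -
    have "(\<lambda>q. real (N - 1) * q ^ (N - 2) * integral {q..1} w) integrable_on {0..1}"
      by (intro integrable_continuous_real continuous_intros tail_integral_continuous)
    then show ?thesis
      unfolding A_def using quantile_value payment_integrable[of 0 1] weighted_w_integrable
      by (simp add: Henstock_Kurzweil_Integration.integral_add)
  qed
  have "M * (\<Sum>k\<le>K. ci (\<lambda>x. x ^ (N - 2) * ((s k - \<beta> x)\<^sup>2 / 2)) k)
     = M * (\<Sum>k\<le>K. (s k)\<^sup>2 / 2 * ci pw k - s k * ci kf k + ci sq k)"
    unfolding ci_def by (intro arg_cong2[where f="(*)"] sum.cong refl quad) (use t_range in auto)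
  also have "\<dots> = M * (\<Sum>k\<le>K. (s k)\<^sup>2 / 2 * ci pw k) - M * (\<Sum>k\<le>K. s k * ci kf k) + M * (\<Sum>k\<le>K. ci sq k)"
    by (simp add: sum.distrib sum_subtractf algebra_simps)
  finally show ?thesis
    using deviation layer1' layer2' A_value
    unfolding sum_subtractf sum_distrib_left[symmetric] ci_def by linarith
qed

end

section \<open>The canonical bids and their constants\<close>

declare canonical_bid.simps [simp del] const_C.simps [simp del] const_D.simps [simp del]

lemma at_within_Ioc_neq_bot:
  fixes x b :: real
  assumes "0 < x" "x \<le> b"
  shows "at x within {0<..b} \<noteq> bot"
proof -
  have "x islimpt {0<..<x}" using assms(1) by (rule islimpt_greaterThanLessThan2)
  then have "x islimpt {0<..b}" by (rule islimpt_subset) (use assms in auto)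
  then show ?thesis using trivial_limit_within by blast
qed

lemma vector_derivative_within_Ioc:
  fixes f :: "real \<Rightarrow> real"
  assumes "(f has_real_derivative D) (at x within {0<..b})" "0 < x" "x \<le> b"
  shows "vector_derivative f (at x within {0<..b}) = D"
  using assms at_within_Ioc_neq_bot
  by (intro vector_derivative_within) (auto simp: has_real_derivative_iff_has_vector_derivative)

lemma at_within_Ioc_interior: "0 < x \<Longrightarrow> x < b \<Longrightarrow> at x within {0<..b} = at x" for x b :: real
  by (rule at_within_interior) auto

lemma power_deriv_within: "((\<lambda>x. x ^ n) has_real_derivative real n * x ^ (n - 1)) (at x within S)"
  by (auto intro!: derivative_eq_intros)

text \<open>The derivative along the inverse bid function is read off from the chain rule
  \<open>(J \<circ> \<beta>\<^sup>-\<^sup>1)' (\<beta> x) = J' x / \<beta>' x\<close>.\<close>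

lemma Inf_inverse_derivatives:
  fixes \<beta> J \<beta>' J' :: "real \<Rightarrow> real"
  assumes cont: "continuous_on {0..1} \<beta>" and zero: "\<beta> 0 = 0"
    and mono: "strict_mono_on {0..1} \<beta>"
    and \<beta>': "\<And>x. x \<in> {0<..1} \<Longrightarrow> (\<beta> has_real_derivative \<beta>' x) (at x within {0<..1})"
    and \<beta>'_pos: "\<And>x. x \<in> {0<..1} \<Longrightarrow> 0 < \<beta>' x"
    and J': "\<And>x. x \<in> {0<..1} \<Longrightarrow> (J has_real_derivative J' x) (at x within {0<..1})"
    and lower: "\<And>x. x \<in> {0<..1} \<Longrightarrow> c * \<beta>' x \<le> - J' x" and c: "0 < c" and a: "0 < a"
    and S_def: "S = Inf ({- vector_derivative (\<lambda>\<mu>. J (the_inv_into {0..1} \<beta> \<mu>)) (at \<mu> within {0<..\<beta> 1})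
        | \<mu>. \<mu> \<in> {0<..\<beta> 1}} \<union> {a})"
  shows "0 < S" and "S \<le> a" and "\<And>x. x \<in> {0<..1} \<Longrightarrow> S * \<beta>' x \<le> - J' x"
proof -
  let ?g = "the_inv_into {0..1} \<beta>"
  have inj: "inj_on \<beta> {0..1}" using mono by (rule strict_mono_on_imp_inj_on)
  have g: "?g (\<beta> x) = x" if "x \<in> {0..1}" for x
    by (rule the_inv_into_f_f[OF inj that])
  have mono': "\<beta> x < \<beta> y" if "0 \<le> x" "x < y" "y \<le> 1" for x y
    using mono that by (auto simp: strict_mono_on_def)
  have image: "\<beta> ` {0<..1} = {0<..\<beta> 1}"
  proof (intro equalityI subsetI)
    fix y assume "y \<in> {0<..\<beta> 1}"
    then obtain x where "x \<in> {0..1}" "\<beta> x = y"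
      using IVT'[of \<beta> 0 y 1] cont zero by auto
    moreover from this have "x \<noteq> 0" using zero \<open>y \<in> {0<..\<beta> 1}\<close> by auto
    ultimately show "y \<in> \<beta> ` {0<..1}" by auto
  next
    fix y assume "y \<in> \<beta> ` {0<..1}"
    then obtain x where x: "0 < x" "x \<le> 1" "y = \<beta> x" by auto
    then show "y \<in> {0<..\<beta> 1}"
      using mono'[of 0 x] mono'[of x 1] zero by (cases "x = 1") auto
  qed
  have g_cont: "continuous_on (\<beta> ` {0..1}) ?g"
    by (rule continuous_on_inv[OF cont]) (use g in auto)
  have vd: "vector_derivative (\<lambda>\<mu>. J (?g \<mu>)) (at (\<beta> x) within {0<..\<beta> 1}) = J' x / \<beta>' x"
    if x: "x \<in> {0<..1}" for x
  proof (rule vector_derivative_within_Ioc)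
    have gd: "(?g has_derivative (\<lambda>h. 1 / \<beta>' x * h)) (at (\<beta> x) within \<beta> ` {0<..1})"
    proof (rule has_derivative_inverse_within)
      show "(\<beta> has_derivative (\<lambda>h. \<beta>' x * h)) (at x within {0<..1})"
        using \<beta>'[OF x] by (simp add: has_field_derivative_def)
      have "continuous (at (\<beta> x) within \<beta> ` {0..1}) ?g"
        using g_cont x by (auto simp: continuous_on_eq_continuous_within)
      then show "continuous (at (\<beta> x) within \<beta> ` {0<..1}) ?g"
        by (rule continuous_within_subset) auto
      show "linear (\<lambda>h. 1 / \<beta>' x * h)"
        by (rule bounded_linear.linear) (rule bounded_linear_mult_right)
      show "(\<lambda>h. 1 / \<beta>' x * h) \<circ> (\<lambda>h. \<beta>' x * h) = id"
        using \<beta>'_pos[OF x] by (auto simp: fun_eq_iff)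
    qed (use x g in auto)
    have img: "?g ` \<beta> ` {0<..1} = {0<..1}"
      using g by (force simp: image_image)
    have "(J \<circ> ?g has_real_derivative J' x * (1 / \<beta>' x)) (at (\<beta> x) within \<beta> ` {0<..1})"
    proof (rule DERIV_image_chain)
      show "(J has_real_derivative J' x) (at (?g (\<beta> x)) within ?g ` \<beta> ` {0<..1})"
        unfolding img using J'[OF x] g[of x] x by simp
      show "(?g has_real_derivative 1 / \<beta>' x) (at (\<beta> x) within \<beta> ` {0<..1})"
        using gd by (simp only: has_field_derivative_def)
    qed
    then show "((\<lambda>\<mu>. J (?g \<mu>)) has_real_derivative J' x / \<beta>' x) (at (\<beta> x) within {0<..\<beta> 1})"
      by (simp add: image o_def)
    show "0 < \<beta> x" "\<beta> x \<le> \<beta> 1"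
      using image x by auto
  qed
  have set_eq: "{- vector_derivative (\<lambda>\<mu>. J (?g \<mu>)) (at \<mu> within {0<..\<beta> 1}) | \<mu>. \<mu> \<in> {0<..\<beta> 1}}
     = (\<lambda>x. - (J' x / \<beta>' x)) ` {0<..1}" (is "?L = ?R")
  proof -
    have "?L = (\<lambda>\<mu>. - vector_derivative (\<lambda>\<mu>. J (?g \<mu>)) (at \<mu> within {0<..\<beta> 1})) ` \<beta> ` {0<..1}"
      unfolding image by auto
    also have "\<dots> = ?R" unfolding image_image using vd by (intro image_cong) auto
    finally show ?thesis .
  qed
  have S_eq: "S = Inf ((\<lambda>x. - (J' x / \<beta>' x)) ` {0<..1} \<union> {a})"
    unfolding S_def set_eq ..
  \<comment> \<open>An \<open>Inf\<close> of reals carries information only for a set that is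
    bounded below. The bound \<open>c\<close> ensures this and also makes the infimum
    positive.\<close>
  have lb: "min c a \<le> y" if y: "y \<in> (\<lambda>x. - (J' x / \<beta>' x)) ` {0<..1} \<union> {a}" for y
  proof (cases "y = a")
    case False
    then obtain x where x: "x \<in> {0<..1}" "y = - (J' x / \<beta>' x)" using y by auto
    have "c \<le> y"
      using x(2) lower[OF x(1)] pos_le_divide_eq[OF \<beta>'_pos[OF x(1)], of c "- J' x"] by simp
    then show ?thesis by simp
  qed simp
  then have bdd: "bdd_below ((\<lambda>x. - (J' x / \<beta>' x)) ` {0<..1} \<union> {a})"
    by (auto simp: bdd_below_def)
  have "min c a \<le> S"
    unfolding S_eq by (rule cInf_greatest) (use lb in auto)
  then show "0 < S" using c a by simp
  show "S \<le> a" unfolding S_eq by (rule cInf_lower[OF _ bdd]) simp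
  fix x :: real assume x: "x \<in> {0<..1}"
  then have "S \<le> - (J' x / \<beta>' x)" unfolding S_eq by (intro cInf_lower[OF _ bdd]) simp
  then show "S * \<beta>' x \<le> - J' x"
    using pos_le_divide_eq[OF \<beta>'_pos[OF x], of S "- J' x"] by simp
qed

lemma INF_positive:
  fixes g :: "real \<Rightarrow> real"
  assumes "\<And>x. x \<in> {0<..1} \<Longrightarrow> c \<le> g x" "0 < c"
  shows "0 < (INF x\<in>{0<..1}. g x)" and "\<And>x. x \<in> {0<..1} \<Longrightarrow> (INF x\<in>{0<..1}. g x) \<le> g x"
proof -
  have "c \<le> (INF x\<in>{0<..1}. g x)" by (rule cINF_greatest) (use assms in auto)
  then show "0 < (INF x\<in>{0<..1}. g x)" using assms by simp
  show "(INF x\<in>{0<..1}. g x) \<le> g x" if "x \<in> {0<..1}" for x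
    by (rule cINF_lower[OF bdd_belowI2[OF assms(1)] that])
qed

section \<open>Calculus of the valuation and of the canonical bids\<close>

context continuous_auction
begin

definition dv :: "real \<Rightarrow> real" where
  "dv x = vector_derivative v (at x within {0<..1})"

text \<open>Interim payment of a type in the canonical equilibrium, equal in both formats by revenue
  equivalence: it is the all-pay bid, and x^(N-1) times the first-price bid.\<close>

definition pay :: "real \<Rightarrow> real" where
  "pay x = integral {0..x} (\<lambda>t. real (N - 1) * t ^ (N - 2) * v t)"

lemma v_strict: "0 \<le> x \<Longrightarrow> x < y \<Longrightarrow> y \<le> 1 \<Longrightarrow> v x < v y"
  using v_strict_mono by (auto simp: strict_mono_on_def)

lemma v_mono: "0 \<le> x \<Longrightarrow> x \<le> y \<Longrightarrow> y \<le> 1 \<Longrightarrow> v x \<le> v y"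
  using v_strict[of x y] by (cases "x = y") auto

lemma v_0: "v 0 = 0"
proof -
  have "v 0 \<in> {0..v 1}" using v_image by auto
  then have "0 \<in> v ` {0..1}" using v_image by auto
  then obtain x where "x \<in> {0..1}" "v x = 0" by auto
  then have "v 0 \<le> 0" using v_mono[of 0 x] by auto
  then show ?thesis using \<open>v 0 \<in> {0..v 1}\<close> by auto
qed

lemma v_pos: "0 < x \<Longrightarrow> x \<le> 1 \<Longrightarrow> 0 < v x"
  using v_strict[of 0 x] v_0 by simp

lemma bmax_ge: "v 1 \<le> bmax"
  using bids_cover v_pos[of 1] by auto

lemma bmax_pos: "0 < bmax"
  using bmax_ge v_pos[of 1] by simp

lemma v_deriv: "x \<in> {0<..1} \<Longrightarrow> (v has_real_derivative dv x) (at x within {0<..1})"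
proof -
  assume x: "x \<in> {0<..1}"
  obtain E where E: "\<And>x. x \<in> {0<..1} \<Longrightarrow> E 0 x = v x"
    "\<And>k x. x \<in> {0<..1} \<Longrightarrow> (E k has_real_derivative E (Suc k) x) (at x within {0<..1})"
    using v_smooth unfolding smooth_on_def by blast
  have "(v has_real_derivative E (Suc 0) x) (at x within {0<..1})"
    by (rule has_field_derivative_transform_within[OF E(2)[OF x, of 0], of 1]) (use E(1) x in auto)
  then show ?thesis
    unfolding dv_def using vector_derivative_within_Ioc[of v "E (Suc 0) x" x 1] x by auto
qed

lemma v_deriv_at: "0 < x \<Longrightarrow> x < 1 \<Longrightarrow> (v has_real_derivative dv x) (at x)"
  using v_deriv[of x] at_within_Ioc_interior[of x 1] by simp

lemma v_continuous_on: "S \<subseteq> {0..1} \<Longrightarrow> continuous_on S v"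
  using v_continuous by (rule continuous_on_subset)

lemma pay_deriv:
  "x \<in> {0..1} \<Longrightarrow> (pay has_real_derivative real (N - 1) * x ^ (N - 2) * v x) (at x within {0..1})"
  unfolding pay_def
  by (rule integral_has_real_derivative) (intro continuous_intros v_continuous)

lemma pay_deriv_Ioc:
  "x \<in> {0<..1} \<Longrightarrow> (pay has_real_derivative real (N - 1) * x ^ (N - 2) * v x) (at x within {0<..1})"
  using pay_deriv[of x] by (rule has_field_derivative_subset) auto

lemma pay_deriv_at:
  "0 < x \<Longrightarrow> x < 1 \<Longrightarrow> (pay has_real_derivative real (N - 1) * x ^ (N - 2) * v x) (at x)"
  using pay_deriv[of x] by (simp add: at_within_Icc_at)

lemma pay_0: "pay 0 = 0"
  by (simp add: pay_def)

lemma pay_continuous: "continuous_on {0..1} pay"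
  using pay_deriv by (rule DERIV_continuous_on)

lemma pay_pos:
  assumes "0 < x" "x \<le> 1"
  shows "0 < pay x"
proof -
  have "pay 0 < pay x"
  proof (rule DERIV_pos_imp_increasing_open[OF assms(1)])
    fix y assume "0 < y" "y < x"
    then show "\<exists>z. (pay has_real_derivative z) (at y) \<and> 0 < z"
      using pay_deriv_at[of y] v_pos[of y] assms two_buyers
      by (intro exI[of _ "real (N - 1) * y ^ (N - 2) * v y"] conjI) auto
  qed (use pay_continuous assms in \<open>auto intro: continuous_on_subset\<close>)
  then show ?thesis by (simp add: pay_0)
qed

text \<open>The rent x^(N-1) * v x - pay x starts at 0 and has derivative x^(N-1) * dv x.\<close>

lemma pay_less:
  assumes dv_pos: "\<And>y. 0 < y \<Longrightarrow> y < 1 \<Longrightarrow> 0 < dv y" and x: "0 < x" "x \<le> 1"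
  shows "pay x < x ^ (N - 1) * v x"
proof -
  define E where "E y = y ^ (N - 1) * v y - pay y" for y
  have "E 0 < E x"
  proof (rule DERIV_pos_imp_increasing_open[OF x(1)])
    fix y assume y: "0 < y" "y < x"
    have "(E has_real_derivative y ^ (N - 1) * dv y) (at y)"
      unfolding E_def using y x
      by (auto intro!: derivative_eq_intros v_deriv_at pay_deriv_at simp: numeral_2_eq_2)
    then show "\<exists>z. (E has_real_derivative z) (at y) \<and> 0 < z"
      using dv_pos[of y] y x by auto
  next
    show "continuous_on {0..x} E"
      unfolding E_def
      by (intro continuous_intros v_continuous_on continuous_on_subset[OF pay_continuous]) (use x in auto)
  qed
  then show ?thesis using two_buyers by (simp add: E_def pay_0 v_0)
qed

lemma canonical_bid_AP: "canonical_bid AP N v = pay"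
  by (simp add: canonical_bid.simps pay_def fun_eq_iff)

lemma canonical_bid_FP: "canonical_bid FP N v x = (if x = 0 then 0 else pay x / x ^ (N - 1))"
  by (simp add: canonical_bid.simps pay_def)

lemma inverse_v_deriv:
  "0 < x \<Longrightarrow> x < 1 \<Longrightarrow> ((\<lambda>x. 1 / v x) has_real_derivative - dv x / (v x)\<^sup>2) (at x)"
  using v_pos[of x] by (auto intro!: derivative_eq_intros v_deriv_at simp: power2_eq_square field_simps)

lemma decreasing_drop:
  fixes J J' \<beta> \<beta>' :: "real \<Rightarrow> real"
  assumes "\<And>x. x \<in> {0<..1} \<Longrightarrow> (J has_real_derivative J' x) (at x within {0<..1})"
    and "\<And>x. x \<in> {0<..1} \<Longrightarrow> (\<beta> has_real_derivative \<beta>' x) (at x within {0<..1})"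
    and "\<And>x. x \<in> {0<..1} \<Longrightarrow> M * \<beta>' x \<le> - J' x"
    and "0 < q" "q \<le> s" "s \<le> 1"
  shows "M * (\<beta> s - \<beta> q) \<le> J q - J s"
proof -
  have d: "((\<lambda>x. J x + M * \<beta> x) has_real_derivative J' x + M * \<beta>' x) (at x within {0<..1})"
    if "x \<in> {0<..1}" for x
    using that assms(1,2) by (auto intro!: derivative_eq_intros)
  have "J s + M * \<beta> s \<le> J q + M * \<beta> q"
  proof (rule DERIV_nonpos_imp_decreasing_open[OF assms(5)])
    fix x assume x: "q < x" "x < s"
    then have x': "x \<in> {0<..1}" using assms(4,6) by auto
    show "\<exists>y. ((\<lambda>x. J x + M * \<beta> x) has_real_derivative y) (at x) \<and> y \<le> 0"
      using d[OF x'] assms(3)[OF x'] at_within_Ioc_interior[of x 1] x x' assms(6) by auto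
  next
    have "continuous_on {0<..1} (\<lambda>x. J x + M * \<beta> x)"
      using d by (rule DERIV_continuous_on)
    then show "continuous_on {q..s} (\<lambda>x. J x + M * \<beta> x)"
      by (rule continuous_on_subset) (use assms(4,6) in auto)
  qed
  then show ?thesis by (simp add: algebra_simps)
qed

text \<open>Positivity of both infima needs explicit lower bounds in terms of \<open>c\<close>.
  Since x / v x decreases, it is at least 1 / v 1. This gives v x \<le> v 1 * x, hence a bounded
  \<beta>' and a positive \<open>const_C\<close>; the same estimate bounds the quotient in
  \<open>const_D\<close> from below.\<close>

lemma FP_dual_core:
  assumes decr: "strict_antimono_on {0<..1} (\<lambda>t. t / v t)"
    and c: "c < 0" "\<And>\<theta>. \<theta> \<in> {0<..1} \<Longrightarrow> vector_derivative (\<lambda>t. t / v t) (at \<theta> within {0<..1}) \<le> c"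
  defines "M \<equiv> min (const_C FP N v bmax) (const_D FP N v)"
    and "\<beta> \<equiv> canonical_bid FP N v"
  shows "0 < M"
    and "\<exists>\<beta>' m' r' k'. dual_core N M bmax \<beta> \<beta>' (\<lambda>x. 1 / v x) m' (\<lambda>x. x / v x)
           (\<lambda>x. 1 - \<beta> x / v x) (\<lambda>x. x ^ (N - 1)) r' k'"
    and "\<And>x. x \<in> {0..1} \<Longrightarrow> \<beta> x \<le> v x"
proof -
  define J' where "J' x = (v x - x * dv x) / (v x)\<^sup>2" for x
  define \<beta>' where "\<beta>' x = real (N - 1) * (v x - \<beta> x) / x" for x
  have \<beta>_eq: "\<beta> x = (if x = 0 then 0 else pay x / x ^ (N - 1))" for x
    by (simp only: \<beta>_def canonical_bid_FP)
  have pow: "x ^ (N - 1) = x * x ^ (N - 2)" for x :: real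
  proof -
    have "N - 1 = Suc (N - 2)" using two_buyers by simp
    then show ?thesis by (simp only: power_Suc)
  qed
  have J_deriv: "((\<lambda>x. x / v x) has_real_derivative J' x) (at x within {0<..1})" if "x \<in> {0<..1}" for x
    unfolding J'_def using that v_pos[of x]
    by (auto intro!: derivative_eq_intros v_deriv simp: power2_eq_square)
  have J'_le: "J' x \<le> c" if "x \<in> {0<..1}" for x
    using c(2)[OF that] vector_derivative_within_Ioc[OF J_deriv[OF that]] that by simp
  have slope: "v x - c * (v x)\<^sup>2 \<le> x * dv x" if "x \<in> {0<..1}" for x
  proof -
    have "0 < v x" using that v_pos by auto
    then have "v x - x * dv x \<le> c * (v x)\<^sup>2"
      using J'_le[OF that] by (simp add: J'_def pos_divide_le_eq)
    then show ?thesis by simp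
  qed
  have dv_pos: "0 < dv x" if "x \<in> {0<..1}" for x
  proof -
    have "0 < v x" using that v_pos by auto
    moreover have "c * (v x)\<^sup>2 \<le> 0" using c(1) by (intro mult_nonpos_nonneg) auto
    ultimately have "0 < x * dv x" using slope[OF that] by linarith
    then show ?thesis using that by (simp add: zero_less_mult_iff)
  qed
  have \<beta>_pos: "0 < \<beta> x" and \<beta>_less: "\<beta> x < v x" if "0 < x" "x \<le> 1" for x
    using pay_pos[OF that] pay_less[OF _ that] dv_pos that
    by (auto simp: \<beta>_eq pos_divide_less_eq mult.commute)
  have \<beta>_0: "\<beta> 0 = 0" by (simp add: \<beta>_eq)
  show \<beta>_le: "\<beta> x \<le> v x" if "x \<in> {0..1}" for x
    using \<beta>_less[of x] \<beta>_0 v_0 that by (cases "x = 0") auto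
  have J_ge: "1 / v 1 \<le> x / v x" if "x \<in> {0<..1}" for x
    using decr that by (cases "x = 1") (auto simp: monotone_on_def less_imp_le)
  have \<beta>_deriv: "(\<beta> has_real_derivative \<beta>' x) (at x within {0<..1})" if x: "x \<in> {0<..1}" for x
  proof -
    have "((\<lambda>x. pay x / x ^ (N - 1)) has_real_derivative
        (real (N - 1) * x ^ (N - 2) * v x * x ^ (N - 1) - pay x * (real (N - 1) * x ^ (N - 1 - 1)))
          / (x ^ (N - 1) * x ^ (N - 1))) (at x within {0<..1})"
      using x by (intro DERIV_divide pay_deriv_Ioc power_deriv_within) auto
    also have "(real (N - 1) * x ^ (N - 2) * v x * x ^ (N - 1) - pay x * (real (N - 1) * x ^ (N - 1 - 1)))
          / (x ^ (N - 1) * x ^ (N - 1)) = \<beta>' x"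
    proof -
      have e: "N - 1 - 1 = N - 2" by simp
      show ?thesis unfolding e \<beta>'_def \<beta>_eq pow using x by (simp add: field_simps)
    qed
    finally show ?thesis
      by (rule has_field_derivative_transform_within[where d=1]) (use x in \<open>auto simp: \<beta>_eq\<close>)
  qed
  have \<beta>'_pos: "0 < \<beta>' x" if "x \<in> {0<..1}" for x
    unfolding \<beta>'_def using \<beta>_less[of x] that two_buyers by auto
  have \<beta>'_le: "\<beta>' x \<le> real (N - 1) * v 1" if x: "x \<in> {0<..1}" for x
  proof -
    have "v x \<le> v 1 * x"
      using J_ge[OF x] v_pos[of x] v_pos[of 1] x by (simp add: field_simps)
    then have "(v x - \<beta> x) / x \<le> v 1"
      using \<beta>_pos[of x] x by (simp add: pos_divide_le_eq)
    then have "real (N - 1) * ((v x - \<beta> x) / x) \<le> real (N - 1) * v 1"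
      by (intro mult_left_mono) auto
    then show ?thesis by (simp add: \<beta>'_def)
  qed
  have \<beta>_cont: "continuous_on {0..1} \<beta>"
  proof -
    have "continuous (at x within {0..1}) \<beta>" if x: "x \<in> {0..1}" for x
    proof (cases "x = 0")
      case True
      have lim: "(v \<longlongrightarrow> 0) (at 0 within {0..1})"
        using v_continuous v_0 unfolding continuous_on_def by (metis atLeastAtMost_iff order_refl zero_le_one)
      \<comment> \<open>At 0 the quotient formula for \<beta> degenerates, so \<beta> is squeezed
        between 0 and \<open>v\<close>.\<close>
      have "(\<beta> \<longlongrightarrow> 0) (at 0 within {0..1})"
      proof (rule tendsto_sandwich[OF _ _ tendsto_const lim])
        show "\<forall>\<^sub>F x in at 0 within {0..1}. 0 \<le> \<beta> x"
          using \<beta>_pos by (auto simp: eventually_at_filter less_imp_le)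
        show "\<forall>\<^sub>F x in at 0 within {0..1}. \<beta> x \<le> v x"
          using \<beta>_le by (auto simp: eventually_at_filter)
      qed
      then show ?thesis by (simp add: True continuous_within \<beta>_0)
    next
      case False
      have "continuous (at x within {0..1}) (\<lambda>x. pay x / x ^ (N - 1))"
        using False x pay_continuous
        by (intro continuous_intros) (auto simp: continuous_on_eq_continuous_within)
      then show ?thesis
        by (rule continuous_transform_within[of _ _ _ x]) (use False x in \<open>auto simp: \<beta>_eq dist_real_def\<close>)
    qed
    then show ?thesis by (simp add: continuous_on_eq_continuous_within)
  qed
  have \<beta>_mono: "\<beta> x < \<beta> y" if xy: "0 \<le> x" "x < y" "y \<le> 1" for x y
  proof (rule DERIV_pos_imp_increasing_open[OF xy(2)])
    fix z assume "x < z" "z < y"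
    then show "\<exists>d. (\<beta> has_real_derivative d) (at z) \<and> 0 < d"
      using \<beta>_deriv[of z] \<beta>'_pos[of z] at_within_Ioc_interior[of z 1] xy by auto
  qed (use \<beta>_cont xy in \<open>auto intro: continuous_on_subset\<close>)
  have lower: "- c / (real (N - 1) * v 1) * \<beta>' x \<le> - J' x" if x: "x \<in> {0<..1}" for x
  proof -
    define e where "e = real (N - 1) * v 1"
    have e: "0 < e" using two_buyers v_pos[of 1] by (simp add: e_def)
    have "0 \<le> - c / e" by (rule divide_nonneg_pos) (use c(1) e in auto)
    then have "- c / e * \<beta>' x \<le> - c / e * e"
      using \<beta>'_le[OF x] unfolding e_def[symmetric] by (intro mult_left_mono)
    also have "\<dots> = - c" using e by simp
    finally show ?thesis using J'_le[OF x] by (simp add: e_def)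
  qed
  have C_def: "const_C FP N v bmax = Inf ({- vector_derivative (\<lambda>\<mu>. (\<lambda>x. x / v x) (the_inv_into {0..1} \<beta> \<mu>)) (at \<mu> within {0<..\<beta> 1})
        | \<mu>. \<mu> \<in> {0<..\<beta> 1}} \<union> {1 / (v 1 * bmax)})"
    by (simp only: const_C.simps canonical_bid_inv_def \<beta>_def)
  have smono: "strict_mono_on {0..1} \<beta>" using \<beta>_mono by (auto simp: strict_mono_on_def)
  have c': "0 < - c / (real (N - 1) * v 1)" "0 < 1 / (v 1 * bmax)"
    using c two_buyers v_pos[of 1] bmax_pos by (auto intro!: divide_neg_pos)
  have C: "0 < const_C FP N v bmax" "const_C FP N v bmax \<le> 1 / (v 1 * bmax)"
    "\<And>x. x \<in> {0<..1} \<Longrightarrow> const_C FP N v bmax * \<beta>' x \<le> - J' x"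
    using Inf_inverse_derivatives[OF \<beta>_cont \<beta>_0 smono \<beta>_deriv \<beta>'_pos J_deriv lower c' C_def] by blast+
  have N3: "0 < 2 * real N - 3" using two_buyers by simp
  have D_lower: "- c / ((2 * real N - 3) * v 1) \<le> dv x * x\<^sup>2 / ((2 * real N - 3) * v x ^ 3)"
    if x: "x \<in> {0<..1}" for x
  proof -
    have vx: "0 < v x" using x v_pos by auto
    have "- c * (v x)\<^sup>2 \<le> x * dv x" using slope[OF x] vx by simp
    then have "- c * (v x)\<^sup>2 * x \<le> x * dv x * x" using x by (intro mult_right_mono) auto
    then have "- c * (v x)\<^sup>2 * x / v x ^ 3 \<le> x * dv x * x / v x ^ 3"
      using vx by (intro divide_right_mono) auto
    then have "- c * (x / v x) \<le> dv x * x\<^sup>2 / v x ^ 3"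
      using vx by (simp add: power2_eq_square power3_eq_cube field_simps)
    moreover have "- c * (1 / v 1) \<le> - c * (x / v x)"
      using J_ge[OF x] c by (intro mult_left_mono) auto
    ultimately have "- c * (1 / v 1) \<le> dv x * x\<^sup>2 / v x ^ 3" by linarith
    then have "- c * (1 / v 1) / (2 * real N - 3) \<le> dv x * x\<^sup>2 / v x ^ 3 / (2 * real N - 3)"
      using N3 by (intro divide_right_mono) auto
    then show ?thesis by (simp add: mult.commute)
  qed
  have D_def: "const_D FP N v = (INF x\<in>{0<..1}. dv x * x\<^sup>2 / ((2 * real N - 3) * v x ^ 3))"
    by (simp add: const_D.simps dv_def)
  have c'': "0 < - c / ((2 * real N - 3) * v 1)"
    using c N3 v_pos[of 1] by (auto intro!: divide_neg_pos)
  have D: "0 < const_D FP N v"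
    "\<And>x. x \<in> {0<..1} \<Longrightarrow> const_D FP N v \<le> dv x * x\<^sup>2 / ((2 * real N - 3) * v x ^ 3)"
    unfolding D_def
    using INF_positive[where g="\<lambda>x. dv x * x\<^sup>2 / ((2 * real N - 3) * v x ^ 3)", OF D_lower c''] by blast+
  show M_pos: "0 < M" using C(1) D(1) by (simp add: M_def)
  have M_C: "M * \<beta>' x \<le> - J' x" if x: "x \<in> {0<..1}" for x
  proof -
    have "M * \<beta>' x \<le> const_C FP N v bmax * \<beta>' x"
      using \<beta>'_pos[OF x] by (intro mult_right_mono) (auto simp: M_def)
    then show ?thesis using C(3)[OF x] by simp
  qed
  have M_D: "M * ((2 * real N - 3) * v x) \<le> dv x * x\<^sup>2 / (v x)\<^sup>2" if x: "x \<in> {0<..1}" for x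
  proof -
    have vx: "0 < v x" using x v_pos by auto
    have "M \<le> dv x * x\<^sup>2 / ((2 * real N - 3) * v x ^ 3)"
      using D(2)[OF x] by (simp add: M_def)
    then have "M * ((2 * real N - 3) * v x) \<le> dv x * x\<^sup>2 / ((2 * real N - 3) * v x ^ 3) * ((2 * real N - 3) * v x)"
      using vx N3 by (intro mult_right_mono) auto
    also have "\<dots> = dv x * x\<^sup>2 / (v x)\<^sup>2"
      using vx N3 by (simp add: power2_eq_square power3_eq_cube)
    finally show ?thesis .
  qed
  define k' where "k' x = real (N - 2) * x ^ (N - 2 - 1) * \<beta> x + x ^ (N - 2) * \<beta>' x" for x
  have "dual_core N M bmax \<beta> \<beta>' (\<lambda>x. 1 / v x) (\<lambda>x. - dv x / (v x)\<^sup>2) (\<lambda>x. x / v x)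
           (\<lambda>x. 1 - \<beta> x / v x) (\<lambda>x. x ^ (N - 1)) (\<lambda>x. real (N - 1) * x ^ (N - 1 - 1)) k'"
  proof
    show "2 \<le> N" by (rule two_buyers)
    show "0 \<le> M" using M_pos by simp
    have "M * bmax \<le> 1 / (v 1 * bmax) * bmax"
      using C(2) bmax_pos by (intro mult_right_mono) (auto simp: M_def)
    then show "M * bmax \<le> 1 / v 1" using bmax_pos by simp
    show "continuous_on {0..1} \<beta>" "\<beta> 0 = 0" by fact+
    show "\<beta> x < \<beta> y" if "0 \<le> x" "x < y" "y \<le> 1" for x y using \<beta>_mono that .
    show "continuous_on {0<..1} (\<lambda>x. 1 - \<beta> x / v x)"
      by (intro continuous_intros v_continuous_on continuous_on_subset[OF \<beta>_cont]) (use v_pos in force)+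
    show "continuous_on {0<..1} (\<lambda>x. 1 / v x)"
      by (intro continuous_intros v_continuous_on) (use v_pos in force)+
    show "continuous_on {0..1} (\<lambda>x::real. real (N - 1) * x ^ (N - 1 - 1))"
      by (intro continuous_intros)
    show "((\<lambda>x. x ^ (N - 1)) has_real_derivative real (N - 1) * x ^ (N - 1 - 1)) (at x)" for x :: real
      by (auto intro!: derivative_eq_intros)
    show "0 \<le> real (N - 1) * x ^ (N - 1 - 1)" if "0 \<le> x" for x using that by simp
    show "M * (\<beta> s - \<beta> q) \<le> q / v q - s / v s" if "0 < q" "q \<le> s" "s \<le> 1" for q s
      by (rule decreasing_drop[OF J_deriv \<beta>_deriv M_C that])
    fix x :: real
    show "0 \<le> 1 - \<beta> x / v x \<and> 1 - \<beta> x / v x \<le> 1" if "0 \<le> x" "x \<le> 1"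
      using \<beta>_pos[of x] \<beta>_less[of x] v_pos[of x] \<beta>_0 that by (cases "x = 0") auto
    show "0 \<le> x ^ (N - 1) * (1 / v x) * \<beta> x \<and> x ^ (N - 1) * (1 / v x) * \<beta> x \<le> 1" if x: "0 \<le> x" "x \<le> 1"
    proof (cases "x = 0")
      case False
      then have "0 \<le> \<beta> x / v x" "\<beta> x / v x \<le> 1" using \<beta>_pos[of x] \<beta>_less[of x] v_pos[of x] x by auto
      moreover have "0 \<le> x ^ (N - 1)" "x ^ (N - 1) \<le> 1" using x by (auto intro: power_le_one)
      ultimately have "0 \<le> x ^ (N - 1) * (\<beta> x / v x)" "x ^ (N - 1) * (\<beta> x / v x) \<le> 1"
        by (blast intro: mult_nonneg_nonneg mult_le_one)+
      moreover have "x ^ (N - 1) * (1 / v x) * \<beta> x = x ^ (N - 1) * (\<beta> x / v x)" by simp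
      ultimately show ?thesis by metis
    qed (simp add: \<beta>_0)
    assume x0: "0 < x"
    show "x ^ (N - 2) * (x / v x) = x ^ (N - 1) * (1 / v x)" unfolding pow by simp
    assume x1: "x < 1"
    have x: "x \<in> {0<..1}" and vx: "0 < v x" using x0 x1 v_pos by auto
    show \<beta>d: "(\<beta> has_real_derivative \<beta>' x) (at x)"
      using \<beta>_deriv[OF x] at_within_Ioc_interior[OF x0 x1] by simp
    show "0 \<le> \<beta>' x" using \<beta>'_pos[OF x] by simp
    show "real (N - 1) * (1 - \<beta> x / v x) = \<beta>' x * (x / v x)"
      using x0 vx by (simp add: \<beta>'_def field_simps)
    show "((\<lambda>x. 1 / v x) has_real_derivative - dv x / (v x)\<^sup>2) (at x)"
      by (rule inverse_v_deriv[OF x0 x1])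
    show "- dv x / (v x)\<^sup>2 \<le> 0" using dv_pos[OF x] vx by simp
    show "((\<lambda>x. x ^ (N - 2) * \<beta> x) has_real_derivative k' x) (at x)"
      unfolding k'_def by (auto intro!: derivative_eq_intros \<beta>d)
    show "x ^ (N - 1) * (- dv x / (v x)\<^sup>2) + M * k' x \<le> 0"
    proof -
      \<comment> \<open>\<open>X\<close> is x^(N-3) with a possibly negative exponent. For N = 2 the
        truncated exponent N - 2 - 1 is 0 instead, but its term has the factor N - 2 = 0.\<close>
      define X where "X = x ^ (N - 2) / x"
      have X: "0 < X" using x0 by (simp add: X_def)
      have "real (N - 2) * x ^ (N - 2 - 1) = real (N - 2) * X"
      proof (cases "N = 2")
        case False
        then have "N - 2 = Suc (N - 2 - 1)" using two_buyers by simp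
        then have "x ^ (N - 2) = x * x ^ (N - 2 - 1)" by (metis power_Suc)
        then show ?thesis using x0 by (simp add: X_def)
      qed simp
      then have "k' x = X * (real (N - 2) * \<beta> x + real (N - 1) * (v x - \<beta> x))"
        using x0 by (simp add: k'_def \<beta>'_def X_def field_simps)
      also have "real (N - 2) * \<beta> x + real (N - 1) * (v x - \<beta> x) \<le> (2 * real N - 3) * v x"
      proof -
        have "real (N - 2) * \<beta> x \<le> real (N - 2) * v x"
          using \<beta>_less[of x] x by (intro mult_left_mono) auto
        moreover have "real (N - 1) * (v x - \<beta> x) \<le> real (N - 1) * v x"
          using \<beta>_pos[of x] x by (intro mult_left_mono) auto
        moreover have "real (N - 2) * v x + real (N - 1) * v x = (2 * real N - 3) * v x"
          using two_buyers by (simp add: of_nat_diff algebra_simps)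
        ultimately show ?thesis by linarith
      qed
      finally have "k' x \<le> X * ((2 * real N - 3) * v x)" using X by simp
      then have "M * k' x \<le> M * (X * ((2 * real N - 3) * v x))"
        using M_pos by (intro mult_left_mono) auto
      also have "\<dots> = X * (M * ((2 * real N - 3) * v x))" by simp
      also have "\<dots> \<le> X * (dv x * x\<^sup>2 / (v x)\<^sup>2)"
        using X by (intro mult_left_mono M_D[OF x]) auto
      also have "\<dots> = x ^ (N - 1) * (dv x / (v x)\<^sup>2)"
        unfolding X_def pow power2_eq_square using x0 by simp
      finally show ?thesis by simp
    qed
  qed
  then show "\<exists>\<beta>' m' r' k'. dual_core N M bmax \<beta> \<beta>' (\<lambda>x. 1 / v x) m' (\<lambda>x. x / v x)
           (\<lambda>x. 1 - \<beta> x / v x) (\<lambda>x. x ^ (N - 1)) r' k'" by blast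
qed

text \<open>Here w = r = 1, and \<open>J\<close> is (N - 1) / \<beta>'. The estimate v x \<le> v 1
  already bounds \<beta>', and because x^(N-2) \<le> 1 the derivative of \<open>J\<close> inherits
  the upper bound \<open>c\<close> from that of 1 / v.\<close>

lemma AP_dual_core:
  assumes c: "c < 0" "\<And>\<theta>. \<theta> \<in> {0<..1} \<Longrightarrow> vector_derivative (\<lambda>t. 1 / v t) (at \<theta> within {0<..1}) \<le> c"
  defines "M \<equiv> min (const_C AP N v bmax) (const_D AP N v)"
    and "\<beta> \<equiv> canonical_bid AP N v"
  shows "0 < M"
    and "\<exists>\<beta>' J m' r' k'. dual_core N M bmax \<beta> \<beta>' (\<lambda>x. 1 / v x) m' J (\<lambda>_. 1) (\<lambda>_. 1) r' k'"
    and "\<And>x. x \<in> {0..1} \<Longrightarrow> \<beta> x \<le> v x"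
proof -
  define J where "J x = 1 / (x ^ (N - 2) * v x)" for x
  define J' where "J' x = - (real (N - 2) * x ^ (N - 2 - 1) * v x + x ^ (N - 2) * dv x) / (x ^ (N - 2) * v x)\<^sup>2" for x
  define \<beta>' where "\<beta>' x = real (N - 1) * x ^ (N - 2) * v x" for x
  have \<beta>_eq: "\<beta> = pay" by (simp only: \<beta>_def canonical_bid_AP)
  have pow: "x ^ (N - 1) = x * x ^ (N - 2)" for x :: real
  proof -
    have "N - 1 = Suc (N - 2)" using two_buyers by simp
    then show ?thesis by (simp only: power_Suc)
  qed
  have vx: "0 < v x" if "x \<in> {0<..1}" for x using that v_pos by auto
  have slope: "- c * (v x)\<^sup>2 \<le> dv x" if x: "x \<in> {0<..1}" for x
  proof -
    have "((\<lambda>x. 1 / v x) has_real_derivative - dv x / (v x)\<^sup>2) (at x within {0<..1})"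
      using vx[OF x] x by (auto intro!: derivative_eq_intros v_deriv simp: power2_eq_square)
    then have "- dv x / (v x)\<^sup>2 \<le> c"
      using c(2)[OF x] vector_derivative_within_Ioc x by (metis greaterThanAtMost_iff)
    moreover have "0 < (v x)\<^sup>2" using vx[OF x] by simp
    ultimately have "- dv x \<le> c * (v x)\<^sup>2" by (simp only: pos_divide_le_eq)
    then show ?thesis by simp
  qed
  have dv_pos: "0 < dv x" if x: "x \<in> {0<..1}" for x
  proof -
    have "0 < - c * (v x)\<^sup>2" using c(1) vx[OF x] by (intro mult_pos_pos) auto
    then show ?thesis using slope[OF x] by linarith
  qed
  have J_deriv: "(J has_real_derivative J' x) (at x within {0<..1})" if x: "x \<in> {0<..1}" for x
  proof -
    have "((\<lambda>x. x ^ (N - 2) * v x) has_real_derivative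
        real (N - 2) * x ^ (N - 2 - 1) * v x + x ^ (N - 2) * dv x) (at x within {0<..1})"
      by (auto intro!: derivative_eq_intros v_deriv power_deriv_within x)
    moreover have "x ^ (N - 2) * v x \<noteq> 0" using x vx[OF x] by auto
    ultimately show ?thesis
      unfolding J_def J'_def
      by (intro DERIV_cong[OF DERIV_divide[OF DERIV_const]])
         (auto simp: power2_eq_square simp del: minus_add_distrib)
  qed
  have J'_le: "J' x \<le> c" if x: "x \<in> {0<..1}" for x
  proof -
    define Y where "Y = x ^ (N - 2)"
    have Y: "0 < Y" "Y \<le> 1" using x by (auto simp: Y_def power_le_one)
    have "- c * (Y * v x)\<^sup>2 \<le> - c * (Y * (v x)\<^sup>2)"
    proof (rule mult_left_mono)
      have "Y * Y * (v x)\<^sup>2 \<le> 1 * Y * (v x)\<^sup>2" using Y by (intro mult_right_mono) auto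
      then show "(Y * v x)\<^sup>2 \<le> Y * (v x)\<^sup>2" by (simp add: power2_eq_square mult_ac)
    qed (use c(1) in simp)
    also have "\<dots> \<le> Y * dv x" using mult_left_mono[OF slope[OF x], of Y] Y by (simp add: mult_ac)
    also have "\<dots> \<le> real (N - 2) * x ^ (N - 2 - 1) * v x + Y * dv x"
      using x vx[OF x] by simp
    finally have "- (real (N - 2) * x ^ (N - 2 - 1) * v x + Y * dv x) \<le> c * (Y * v x)\<^sup>2" by simp
    moreover have "0 < (Y * v x)\<^sup>2" using Y vx[OF x] by simp
    ultimately show ?thesis
      unfolding J'_def Y_def by (simp only: pos_divide_le_eq)
  qed
  have \<beta>_pos: "0 < \<beta> x" and \<beta>_less: "\<beta> x < x ^ (N - 1) * v x" if "0 < x" "x \<le> 1" for x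
    using pay_pos[OF that] pay_less[OF _ that] dv_pos by (auto simp: \<beta>_eq)
  have \<beta>_0: "\<beta> 0 = 0" by (simp add: \<beta>_eq pay_0)
  have \<beta>_less_v: "\<beta> x < v x" if "0 < x" "x \<le> 1" for x
  proof -
    have "x ^ (N - 1) * v x \<le> 1 * v x"
      using that v_pos[of x] by (intro mult_right_mono power_le_one) auto
    then show ?thesis using \<beta>_less[OF that] by simp
  qed
  show \<beta>_le: "\<beta> x \<le> v x" if "x \<in> {0..1}" for x
    using \<beta>_less_v[of x] \<beta>_0 v_0 that by (cases "x = 0") auto
  have \<beta>_deriv: "(\<beta> has_real_derivative \<beta>' x) (at x within {0<..1})" if "x \<in> {0<..1}" for x
    unfolding \<beta>_eq \<beta>'_def by (rule pay_deriv_Ioc[OF that])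
  have \<beta>'_pos: "0 < \<beta>' x" if "x \<in> {0<..1}" for x
    unfolding \<beta>'_def using vx[OF that] that two_buyers by auto
  have \<beta>'_le: "\<beta>' x \<le> real (N - 1) * v 1" if x: "x \<in> {0<..1}" for x
  proof -
    have "x ^ (N - 2) * v x \<le> 1 * v 1"
      using x v_mono[of x 1] vx[OF x] by (intro mult_mono power_le_one) auto
    then have "real (N - 1) * (x ^ (N - 2) * v x) \<le> real (N - 1) * v 1"
      by (intro mult_left_mono) auto
    then show ?thesis by (simp add: \<beta>'_def mult.assoc)
  qed
  have \<beta>_cont: "continuous_on {0..1} \<beta>" unfolding \<beta>_eq by (rule pay_continuous)
  have \<beta>_mono: "\<beta> x < \<beta> y" if xy: "0 \<le> x" "x < y" "y \<le> 1" for x y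
  proof (rule DERIV_pos_imp_increasing_open[OF xy(2)])
    fix z assume "x < z" "z < y"
    then show "\<exists>d. (\<beta> has_real_derivative d) (at z) \<and> 0 < d"
      using \<beta>_deriv[of z] \<beta>'_pos[of z] at_within_Ioc_interior[of z 1] xy by auto
  qed (use \<beta>_cont xy in \<open>auto intro: continuous_on_subset\<close>)
  have lower: "- c / (real (N - 1) * v 1) * \<beta>' x \<le> - J' x" if x: "x \<in> {0<..1}" for x
  proof -
    define e where "e = real (N - 1) * v 1"
    have e: "0 < e" using two_buyers v_pos[of 1] by (simp add: e_def)
    have "0 \<le> - c / e" by (rule divide_nonneg_pos) (use c(1) e in auto)
    then have "- c / e * \<beta>' x \<le> - c / e * e"
      using \<beta>'_le[OF x] unfolding e_def[symmetric] by (intro mult_left_mono)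
    also have "\<dots> = - c" using e by simp
    finally show ?thesis using J'_le[OF x] by (simp add: e_def)
  qed
  have C_def: "const_C AP N v bmax = Inf ({- vector_derivative (\<lambda>\<mu>. J (the_inv_into {0..1} \<beta> \<mu>)) (at \<mu> within {0<..\<beta> 1})
        | \<mu>. \<mu> \<in> {0<..\<beta> 1}} \<union> {1 / (v 1 * bmax)})"
    by (simp only: const_C.simps canonical_bid_inv_def \<beta>_def J_def)
  have smono: "strict_mono_on {0..1} \<beta>" using \<beta>_mono by (auto simp: strict_mono_on_def)
  have c': "0 < - c / (real (N - 1) * v 1)" "0 < 1 / (v 1 * bmax)"
    using c two_buyers v_pos[of 1] bmax_pos by (auto intro!: divide_neg_pos)
  have C: "0 < const_C AP N v bmax" "const_C AP N v bmax \<le> 1 / (v 1 * bmax)"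
    "\<And>x. x \<in> {0<..1} \<Longrightarrow> const_C AP N v bmax * \<beta>' x \<le> - J' x"
    using Inf_inverse_derivatives[OF \<beta>_cont \<beta>_0 smono \<beta>_deriv \<beta>'_pos J_deriv lower c' C_def] by blast+
  have N3: "0 < 2 * real N - 3" using two_buyers by simp
  have D_lower: "- c / ((2 * real N - 3) * v 1) \<le> dv x / ((2 * real N - 3) * v x ^ 3)"
    if x: "x \<in> {0<..1}" for x
  proof -
    have "- c * (v x)\<^sup>2 / v x ^ 3 \<le> dv x / v x ^ 3"
      using vx[OF x] slope[OF x] by (intro divide_right_mono) auto
    then have "- c * (1 / v x) \<le> dv x / v x ^ 3"
      using vx[OF x] by (simp add: power2_eq_square power3_eq_cube field_simps)
    moreover have "- c * (1 / v 1) \<le> - c * (1 / v x)"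
      using v_mono[of x 1] x vx[OF x] c by (intro mult_left_mono) (auto simp: field_simps)
    ultimately have "- c * (1 / v 1) \<le> dv x / v x ^ 3" by linarith
    then have "- c * (1 / v 1) / (2 * real N - 3) \<le> dv x / v x ^ 3 / (2 * real N - 3)"
      using N3 by (intro divide_right_mono) auto
    then show ?thesis by (simp add: mult.commute)
  qed
  have D_def: "const_D AP N v = (INF x\<in>{0<..1}. dv x / ((2 * real N - 3) * v x ^ 3))"
    by (simp add: const_D.simps dv_def)
  have c'': "0 < - c / ((2 * real N - 3) * v 1)"
    using c N3 v_pos[of 1] by (auto intro!: divide_neg_pos)
  have D: "0 < const_D AP N v"
    "\<And>x. x \<in> {0<..1} \<Longrightarrow> const_D AP N v \<le> dv x / ((2 * real N - 3) * v x ^ 3)"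
    unfolding D_def
    using INF_positive[where g="\<lambda>x. dv x / ((2 * real N - 3) * v x ^ 3)", OF D_lower c''] by blast+
  show M_pos: "0 < M" using C(1) D(1) by (simp add: M_def)
  have M_C: "M * \<beta>' x \<le> - J' x" if x: "x \<in> {0<..1}" for x
  proof -
    have "M * \<beta>' x \<le> const_C AP N v bmax * \<beta>' x"
      using \<beta>'_pos[OF x] by (intro mult_right_mono) (auto simp: M_def)
    then show ?thesis using C(3)[OF x] by simp
  qed
  have M_D: "M * ((2 * real N - 3) * v x) \<le> dv x / (v x)\<^sup>2" if x: "x \<in> {0<..1}" for x
  proof -
    have "M \<le> dv x / ((2 * real N - 3) * v x ^ 3)"
      using D(2)[OF x] by (simp add: M_def)
    then have "M * ((2 * real N - 3) * v x) \<le> dv x / ((2 * real N - 3) * v x ^ 3) * ((2 * real N - 3) * v x)"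
      using vx[OF x] N3 by (intro mult_right_mono) auto
    also have "\<dots> = dv x / (v x)\<^sup>2"
      using vx[OF x] N3 by (simp add: power2_eq_square power3_eq_cube)
    finally show ?thesis .
  qed
  define k' where "k' x = real (N - 2) * x ^ (N - 2 - 1) * \<beta> x + x ^ (N - 2) * \<beta>' x" for x
  have "dual_core N M bmax \<beta> \<beta>' (\<lambda>x. 1 / v x) (\<lambda>x. - dv x / (v x)\<^sup>2) J (\<lambda>_. 1) (\<lambda>_. 1) (\<lambda>_. 0) k'"
  proof
    show "2 \<le> N" by (rule two_buyers)
    show "0 \<le> M" using M_pos by simp
    have "M * bmax \<le> 1 / (v 1 * bmax) * bmax"
      using C(2) bmax_pos by (intro mult_right_mono) (auto simp: M_def)
    then show "M * bmax \<le> J 1" using bmax_pos by (simp add: J_def)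
    show "continuous_on {0..1} \<beta>" "\<beta> 0 = 0" by fact+
    show "\<beta> x < \<beta> y" if "0 \<le> x" "x < y" "y \<le> 1" for x y using \<beta>_mono that .
    show "continuous_on {0<..1} (\<lambda>x. 1 / v x)"
      by (intro continuous_intros v_continuous_on) (use v_pos in force)+
    show "M * (\<beta> s - \<beta> q) \<le> J q - J s" if "0 < q" "q \<le> s" "s \<le> 1" for q s
      by (rule decreasing_drop[OF J_deriv \<beta>_deriv M_C that])
    fix x :: real
    show "0 \<le> 1 * (1 / v x) * \<beta> x \<and> 1 * (1 / v x) * \<beta> x \<le> 1" if x: "0 \<le> x" "x \<le> 1"
      using \<beta>_pos[of x] \<beta>_less_v[of x] v_pos[of x] x \<beta>_0 by (cases "x = 0") auto
    assume x0: "0 < x"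
    show "x ^ (N - 2) * J x = 1 * (1 / v x)" using x0 by (simp add: J_def)
    assume x1: "x < 1"
    have x: "x \<in> {0<..1}" using x0 x1 by auto
    show \<beta>d: "(\<beta> has_real_derivative \<beta>' x) (at x)"
      using \<beta>_deriv[OF x] at_within_Ioc_interior[OF x0 x1] by simp
    show "0 \<le> \<beta>' x" using \<beta>'_pos[OF x] by simp
    show "real (N - 1) * 1 = \<beta>' x * J x"
      using x0 vx[OF x] by (simp add: \<beta>'_def J_def)
    show "((\<lambda>x. 1 / v x) has_real_derivative - dv x / (v x)\<^sup>2) (at x)"
      by (rule inverse_v_deriv[OF x0 x1])
    show "- dv x / (v x)\<^sup>2 \<le> 0" using dv_pos[OF x] vx[OF x] by simp
    show "((\<lambda>x. x ^ (N - 2) * \<beta> x) has_real_derivative k' x) (at x)"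
      unfolding k'_def by (auto intro!: derivative_eq_intros \<beta>d)
    show "1 * (- dv x / (v x)\<^sup>2) + M * k' x \<le> 0"
    proof -
      \<comment> \<open>Powers of \<open>x\<close> may be bounded by 1 because r = 1 does not decay
        at 0; hence no factor x^2 in the all-pay \<open>const_D\<close>.\<close>
      have "real (N - 2) * (x ^ (N - 2 - 1) * \<beta> x) \<le> real (N - 2) * v x"
      proof (rule mult_left_mono)
        have "x ^ (N - 2 - 1) * \<beta> x \<le> 1 * v x"
          using x \<beta>_less_v[of x] \<beta>_pos[of x] by (intro mult_mono power_le_one) auto
        then show "x ^ (N - 2 - 1) * \<beta> x \<le> v x" by simp
      qed simp
      moreover have "x ^ (N - 2) * \<beta>' x \<le> 1 * (real (N - 1) * v x)"
      proof (rule mult_mono)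
        have "x ^ (N - 2) * v x \<le> 1 * v x"
          using x vx[OF x] by (intro mult_right_mono power_le_one) auto
        then have "real (N - 1) * (x ^ (N - 2) * v x) \<le> real (N - 1) * v x"
          by (intro mult_left_mono) auto
        then show "\<beta>' x \<le> real (N - 1) * v x" by (simp add: \<beta>'_def mult.assoc)
      qed (use x \<beta>'_pos[OF x] in \<open>auto intro: power_le_one\<close>)
      moreover have "real (N - 2) * v x + real (N - 1) * v x = (2 * real N - 3) * v x"
        using two_buyers by (simp add: of_nat_diff algebra_simps)
      ultimately have "k' x \<le> (2 * real N - 3) * v x" unfolding k'_def mult.assoc by linarith
      then have "M * k' x \<le> M * ((2 * real N - 3) * v x)"
        using M_pos by (intro mult_left_mono) auto
      then show ?thesis using M_D[OF x] by simp
    qed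
  qed (auto intro: continuous_intros)
  then show "\<exists>\<beta>' J m' r' k'. dual_core N M bmax \<beta> \<beta>' (\<lambda>x. 1 / v x) m' J (\<lambda>_. 1) (\<lambda>_. 1) r' k'" by blast
qed

end

section \<open>Winning probabilities\<close>

definition win :: "nat \<Rightarrow> nat \<Rightarrow> 'a pmf \<Rightarrow> 'a \<Rightarrow> ('a \<Rightarrow> real) \<Rightarrow> real \<Rightarrow> real" where
  "win N i P d g b =
     measure_pmf.expectation (Pi_pmf ({..<N} - {i}) d (\<lambda>_. P)) (\<lambda>w. alloc N i ((\<lambda>j. g (w j))(i := b)))"

lemma alloc_fun_upd:
  assumes "i < N"
  shows "alloc N i (a(i := b)) =
    (if \<forall>j\<in>{..<N} - {i}. a j \<le> b then 1 / real (Suc (card {j\<in>{..<N} - {i}. a j = b})) else 0)"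
proof -
  have "is_arg_max (a(i := b)) (\<lambda>j. j < N) i \<longleftrightarrow> (\<forall>j\<in>{..<N} - {i}. a j \<le> b)"
    using assms by (auto simp: is_arg_max_def not_less)
  moreover have "{j. is_arg_max (a(i := b)) (\<lambda>j. j < N) j} = insert i {j\<in>{..<N} - {i}. a j = b}"
    if le: "\<forall>j\<in>{..<N} - {i}. a j \<le> b"
  proof (intro equalityI subsetI)
    fix j assume "j \<in> {j. is_arg_max (a(i := b)) (\<lambda>j. j < N) j}"
    then have j: "j < N" "\<And>y. y < N \<Longrightarrow> (a(i := b)) y \<le> (a(i := b)) j"
      unfolding is_arg_max_def mem_Collect_eq by (blast, meson not_le)
    show "j \<in> insert i {j\<in>{..<N} - {i}. a j = b}"
      using j(1) j(2)[OF assms] le by (cases "j = i") (auto intro: antisym)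
  qed (use assms le in \<open>auto simp: is_arg_max_def not_less\<close>)
  ultimately show ?thesis by (simp add: alloc_def)
qed

lemma power_antideriv: "((\<lambda>t. t ^ Suc n / real (Suc n)) has_real_derivative x ^ n) (at x within S)"
  by (rule DERIV_cong[OF DERIV_cdivide[OF power_deriv_within]]) simp

lemma integral_power:
  fixes a b :: real
  assumes "a \<le> b"
  shows "integral {a..b} (\<lambda>q. q ^ n) = (b ^ Suc n - a ^ Suc n) / real (Suc n)"
proof -
  have "((\<lambda>q. q ^ n) has_integral b ^ Suc n / real (Suc n) - a ^ Suc n / real (Suc n)) {a..b}"
  proof (rule fundamental_theorem_of_calculus[OF assms])
    fix x :: real
    show "((\<lambda>q. q ^ Suc n / real (Suc n)) has_vector_derivative x ^ n) (at x within {a..b})"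
      using power_antideriv by (simp only: has_real_derivative_iff_has_vector_derivative)
  qed
  then show ?thesis by (simp add: integral_unique diff_divide_distrib del: power_Suc of_nat_Suc)
qed

lemma integral_power_unit: "integral {0..1} (\<lambda>t::real. t ^ n) = 1 / real (Suc n)"
  by (simp add: integral_power)

text \<open>Writing \<open>1 / (c + 1)\<close> as the integral of \<open>t ^ c\<close> turns the tie-breaking probability into a
  product over the opponents, so independence applies.\<close>

lemma win_eq_integral:
  assumes i: "i < N" and fin: "finite (set_pmf P)"
  shows "win N i P d g b =
    integral {0..1} (\<lambda>t. (measure_pmf.prob P {x. g x < b} + t * measure_pmf.prob P {x. g x = b}) ^ (N - 1))"
proof -
  let ?A = "{..<N} - {i}"
  let ?Q = "Pi_pmf ?A d (\<lambda>_. P)"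
  \<comment> \<open>\<open>h t\<close> is the chance of not losing to one opponent if a tie is
    survived with probability \<open>t\<close>; integrating over \<open>t\<close> is a uniform
    tie-breaking draw of the bidder.\<close>
  define h where "h t x = indicat_real {x. g x < b} x + t * indicat_real {x. g x = b} x" for t x
  have finA: "finite ?A" by simp
  have finQ: "finite (set_pmf ?Q)"
    using fin by (intro finite_subset[OF set_Pi_pmf_subset'] finite_PiE_dflt) auto
  have h_prod: "(\<Prod>j\<in>?A. h t (w j)) = (if \<forall>j\<in>?A. g (w j) \<le> b then t ^ card {j\<in>?A. g (w j) = b} else 0)" for t w
  proof (cases "\<forall>j\<in>?A. g (w j) \<le> b")
    case True
    have "(\<Prod>j\<in>?A. h t (w j)) = (\<Prod>j\<in>?A. if g (w j) = b then t else 1)"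
      using True by (intro prod.cong) (auto simp: h_def indicator_def less_le)
    also have "\<dots> = (\<Prod>j\<in>{j\<in>?A. g (w j) = b}. t)"
      by (subst prod.inter_filter) auto
    finally show ?thesis using True by simp
  next
    case False
    then obtain j where "j \<in> ?A" "b < g (w j)" by (auto simp: not_le)
    then have "\<exists>j\<in>?A. h t (w j) = 0" by (intro bexI[of _ j]) (auto simp: h_def)
    then show ?thesis using False by (subst prod_zero) auto
  qed
  have "win N i P d g b = (\<Sum>w\<in>set_pmf ?Q. integral {0..1} (\<lambda>t. (\<Prod>j\<in>?A. h t (w j)) * pmf ?Q w))"
  proof -
    have "alloc N i ((\<lambda>j. g (w j))(i := b)) = integral {0..1} (\<lambda>t. \<Prod>j\<in>?A. h t (w j))" for w
      unfolding alloc_fun_upd[OF i] h_prod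
      by (cases "\<forall>j\<in>?A. g (w j) \<le> b") (simp_all only: if_P if_not_P if_True if_False integral_power_unit integral_0)
    then show ?thesis
      unfolding win_def by (subst integral_measure_pmf_real[OF finQ]) auto
  qed
  also have "\<dots> = integral {0..1} (\<lambda>t. \<Sum>w\<in>set_pmf ?Q. (\<Prod>j\<in>?A. h t (w j)) * pmf ?Q w)"
    unfolding h_def
    by (rule Henstock_Kurzweil_Integration.integral_sum[symmetric, OF finQ])
       (intro integrable_continuous_real continuous_intros)
  also have "\<dots> = integral {0..1} (\<lambda>t. (measure_pmf.prob P {x. g x < b} + t * measure_pmf.prob P {x. g x = b}) ^ (N - 1))"
  proof (rule integral_cong)
    fix t :: real assume t: "t \<in> {0..1}"
    have int: "integrable (measure_pmf P) f" for f :: "'a \<Rightarrow> real"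
      by (rule integrable_measure_pmf_finite[OF fin])
    have "(\<Sum>w\<in>set_pmf ?Q. (\<Prod>j\<in>?A. h t (w j)) * pmf ?Q w) = measure_pmf.expectation ?Q (\<lambda>w. \<Prod>j\<in>?A. h t (w j))"
      by (rule integral_measure_pmf_real[symmetric, OF finQ])
    also have "\<dots> = (\<Prod>j\<in>?A. measure_pmf.expectation P (h t))"
      by (rule expectation_prod_Pi_pmf[OF finA int]) (use t in \<open>auto simp: h_def\<close>)
    also have "\<dots> = measure_pmf.expectation P (h t) ^ (N - 1)"
      using i by simp
    also have "measure_pmf.expectation P (h t) =
        measure_pmf.prob P {x. g x < b} + t * measure_pmf.prob P {x. g x = b}"
      unfolding h_def by (subst Bochner_Integration.integral_add[OF int int]) simp
    finally show "(\<Sum>w\<in>set_pmf ?Q. (\<Prod>j\<in>?A. h t (w j)) * pmf ?Q w) =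
       (measure_pmf.prob P {x. g x < b} + t * measure_pmf.prob P {x. g x = b}) ^ (N - 1)" .
  qed
  finally show ?thesis .
qed

text \<open>With \<open>a\<close> and \<open>p\<close> the probabilities of a lower and of an equal
  opposing bid and n = N - 1, it says that the winning probability is the mean of q^(N-1) over the
  quantiles of the bid.\<close>

lemma integral_affine_power:
  fixes a p :: real
  shows "p * integral {0..1} (\<lambda>t. (a + t * p) ^ n) = ((a + p) ^ Suc n - a ^ Suc n) / real (Suc n)"
proof -
  have "((\<lambda>t. p * (a + t * p) ^ n) has_integral
     (a + 1 * p) ^ Suc n / real (Suc n) - (a + 0 * p) ^ Suc n / real (Suc n)) {0..1}"
  proof (rule fundamental_theorem_of_calculus)
    fix x :: real
    have "((\<lambda>t. (a + t * p) ^ Suc n / real (Suc n)) has_real_derivative p * (a + x * p) ^ n) (at x within {0..1})"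
      by (rule DERIV_cong[OF DERIV_chain2[OF power_antideriv[where S=UNIV]]])
         (auto intro!: derivative_eq_intros simp: mult.commute)
    then show "((\<lambda>t. (a + t * p) ^ Suc n / real (Suc n)) has_vector_derivative p * (a + x * p) ^ n) (at x within {0..1})"
      by (simp only: has_real_derivative_iff_has_vector_derivative)
  qed simp
  then show ?thesis
    by (simp add: integral_unique diff_divide_distrib flip: integral_mult_right del: power_Suc of_nat_Suc)
qed

text \<open>The lower bound counts every tie as a loss. It is the form in which the canonical
  deviation is valued.\<close>

lemma win_bounds:
  assumes "i < N" "finite (set_pmf P)"
  shows "measure_pmf.prob P {x. g x < b} ^ (N - 1) \<le> win N i P d g b" and "win N i P d g b \<le> 1"
    and "0 \<le> win N i P d g b"
proof -
  let ?a = "measure_pmf.prob P {x. g x < b}" and ?p = "measure_pmf.prob P {x. g x = b}"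
  have "?a + ?p = measure_pmf.prob P ({x. g x < b} \<union> {x. g x = b})"
    by (rule measure_pmf.finite_measure_Union[symmetric]) auto
  then have le: "?a + ?p \<le> 1" by simp
  have int: "(\<lambda>t. (?a + t * ?p) ^ (N - 1)) integrable_on {0..1}"
    by (intro integrable_continuous_real continuous_intros)
  have "integral {0..1} (\<lambda>t::real. ?a ^ (N - 1)) \<le> integral {0..1} (\<lambda>t. (?a + t * ?p) ^ (N - 1))"
    by (rule integral_le[OF _ int]) (auto intro!: power_mono)
  then show 1: "?a ^ (N - 1) \<le> win N i P d g b"
    by (simp add: win_eq_integral[OF assms])
  have "integral {0..1} (\<lambda>t. (?a + t * ?p) ^ (N - 1)) \<le> integral {0..1} (\<lambda>t::real. 1)"
  proof (rule integral_le[OF int])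
    fix t :: real assume "t \<in> {0..1}"
    then have "0 \<le> ?a + t * ?p" "?a + t * ?p \<le> 1"
      using mult_right_mono[of t 1 ?p] le by simp_all
    then show "(?a + t * ?p) ^ (N - 1) \<le> 1" by (rule power_le_one)
  qed (intro integrable_continuous_real continuous_intros)
  then show "win N i P d g b \<le> 1"
    by (simp add: win_eq_integral[OF assms])
  show "0 \<le> win N i P d g b" by (rule order_trans[OF _ 1]) simp
qed

lemma expectation_pair_pmf_finite:
  fixes f :: "'a \<times> 'b \<Rightarrow> real"
  assumes "finite (set_pmf p)" "finite (set_pmf q)"
  shows "measure_pmf.expectation (pair_pmf p q) f =
    (\<Sum>x\<in>set_pmf p. pmf p x * measure_pmf.expectation q (\<lambda>y. f (x, y)))"
proof -
  have "measure_pmf.expectation (pair_pmf p q) f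
     = (\<Sum>z\<in>set_pmf p \<times> set_pmf q. f z * pmf (pair_pmf p q) z)"
    by (rule integral_measure_pmf_real) (use assms in auto)
  also have "\<dots> = (\<Sum>x\<in>set_pmf p. \<Sum>y\<in>set_pmf q. f (x, y) * (pmf p x * pmf q y))"
    unfolding sum.cartesian_product by (intro sum.cong) (auto simp: pmf_pair)
  also have "\<dots> = (\<Sum>x\<in>set_pmf p. pmf p x * measure_pmf.expectation q (\<lambda>y. f (x, y)))"
    by (intro sum.cong refl, subst integral_measure_pmf_real[OF assms(2)])
       (auto simp: sum_distrib_left mult_ac)
  finally show ?thesis .
qed

context layers
begin

text \<open>In \<open>G\<close>, \<open>X\<close> is the winning probability of the bidder's own bid; its mean over the types is
  \<open>1 / N\<close>.\<close>

lemma integrated_gain: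
  fixes X G :: "real \<Rightarrow> real"
  assumes X: "\<And>b. b \<in> bids \<Longrightarrow> real N * (X b * mass b) = upto b ^ N - below b ^ N"
    and G: "\<And>k x. k \<le> K \<Longrightarrow> t k < x \<Longrightarrow> x < t (Suc k) \<Longrightarrow>
      G x = below (\<beta> x) ^ (N - 1) * w x - (x ^ (N - 1) * (w x - 1) + r x * m x * \<beta> x)
        - X (s k) + s k * (\<rho> (s k) * m x)"
  obtains Z where "(G has_integral Z) {0..1}"
    and "M * (\<Sum>k\<le>K. integral {t k..t (Suc k)} (\<lambda>x. x ^ (N - 2) * ((s k - \<beta> x)\<^sup>2 / 2))) \<le> Z"
proof
  define q where "q k = (t (Suc k) - t k) * (- X (s k)) + s k * (\<rho> (s k) * integral {t k..t (Suc k)} m)" for k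
  \<comment> \<open>\<open>a\<close> collects what does not involve the bid of type \<open>x\<close>
    itself. Its last summand stems from w x - 1 and integrates to 1 / N.\<close>
  define a where "a x = below (\<beta> x) ^ (N - 1) * w x - (x ^ (N - 1) * w x + r x * m x * \<beta> x) + x ^ (N - 1)" for x
  have pw: "((\<lambda>x::real. x ^ (N - 1)) has_integral 1 / real N) {0..1}"
  proof -
    have "(\<lambda>x::real. x ^ (N - 1)) integrable_on {0..1}"
      by (intro integrable_continuous_real continuous_intros)
    moreover have "Suc (N - 1) = N" using two_le_N by simp
    ultimately show ?thesis
      using integral_power_unit[of "N - 1"] by (metis has_integral_integral)
  qed
  have a: "(a has_integral integral {0..1} (\<lambda>x. below (\<beta> x) ^ (N - 1) * w x)
      - integral {0..1} (\<lambda>x. x ^ (N - 1) * w x + r x * m x * \<beta> x) + 1 / real N) {0..1}"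
    unfolding a_def
    by (intro has_integral_add has_integral_diff pw integrable_integral integrable_add
        weighted_w_integrable payment_integrable has_integral_integrable[OF value_below_eq]) auto
  have cells: "((\<lambda>x. G x - a x) has_integral (\<Sum>k<Suc K. q k)) {t 0..t (Suc K)}"
  proof (rule has_integral_piecewise[where g="\<lambda>k x. - X (s k) + s k * (\<rho> (s k) * m x)"])
    fix k assume "k < Suc K"
    then have k: "k \<le> K" by simp
    have c: "((\<lambda>x. - X (s k)) has_integral (t (Suc k) - t k) * (- X (s k))) {t k..t (Suc k)}"
      using has_integral_const_real[of "- X (s k)" "t k" "t (Suc k)"] t_less[OF k] by simp
    show "((\<lambda>x. - X (s k) + s k * (\<rho> (s k) * m x)) has_integral q k) {t k..t (Suc k)}"
    proof (cases "k = 0")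
      case True
      then show ?thesis using c by (simp add: q_def s_0)
    next
      case False
      then have "0 < t k" using t_le[of 1 k] t_less[of 0] t_0 k by simp
      then have "m integrable_on {t k..t (Suc k)}"
        by (intro integrable_continuous_real m_continuous_on) (use t_range[of "Suc k"] k in auto)
      then show ?thesis
        unfolding q_def by (intro has_integral_add c has_integral_mult_right integrable_integral)
    qed
    show "t k < t (Suc k)" by (rule t_less[OF k])
    show "G x - a x = - X (s k) + s k * (\<rho> (s k) * m x)" if "t k < x" "x < t (Suc k)" for x
      unfolding G[OF k that] a_def by (simp add: algebra_simps)
  qed
  have "((\<lambda>x. (G x - a x) + a x) has_integral (\<Sum>k\<le>K. q k) + (integral {0..1} (\<lambda>x. below (\<beta> x) ^ (N - 1) * w x)
      - integral {0..1} (\<lambda>x. x ^ (N - 1) * w x + r x * m x * \<beta> x) + 1 / real N)) {0..1}"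
    by (rule has_integral_add[OF _ a]) (use cells in \<open>simp only: t_0 t_last lessThan_Suc_atMost\<close>)
  then show "(G has_integral (\<Sum>k\<le>K. q k) + (integral {0..1} (\<lambda>x. below (\<beta> x) ^ (N - 1) * w x)
      - integral {0..1} (\<lambda>x. x ^ (N - 1) * w x + r x * m x * \<beta> x) + 1 / real N)) {0..1}"
    by simp
  have "(\<Sum>k\<le>K. (t (Suc k) - t k) * X (s k)) = (\<Sum>b\<in>bids. X b * mass b)"
  proof -
    have "(\<Sum>b\<in>bids. X b * mass b) = (\<Sum>b\<in>bids. \<Sum>k\<in>{k\<in>{..K}. s k = b}. (t (Suc k) - t k) * X (s k))"
      unfolding mass_def by (intro sum.cong) (auto simp: sum_distrib_left mult.commute)
    then show ?thesis by (simp only: sum_bids_all)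
  qed
  \<comment> \<open>The N symmetric buyers share one object, so each wins with mean probability 1 /
    N; here this is the telescoping of \<open>upto b ^ N - below b ^ N\<close>. It cancels the 1 / N
    in the integral of \<open>a\<close>.\<close>
  moreover have "real N * (\<Sum>b\<in>bids. X b * mass b) = 1"
  proof -
    have "real N * (\<Sum>b\<in>bids. X b * mass b) = (\<Sum>b\<in>bids. upto b ^ N - below b ^ N)"
      unfolding sum_distrib_left by (intro sum.cong) (auto simp: X)
    then show ?thesis using sum_telescope_all[of "\<lambda>x. x ^ N"] two_le_N by simp
  qed
  ultimately have "(\<Sum>k\<le>K. (t (Suc k) - t k) * X (s k)) = 1 / real N"
    using two_le_N by (simp add: field_simps)
  moreover have "(\<Sum>k\<le>K. q k) = - (\<Sum>k\<le>K. (t (Suc k) - t k) * X (s k))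
      + (\<Sum>k\<le>K. s k * (\<rho> (s k) * integral {t k..t (Suc k)} m))"
    by (simp add: q_def sum.distrib sum_negf sum_subtractf)
  ultimately show "M * (\<Sum>k\<le>K. integral {t k..t (Suc k)} (\<lambda>x. x ^ (N - 2) * ((s k - \<beta> x)\<^sup>2 / 2)))
    \<le> (\<Sum>k\<le>K. q k) + (integral {0..1} (\<lambda>x. below (\<beta> x) ^ (N - 1) * w x)
      - integral {0..1} (\<lambda>x. x ^ (N - 1) * w x + r x * m x * \<beta> x) + 1 / real N)"
    using duality_gap by linarith
qed

end

section \<open>Deviations in a discretisation\<close>

text \<open>Both utilities are affine in the allocation, so an expected utility involves the
  opponents only through the winning probability, here \<open>x\<close>.\<close>

fun surplus :: "auction_format \<Rightarrow> real \<Rightarrow> real \<Rightarrow> real \<Rightarrow> real" where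
  "surplus FP x b w = x * (w - b)"
| "surplus AP x b w = x * w - b"

lemma symmetric_profile_eq: "symmetric_profile N l \<Longrightarrow> j < N \<Longrightarrow> l j = l 0"
  unfolding symmetric_profile_def by (metis le_less_trans le0)

lemma alloc_symmetric_profile:
  assumes "symmetric_profile N l" "i < N"
  shows "alloc N i ((\<lambda>j. l j (w j))(i := b)) = alloc N i ((\<lambda>j. l 0 (w j))(i := b))"
proof -
  have eq: "l j = l 0" if "j < N" for j
    using assms(1) that by (rule symmetric_profile_eq)
  have "{j \<in> {..<N} - {i}. l j (w j) = b} = {j \<in> {..<N} - {i}. l 0 (w j) = b}"
    by (rule Collect_cong) (metis DiffD1 lessThan_iff eq)
  moreover have "(\<forall>j\<in>{..<N} - {i}. l j (w j) \<le> b) = (\<forall>j\<in>{..<N} - {i}. l 0 (w j) \<le> b)"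
    by (rule ball_cong[OF refl]) (metis DiffD1 lessThan_iff eq)
  ultimately show ?thesis by (simp only: alloc_fun_upd[OF assms(2)])
qed

lemma expected_utility_symmetric:
  assumes "symmetric_profile N l" "i < N" "finite (set_pmf P)"
  shows "measure_pmf.expectation (Pi_pmf ({..<N} - {i}) d (\<lambda>_. P))
      (\<lambda>w. utility fmt N i ((\<lambda>j. l j (w j))(i := b)) x) = surplus fmt (win N i P d (l 0) b) b x"
proof -
  have int: "integrable (measure_pmf (Pi_pmf ({..<N} - {i}) d (\<lambda>_. P))) g" for g :: "_ \<Rightarrow> real"
    using assms(3)
    by (intro integrable_measure_pmf_finite finite_subset[OF set_Pi_pmf_subset'] finite_PiE_dflt) auto
  show ?thesis
    unfolding win_def
    by (cases fmt) (simp_all add: alloc_symmetric_profile[OF assms(1,2)] int)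
qed

lemma finite_profiles: "finite V \<Longrightarrow> finite B \<Longrightarrow> finite (profiles N V B)"
  unfolding profiles_def by (intro finite_PiE) auto

lemma BCCE_surplus:
  assumes bcce: "BCCE fmt N V B P \<sigma>" and sym: "\<And>l. l \<in> set_pmf \<sigma> \<Longrightarrow> symmetric_profile N l"
    and fin: "finite V" "finite B" "finite (set_pmf P)"
    and i: "i < N" and x: "x \<in> V" and b: "b \<in> B"
  shows "(\<Sum>l\<in>set_pmf \<sigma>. pmf \<sigma> l * surplus fmt (win N i P 0 (l 0) b) b x)
    \<le> (\<Sum>l\<in>set_pmf \<sigma>. pmf \<sigma> l * surplus fmt (win N i P 0 (l 0) (l 0 x)) (l 0 x) x)"
proof -
  let ?Q = "Pi_pmf ({..<N} - {i}) 0 (\<lambda>_. P)"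
  have fin\<sigma>: "finite (set_pmf \<sigma>)"
    using bcce fin finite_profiles unfolding BCCE_def by (blast intro: finite_subset)
  have finQ: "finite (set_pmf ?Q)"
    using fin by (intro finite_subset[OF set_Pi_pmf_subset'] finite_PiE_dflt) auto
  have E: "measure_pmf.expectation ?Q (\<lambda>w. utility fmt N i ((\<lambda>j. l j (w j))(i := b)) x
        - utility fmt N i (\<lambda>j. l j ((w(i := x)) j)) x)
      = surplus fmt (win N i P 0 (l 0) b) b x - surplus fmt (win N i P 0 (l 0) (l 0 x)) (l 0 x) x"
    if l: "l \<in> set_pmf \<sigma>" for l
  proof -
    have "l i = l 0" using sym[OF l] i by (rule symmetric_profile_eq)
    then have "(\<lambda>j. l j ((w(i := x)) j)) = (\<lambda>j. l j (w j))(i := l 0 x)" for w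
      by (auto simp: fun_eq_iff)
    then show ?thesis
      by (simp only: Bochner_Integration.integral_diff integrable_measure_pmf_finite[OF finQ]
          expected_utility_symmetric[OF sym[OF l] i fin(3)])
  qed
  have "measure_pmf.expectation (pair_pmf \<sigma> ?Q)
      (\<lambda>(l, w). utility fmt N i ((\<lambda>j. l j (w j))(i := b)) x
         - utility fmt N i (\<lambda>j. l j ((w(i := x)) j)) x) \<le> 0"
    using bcce i x b unfolding BCCE_def by blast
  also have "measure_pmf.expectation (pair_pmf \<sigma> ?Q)
      (\<lambda>(l, w). utility fmt N i ((\<lambda>j. l j (w j))(i := b)) x
         - utility fmt N i (\<lambda>j. l j ((w(i := x)) j)) x)
    = (\<Sum>l\<in>set_pmf \<sigma>. pmf \<sigma> l * (surplus fmt (win N i P 0 (l 0) b) b x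
      - surplus fmt (win N i P 0 (l 0) (l 0 x)) (l 0 x) x))"
    unfolding expectation_pair_pmf_finite[OF fin\<sigma> finQ] prod.case
    by (intro sum.cong refl arg_cong2[where f="(*)"] E)
  finally show ?thesis by (simp add: right_diff_distrib sum_subtractf)
qed

text \<open>The midpoint of a gap of \<open>S\<close> has distance at least half the gap from
  \<open>S\<close>.\<close>

lemma grid_gap:
  fixes S :: "real set"
  assumes sup: "(SUP w\<in>{0..R}. INF w'\<in>S. \<bar>w - w'\<bar>) \<le> d"
    and "finite S" "0 \<in> S" and ac: "0 \<le> a" "a \<le> c" "c \<le> R"
    and gap: "\<And>x. x \<in> S \<Longrightarrow> x \<le> a \<or> c \<le> x"
  shows "c - a \<le> 2 * d"
proof -
  define w where "w = (a + c) / 2"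
  have w: "w \<in> {0..R}" using ac by (auto simp: w_def)
  \<comment> \<open>The supremum dominates its members only if they are bounded; the point 0 of
    \<open>S\<close> bounds all distances by \<open>R\<close>.\<close>
  have bdd: "bdd_above ((\<lambda>w. INF w'\<in>S. \<bar>w - w'\<bar>) ` {0..R})"
  proof (rule bdd_aboveI2)
    fix w assume "w \<in> {0..R}"
    moreover have "(INF w'\<in>S. \<bar>w - w'\<bar>) \<le> \<bar>w - 0\<bar>"
      by (rule cINF_lower) (use assms in \<open>auto intro: bdd_belowI2[of _ 0]\<close>)
    ultimately show "(INF w'\<in>S. \<bar>w - w'\<bar>) \<le> R" by simp
  qed
  have "(c - a) / 2 \<le> (INF w'\<in>S. \<bar>w - w'\<bar>)"
    by (rule cINF_greatest) (use \<open>0 \<in> S\<close> gap ac in \<open>force simp: w_def field_simps abs_if\<close>)+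
  also have "\<dots> \<le> d" using cSUP_upper[OF w bdd] sup by linarith
  finally show ?thesis by simp
qed

section \<open>Passing between values and quantiles\<close>

context continuous_auction
begin

lemma F_mono: "x \<le> y \<Longrightarrow> F x \<le> F y" and F_le_1: "F x \<le> 1"
proof -
  interpret P: prob_space "density lborel (\<lambda>x. ennreal (f x))" by (rule density_prob)
  interpret finite_borel_measure "density lborel (\<lambda>x. ennreal (f x))" by unfold_locales simp
  show "F x \<le> F y" if "x \<le> y" using cdf_nondecreasing[OF that] by (simp add: F_cdf)
  show "F x \<le> 1" unfolding F_cdf using cdf_bounded[of x] P.prob_space by simp
qed

lemma v_F: "0 \<le> x \<Longrightarrow> x \<le> v 1 \<Longrightarrow> F x \<in> {0..1} \<and> v (F x) = x"
proof -
  assume "0 \<le> x" "x \<le> v 1"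
  then obtain \<theta> where "\<theta> \<in> {0..1}" "v \<theta> = x" using v_image by (metis atLeastAtMost_iff imageE)
  then show ?thesis using v_inverse by auto
qed

lemma F_pos: "0 < x \<Longrightarrow> 0 < F x"
proof -
  assume x: "0 < x"
  show ?thesis
  proof (cases "x \<le> v 1")
    case True
    then show ?thesis using v_F[of x] x v_0 by (cases "F x = 0") auto
  next
    case False
    then have "F (v 1) \<le> F x" by (intro F_mono) simp
    then show ?thesis using v_inverse[of 1] by simp
  qed
qed

lemma inverse_v_integrable:
  assumes "0 < a"
  shows "(\<lambda>\<theta>. c / v \<theta>) integrable_on {a..1}"
proof (rule integrable_continuous_real)
  show "continuous_on {a..1} (\<lambda>\<theta>. c / v \<theta>)"
  proof (intro continuous_intros v_continuous_on)
    show "\<forall>x\<in>{a..1}. v x \<noteq> 0"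
    proof
      fix x assume "x \<in> {a..1}"
      then show "v x \<noteq> 0" using v_pos[of x] assms by simp
    qed
  qed (use assms in auto)
qed

end

section \<open>The grid of a discretisation in quantile coordinates\<close>

context fine_discretisations
begin

text \<open>The prior gives \<open>vn n k\<close> the mass \<open>cut n (Suc k) - cut n k\<close>,
  so discrete types are uniform quantiles rounded down to a cut.\<close>

definition cut :: "nat \<Rightarrow> nat \<Rightarrow> real" where "cut n k = F (vn n k)"

lemma vn_less: "i < j \<Longrightarrow> j \<le> Suc (K n) \<Longrightarrow> vn n i < vn n j"
  using vn_strict_mono[of n] by (auto simp: strict_mono_on_def)

lemma vn_range: "k \<le> Suc (K n) \<Longrightarrow> 0 \<le> vn n k \<and> vn n k \<le> v 1"
  using vn_less[of 0 k n] vn_less[of k "Suc (K n)" n] vn_first[of n] vn_last[of n]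
  by (cases "k = 0"; cases "k = Suc (K n)") auto

lemma cut_range: "k \<le> Suc (K n) \<Longrightarrow> cut n k \<in> {0..1}" and v_cut: "k \<le> Suc (K n) \<Longrightarrow> v (cut n k) = vn n k"
  using v_F[of "vn n k"] vn_range[of k n] by (auto simp: cut_def)

lemma cells: "bid_cells (K n) (cut n)"
proof
  show "cut n 0 = 0" using v_inverse[of 0] v_0 vn_first[of n] by (simp add: cut_def)
  show "cut n (Suc (K n)) = 1" using v_inverse[of 1] vn_last[of n] by (simp add: cut_def)
  show "cut n k < cut n (Suc k)" if "k \<le> K n" for k
    using vn_less[of k "Suc k" n] that v_cut[of k n] v_cut[of "Suc k" n]
      v_mono[of "cut n (Suc k)" "cut n k"] cut_range[of k n] cut_range[of "Suc k" n] by force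
qed

lemma prior_prob:
  "measure_pmf.prob (Fn n) {x. Q x} = (\<Sum>k\<in>{k\<in>{..K n}. Q (vn n k)}. cut n (Suc k) - cut n k)"
proof -
  have inj: "inj_on (vn n) {..K n}"
    by (rule strict_mono_on_imp_inj_on, rule monotone_on_subset[OF vn_strict_mono]) auto
  have "measure_pmf.prob (Fn n) {x. Q x} = measure_pmf.prob (Fn n) ({x. Q x} \<inter> set_pmf (Fn n))"
    by (rule measure_Int_set_pmf[symmetric])
  also have "\<dots> = measure_pmf.prob (Fn n) (vn n ` {k\<in>{..K n}. Q (vn n k)} \<inter> set_pmf (Fn n))"
    using prior_support[of n] by (intro arg_cong[where f="measure_pmf.prob (Fn n)"]) (auto simp: grid_def)
  also have "\<dots> = measure_pmf.prob (Fn n) (vn n ` {k\<in>{..K n}. Q (vn n k)})"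
    by (rule measure_Int_set_pmf)
  also have "\<dots> = (\<Sum>k\<in>{k\<in>{..K n}. Q (vn n k)}. pmf (Fn n) (vn n k))"
    by (subst measure_measure_pmf_finite) (auto intro!: sum.reindex[unfolded o_def] inj_on_subset[OF inj])
  also have "\<dots> = (\<Sum>k\<in>{k\<in>{..K n}. Q (vn n k)}. cut n (Suc k) - cut n k)"
    by (intro sum.cong) (auto simp: prior cut_def)
  finally show ?thesis .
qed

lemma finite_grid: "finite (grid (K n) (vn n))"
  by (simp add: grid_def)

lemma finite_prior: "finite (set_pmf (Fn n))"
  using prior_support finite_grid by (rule finite_subset)

lemma vn_gap: "k \<le> K n \<Longrightarrow> vn n (Suc k) - vn n k \<le> 2 * \<delta> n"
proof (rule grid_gap[OF fine_valuations finite_grid])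
  assume k: "k \<le> K n"
  show "0 \<in> grid (K n) (vn n)" using vn_first[of n] by (auto simp: grid_def intro!: image_eqI[of _ _ 0])
  show "0 \<le> vn n k" "vn n (Suc k) \<le> v 1" using vn_range[of k n] vn_range[of "Suc k" n] k by auto
  show "vn n k \<le> vn n (Suc k)" using vn_less[of k "Suc k" n] k by simp
  fix x assume "x \<in> grid (K n) (vn n)"
  then obtain j where j: "j \<le> K n" "x = vn n j" by (auto simp: grid_def)
  then show "x \<le> vn n k \<or> vn n (Suc k) \<le> x"
    using vn_less[of j k n] vn_less[of "Suc k" j n] k by (cases "j < k"; cases "j = k"; cases "j = Suc k") auto
qed

text \<open>Rounding up, not to the nearest bid, keeps every win over bids strictly below
  \<open>b\<close>. \<open>Bn_max\<close> guarantees that a bid above exists.\<close>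

lemma bid_above:
  assumes "0 \<le> b" "b \<le> bmax"
  obtains b' where "b' \<in> Bn n" "b \<le> b'" "b' \<le> b + 2 * \<delta> n"
proof -
  define b' where "b' = Min {x\<in>Bn n. b \<le> x}"
  have fin: "finite {x\<in>Bn n. b \<le> x}" using Bn_finite by simp
  have "b' \<in> {x\<in>Bn n. b \<le> x}"
    unfolding b'_def using Bn_max assms by (intro Min_in fin) auto
  then have b': "b' \<in> Bn n" "b \<le> b'" by auto
  have "b' - b \<le> 2 * \<delta> n"
  proof (rule grid_gap[OF fine_bids Bn_finite Bn_zero assms(1) b'(2)])
    show "b' \<le> bmax" using b' Bn_subset by force
    show "x \<le> b \<or> b' \<le> x" if "x \<in> Bn n" for x
      unfolding b'_def using that Min_le[OF fin, of x] by force
  qed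
  then show ?thesis using that b' by simp
qed

text \<open>Keeps \<open>F (4 * \<delta> n)\<close> positive, so that 1 / v is integrated away from
  its singularity.\<close>

lemma delta_pos: "0 < \<delta> n"
  using vn_gap[of 0 n] vn_less[of 0 1 n] by simp

lemma induced_cell:
  assumes "k \<le> K n" "cut n k < x" "x < cut n (Suc k)"
  shows "induced v (K n) (vn n) s x = s (vn n k)"
proof -
  have r: "0 \<le> cut n k" "cut n (Suc k) \<le> 1" using cut_range[of k n] cut_range[of "Suc k" n] assms by auto
  have vx: "vn n k < v x" "v x < vn n (Suc k)"
    using v_strict[of "cut n k" x] v_strict[of x "cut n (Suc k)"] v_cut[of k n] v_cut[of "Suc k" n] assms r by auto
  have "(THE j. j \<le> K n \<and> vn n j \<le> v x \<and> v x < vn n (Suc j)) = k"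
  proof (rule the_equality)
    show "k \<le> K n \<and> vn n k \<le> v x \<and> v x < vn n (Suc k)" using vx assms by simp
    fix j assume j: "j \<le> K n \<and> vn n j \<le> v x \<and> v x < vn n (Suc j)"
    show "j = k"
    proof (rule ccontr)
      assume "j \<noteq> k"
      then consider "Suc j \<le> k" | "Suc k \<le> j" by linarith
      then show False
      proof cases
        case 1
        then have "vn n (Suc j) \<le> vn n k" using vn_less[of "Suc j" k n] assms by (cases "Suc j = k") auto
        then show False using j vx by simp
      next
        case 2
        then have "vn n (Suc k) \<le> vn n j" using vn_less[of "Suc k" j n] j by (cases "Suc k = j") auto
        then show False using j vx by simp
      qed
    qed
  qed
  then show ?thesis using assms r by (simp add: induced_def)
qed

end

section \<open>Averaging the equilibrium constraints\<close>

context fine_discretisations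
begin

text \<open>The weighted gain \<open>G l x\<close> of the canonical deviation is seen from two
  sides: its integral over types is at least \<open>M\<close> times the squared distance for each
  profile separately, while equilibrium bounds its \<sigma>-average from above for almost every
  type.\<close>

lemma certificate_bound:
  fixes \<beta> w r :: "real \<Rightarrow> real" and M :: real and n :: nat
  assumes core: "dual_core N M bmax \<beta> \<beta>' (\<lambda>x. 1 / v x) m' J w r r' k'"
    and M: "0 < M"
    and \<beta>_le: "\<And>x. x \<in> {0..1} \<Longrightarrow> \<beta> x \<le> v x"
    and fmt: "fmt = FP \<and> w = (\<lambda>x. 1 - \<beta> x / v x) \<and> r = (\<lambda>x. x ^ (N - 1))
      \<or> fmt = AP \<and> w = (\<lambda>_. 1) \<and> r = (\<lambda>_. 1)"
    and bcce: "BCCE fmt N (grid (K n) (vn n)) (Bn n) (Fn n) \<sigma>"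
    and sym: "\<And>l. l \<in> set_pmf \<sigma> \<Longrightarrow> symmetric_profile N l"
  shows "(\<Sum>l\<in>set_pmf \<sigma>. pmf \<sigma> l * integral {0..1} (\<lambda>\<theta>. \<theta> ^ (N - 2) *
                  ((induced v (K n) (vn n) (l 0) \<theta> - \<beta> \<theta>)\<^sup>2 / 2)))
         \<le> (F (4 * \<delta> n) + integral {F (4 * \<delta> n)..1} (\<lambda>\<theta>. 4 * \<delta> n / v \<theta>)) / M"
proof -
  interpret dual_core N M bmax \<beta> \<beta>' "\<lambda>x. 1 / v x" m' J w r r' k' by (rule core)
  define s where "s l k = l 0 (vn n k)" for l :: "nat \<Rightarrow> real \<Rightarrow> real" and k
  define X where "X l b = win N 0 (Fn n) 0 (l 0) b" for l :: "nat \<Rightarrow> real \<Rightarrow> real" and b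
  define \<rho> where "\<rho> l b = (if fmt = FP then X l b else 1)" for l :: "nat \<Rightarrow> real \<Rightarrow> real" and b
  define lo where "lo l b = bid_cells.below (K n) (cut n) (s l) b" for l :: "nat \<Rightarrow> real \<Rightarrow> real" and b
  define S where "S = set_pmf \<sigma>"
  have N0: "0 < N" using two_buyers by simp
  have finS: "finite S"
    using bcce finite_profiles[OF finite_grid Bn_finite] unfolding BCCE_def S_def by (blast intro: finite_subset)
  have sum_\<sigma>: "(\<Sum>l\<in>S. pmf \<sigma> l) = 1"
    using finS unfolding S_def by (rule sum_pmf_eq_1) simp
  have s_mem: "s l k \<in> Bn n" if "l \<in> S" "k \<le> K n" for l k
  proof -
    have "l \<in> profiles N (grid (K n) (vn n)) (Bn n)"
      using bcce that unfolding BCCE_def S_def by blast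
    then have "l 0 \<in> grid (K n) (vn n) \<rightarrow>\<^sub>E Bn n" using N0 by (auto simp: profiles_def)
    moreover have "vn n k \<in> grid (K n) (vn n)" using that by (auto simp: grid_def)
    ultimately show ?thesis unfolding s_def by (rule PiE_mem)
  qed
  have s_range: "0 \<le> s l k \<and> s l k \<le> bmax" if "l \<in> S" "k \<le> K n" for l k
    using s_mem[OF that] Bn_subset[of n] by auto
  have cells_n: "bid_cells (K n) (cut n)" by (rule cells)
  note bc = bid_cells.below_nonneg[OF cells_n] bid_cells.upto_le_1[OF cells_n]
    bid_cells.below_le_upto[OF cells_n] bid_cells.upto_eq_below[OF cells_n]
  have lo_prob: "measure_pmf.prob (Fn n) {x. l 0 x < b} = lo l b" for l b
    unfolding lo_def bid_cells.below_def[OF cells_n] s_def by (rule prior_prob)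
  have mass_prob: "measure_pmf.prob (Fn n) {x. l 0 x = b} = bid_cells.mass (K n) (cut n) (s l) b" for l b
    unfolding bid_cells.mass_def[OF cells_n] s_def by (rule prior_prob)
  have X_bounds: "lo l b ^ (N - 1) \<le> X l b" "X l b \<le> 1" "0 \<le> X l b" for l b
    using win_bounds[OF N0 finite_prior[of n], where g="l 0" and d=0 and b=b] by (simp_all add: X_def lo_prob)
  have lo_01: "0 \<le> lo l b" "lo l b \<le> 1" for l b
    using lo_prob[of l b, symmetric] by auto
  have SucN: "Suc (N - 1) = N" using N0 by simp
  have X_mass: "X l b * bid_cells.mass (K n) (cut n) (s l) b
      = (bid_cells.upto (K n) (cut n) (s l) b ^ N - bid_cells.below (K n) (cut n) (s l) b ^ N) / real N" for l b
    using integral_affine_power[of "bid_cells.mass (K n) (cut n) (s l) b" "lo l b" "N - 1", unfolded SucN]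
    by (simp add: X_def win_eq_integral[OF N0 finite_prior] lo_prob mass_prob bc(4) lo_def mult.commute)

  have bcce_dev: "(\<Sum>l\<in>S. pmf \<sigma> l * surplus fmt (X l b) b (vn n k))
      \<le> (\<Sum>l\<in>S. pmf \<sigma> l * surplus fmt (X l (s l k)) (s l k) (vn n k))" if "k \<le> K n" "b \<in> Bn n" for k b
  proof -
    have mem: "vn n k \<in> grid (K n) (vn n)" using that by (auto simp: grid_def)
    show ?thesis
      unfolding X_def s_def S_def
      by (rule BCCE_surplus[OF bcce _ finite_grid Bn_finite finite_prior N0 mem that(2)]) (rule sym)
  qed

  \<comment> \<open>A buyer of value 0 never has positive surplus, and deviating to bid 0 secures 0,
    so the surplus vanishes in every profile of the support. In the first-price format the bid is
    then 0 because a bid that carries mass wins with positive probability.\<close>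
  have s_0: "s l 0 = 0" if l: "l \<in> S" for l
  proof -
    have sur0: "surplus fmt x 0 0 = 0" for x by (cases fmt) auto
    have nonpos: "surplus fmt (X l (s l 0)) (s l 0) 0 \<le> 0" if "l \<in> S" for l
      using s_range[OF that, of 0] X_bounds(3)[of l "s l 0"] by (cases fmt) auto
    have "0 \<le> (\<Sum>l\<in>S. pmf \<sigma> l * surplus fmt (X l (s l 0)) (s l 0) 0)"
      using bcce_dev[of 0 0] Bn_zero vn_first[of n] by (simp add: sur0)
    then have "(\<Sum>l\<in>S. - (pmf \<sigma> l * surplus fmt (X l (s l 0)) (s l 0) 0)) \<le> 0"
      by (simp add: sum_negf)
    moreover have "0 \<le> - (pmf \<sigma> l * surplus fmt (X l (s l 0)) (s l 0) 0)" if "l \<in> S" for l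
      using mult_nonneg_nonpos[OF pmf_nonneg nonpos[OF that]] by simp
    ultimately have "- (pmf \<sigma> l * surplus fmt (X l (s l 0)) (s l 0) 0) = 0"
      using l finS by (metis (no_types, lifting) sum_nonneg sum_nonneg_eq_0_iff antisym)
    moreover have "pmf \<sigma> l \<noteq> 0" using l by (simp add: S_def set_pmf_iff)
    ultimately have "surplus fmt (X l (s l 0)) (s l 0) 0 = 0" by simp
    moreover have "0 < X l (s l 0)"
    proof -
      have "s l 0 \<in> bid_cells.bids (K n) (s l)" by (auto simp: bid_cells.bids_def[OF cells_n])
      then have "bid_cells.below (K n) (cut n) (s l) (s l 0) < bid_cells.upto (K n) (cut n) (s l) (s l 0)"
        using bid_cells.mass_pos[OF cells_n] bc(4) by fastforce
      then have "bid_cells.below (K n) (cut n) (s l) (s l 0) ^ N < bid_cells.upto (K n) (cut n) (s l) (s l 0) ^ N"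
        using bc(1) N0 by (intro power_strict_mono) auto
      then have "X l (s l 0) * bid_cells.mass (K n) (cut n) (s l) (s l 0) \<noteq> 0"
        using N0 by (simp add: X_mass)
      then show ?thesis using X_bounds(3)[of l "s l 0"] by (cases "X l (s l 0) = 0") auto
    qed
    ultimately show ?thesis by (cases fmt) auto
  qed

  have layers: "layers N M bmax \<beta> \<beta>' (\<lambda>x. 1 / v x) m' J w r r' k' (K n) (cut n) (s l) (\<rho> l)" if l: "l \<in> S" for l
  proof (intro layers.intro layers_axioms.intro core cells_n)
    show "s l 0 = 0" by (rule s_0[OF l])
    show "0 \<le> s l k \<and> s l k \<le> bmax" if "k \<le> K n" for k by (rule s_range[OF l that])
    show "\<rho> l b * bid_cells.mass (K n) (cut n) (s l) b =
        integral {bid_cells.below (K n) (cut n) (s l) b..bid_cells.upto (K n) (cut n) (s l) b} r" for b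
      using fmt
    proof (elim disjE conjE)
      assume "fmt = FP" "r = (\<lambda>x. x ^ (N - 1))"
      then show ?thesis
        using integral_power[OF bc(3), of "s l" b "N - 1", unfolded SucN] by (simp add: \<rho>_def X_mass)
    next
      assume "fmt = AP" "r = (\<lambda>_. 1)"
      then show ?thesis using bc(3,4)[of "s l" b] by (simp add: \<rho>_def)
    qed
  qed

  \<comment> \<open>The bracket is the weighted payment of the deviation that is due even without
    winning: it vanishes in the first-price format and equals \<beta> x / v x in the all-pay
    format.\<close>
  define G where "G l x = (let b = induced v (K n) (vn n) (l 0) x in
      lo l (\<beta> x) ^ (N - 1) * w x - (x ^ (N - 1) * (w x - 1) + r x * (1 / v x) * \<beta> x)
        - X l b + b * (\<rho> l b * (1 / v x)))" for l :: "nat \<Rightarrow> real \<Rightarrow> real" and x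
  define Q where "Q l = integral {0..1} (\<lambda>\<theta>. \<theta> ^ (N - 2) * ((induced v (K n) (vn n) (l 0) \<theta> - \<beta> \<theta>)\<^sup>2 / 2))" for l :: "nat \<Rightarrow> real \<Rightarrow> real"
  have Q_eq: "Q l = (\<Sum>k\<le>K n. integral {cut n k..cut n (Suc k)} (\<lambda>x. x ^ (N - 2) * ((s l k - \<beta> x)\<^sup>2 / 2)))" for l
  proof -
    have "((\<lambda>\<theta>. \<theta> ^ (N - 2) * ((induced v (K n) (vn n) (l 0) \<theta> - \<beta> \<theta>)\<^sup>2 / 2)) has_integral
      (\<Sum>k<Suc (K n). integral {cut n k..cut n (Suc k)} (\<lambda>x. x ^ (N - 2) * ((s l k - \<beta> x)\<^sup>2 / 2)))) {cut n 0..cut n (Suc (K n))}"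
    proof (rule has_integral_piecewise[where g="\<lambda>k x. x ^ (N - 2) * ((s l k - \<beta> x)\<^sup>2 / 2)"])
      fix k assume "k < Suc (K n)"
      then have k: "k \<le> K n" by simp
      show "cut n k < cut n (Suc k)" by (rule bid_cells.t_less[OF cells_n k])
      show "((\<lambda>x. x ^ (N - 2) * ((s l k - \<beta> x)\<^sup>2 / 2)) has_integral
          integral {cut n k..cut n (Suc k)} (\<lambda>x. x ^ (N - 2) * ((s l k - \<beta> x)\<^sup>2 / 2))) {cut n k..cut n (Suc k)}"
        using cut_range[of k n] cut_range[of "Suc k" n] k
        by (intro integrable_integral integrable_continuous_real continuous_intros beta_continuous_on) auto
      show "x ^ (N - 2) * ((induced v (K n) (vn n) (l 0) x - \<beta> x)\<^sup>2 / 2) = x ^ (N - 2) * ((s l k - \<beta> x)\<^sup>2 / 2)"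
        if "cut n k < x" "x < cut n (Suc k)" for x
        using induced_cell[OF k that] by (simp add: s_def)
    qed
    then show ?thesis
      unfolding Q_def using bid_cells.t_0[OF cells_n] bid_cells.t_last[OF cells_n]
      by (simp only: lessThan_Suc_atMost integral_unique)
  qed
  have "\<exists>Z. (G l has_integral Z) {0..1} \<and> M * Q l \<le> Z" if l: "l \<in> S" for l
  proof -
    have 1: "real N * (X l b * bid_cells.mass (K n) (cut n) (s l) b)
      = bid_cells.upto (K n) (cut n) (s l) b ^ N - bid_cells.below (K n) (cut n) (s l) b ^ N" for b
      using N0 by (simp add: X_mass)
    have 2: "G l x = bid_cells.below (K n) (cut n) (s l) (\<beta> x) ^ (N - 1) * w x
         - (x ^ (N - 1) * (w x - 1) + r x * (1 / v x) * \<beta> x) - X l (s l k) + s l k * (\<rho> l (s l k) * (1 / v x))"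
      if "k \<le> K n" "cut n k < x" "x < cut n (Suc k)" for k x
      using induced_cell[OF that] by (simp add: G_def lo_def s_def Let_def)
    show ?thesis
      by (rule layers.integrated_gain[OF layers[OF l] 1 2]) (auto simp: Q_eq)
  qed
  then obtain Z where Z: "\<And>l. l \<in> S \<Longrightarrow> (G l has_integral Z l) {0..1}" "\<And>l. l \<in> S \<Longrightarrow> M * Q l \<le> Z l"
    by metis

  define V where "V l x = surplus fmt (lo l (\<beta> x) ^ (N - 1)) (\<beta> x) (v x)" for l :: "nat \<Rightarrow> real \<Rightarrow> real" and x
  have gain_eq: "v x * G l x = V l x - surplus fmt (X l (s l k)) (s l k) (v x)"
    if k: "k \<le> K n" "cut n k < x" "x < cut n (Suc k)" for l k x
  proof -
    have "0 < x" "x \<le> 1" using k cut_range[of k n] cut_range[of "Suc k" n] by auto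
    then have vx: "0 < v x" by (rule v_pos)
    have G_eq: "G l x = lo l (\<beta> x) ^ (N - 1) * w x - (x ^ (N - 1) * (w x - 1) + r x * (1 / v x) * \<beta> x)
         - X l (s l k) + s l k * (\<rho> l (s l k) * (1 / v x))"
      using induced_cell[OF k] by (simp add: G_def s_def Let_def)
    show ?thesis
      using fmt
    proof (elim disjE conjE)
      assume *: "fmt = FP" "w = (\<lambda>x. 1 - \<beta> x / v x)" "r = (\<lambda>x. x ^ (N - 1))"
      show ?thesis unfolding G_eq V_def * using vx by (simp add: \<rho>_def * field_simps)
    next
      assume *: "fmt = AP" "w = (\<lambda>_. 1)" "r = (\<lambda>_. 1)"
      show ?thesis unfolding G_eq V_def * using vx by (simp add: \<rho>_def * field_simps)
    qed
  qed
  \<comment> \<open>The two bounds use different deviations: bid 0, whose surplus is nonnegative,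
    for the bound 1, and the canonical bid rounded up to the grid for the other.\<close>
  have expected_gain: "(\<Sum>l\<in>S. pmf \<sigma> l * G l x) \<le> 1" "(\<Sum>l\<in>S. pmf \<sigma> l * G l x) \<le> 4 * \<delta> n / v x"
    if k: "k \<le> K n" "cut n k < x" "x < cut n (Suc k)" for k x
  proof -
    have x: "0 < x" "x < 1" using k cut_range[of k n] cut_range[of "Suc k" n] by auto
    have vx: "0 < v x" using x by (intro v_pos) auto
    have vk: "vn n k \<le> v x" "v x \<le> vn n k + 2 * \<delta> n"
      using v_mono[of "cut n k" x] v_mono[of x "cut n (Suc k)"] v_cut[of k n] v_cut[of "Suc k" n]
        cut_range[of k n] cut_range[of "Suc k" n] k vn_gap[of k n] by auto
    have \<beta>x: "0 \<le> \<beta> x" "\<beta> x \<le> v x" "\<beta> x \<le> bmax"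
      using beta_nonneg[of x] \<beta>_le[of x] v_mono[of x 1] bmax_ge x by auto
    obtain b where b: "b \<in> Bn n" "\<beta> x \<le> b" "b \<le> \<beta> x + 2 * \<delta> n"
      using bid_above[OF \<beta>x(1,3)] .
    \<comment> \<open>Surplus increases with the valuation, so on this side replacing the grid
      valuation by \<open>v x\<close> costs nothing.\<close>
    have own: "surplus fmt (X l (s l k)) (s l k) (vn n k) \<le> surplus fmt (X l (s l k)) (s l k) (v x)" for l
      using mult_left_mono[OF vk(1) X_bounds(3)[of l "s l k"]] by (cases fmt) (auto simp: right_diff_distrib)
    have dev: "V l x - 4 * \<delta> n \<le> surplus fmt (X l b) b (vn n k)" for l
    proof -
      define y where "y = lo l (\<beta> x) ^ (N - 1)"
      have y: "0 \<le> y" "y \<le> 1" "y \<le> X l b"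
      proof -
        have "lo l (\<beta> x) \<le> lo l b" unfolding lo_def by (rule bid_cells.below_mono[OF cells_n b(2)])
        then have "y \<le> lo l b ^ (N - 1)" unfolding y_def using lo_01 by (intro power_mono)
        then show "y \<le> X l b" using X_bounds(1)[of l b] by simp
      qed (use lo_01 in \<open>auto simp: y_def power_le_one\<close>)
      have V: "V l x = surplus fmt y (\<beta> x) (v x)" by (simp add: V_def y_def)
      have X1: "X l b \<le> 1" by (rule X_bounds)
      show ?thesis
      proof (cases fmt)
        case FP
        show ?thesis
        \<comment> \<open>After rounding, the bid may exceed the grid valuation. Winning more often
          then hurts, and X \<le> 1 has to replace the comparison y \<le> X.\<close>
        proof (cases "0 \<le> vn n k - b")
          case True
          have "y * (v x - \<beta> x) - 4 * \<delta> n \<le> y * (v x - \<beta> x - 4 * \<delta> n)"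
            using y mult_right_mono[of y 1 "4 * \<delta> n"] delta_nonneg[of n] by (simp add: right_diff_distrib)
          also have "\<dots> \<le> y * (vn n k - b)" using y vk b by (intro mult_left_mono) auto
          also have "\<dots> \<le> X l b * (vn n k - b)" using y True by (intro mult_right_mono) auto
          finally show ?thesis by (simp add: FP V)
        next
          case False
          have "y * (v x - \<beta> x) \<le> 1 * (v x - \<beta> x)" using y \<beta>x by (intro mult_right_mono) auto
          then have "y * (v x - \<beta> x) - 4 * \<delta> n \<le> vn n k - b" using vk b by simp
          also have "1 * (vn n k - b) \<le> X l b * (vn n k - b)"
            using False X1 by (intro mult_right_mono_neg) auto
          finally show ?thesis by (simp add: FP V)
        qed
      next
        case AP
        have "y * v x \<le> y * vn n k + 2 * \<delta> n"
          using mult_left_mono[OF vk(2) y(1)] mult_right_mono[OF y(2), of "2 * \<delta> n"] delta_nonneg[of n]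
          by (simp add: distrib_left)
        also have "y * vn n k \<le> X l b * vn n k"
          using y vn_range[of k n] k by (intro mult_right_mono) auto
        finally show ?thesis using b by (simp add: AP V)
      qed
    qed
    have G_eq: "v x * (\<Sum>l\<in>S. pmf \<sigma> l * G l x)
        = (\<Sum>l\<in>S. pmf \<sigma> l * V l x) - (\<Sum>l\<in>S. pmf \<sigma> l * surplus fmt (X l (s l k)) (s l k) (v x))"
    proof -
      have "v x * (\<Sum>l\<in>S. pmf \<sigma> l * G l x) = (\<Sum>l\<in>S. pmf \<sigma> l * (v x * G l x))"
        by (simp add: sum_distrib_left mult_ac)
      then show ?thesis by (simp add: gain_eq[OF k] right_diff_distrib sum_subtractf)
    qed
    have own_sum: "(\<Sum>l\<in>S. pmf \<sigma> l * surplus fmt (X l (s l k)) (s l k) (vn n k))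
      \<le> (\<Sum>l\<in>S. pmf \<sigma> l * surplus fmt (X l (s l k)) (s l k) (v x))"
      by (intro sum_mono mult_left_mono own pmf_nonneg)
    have "(\<Sum>l\<in>S. pmf \<sigma> l * (V l x - 4 * \<delta> n)) \<le> (\<Sum>l\<in>S. pmf \<sigma> l * surplus fmt (X l b) b (vn n k))"
      by (intro sum_mono mult_left_mono dev pmf_nonneg)
    moreover have "(\<Sum>l\<in>S. pmf \<sigma> l * (V l x - 4 * \<delta> n)) = (\<Sum>l\<in>S. pmf \<sigma> l * V l x) - 4 * \<delta> n"
      by (simp add: right_diff_distrib sum_subtractf sum_\<sigma> flip: sum_distrib_right)
    ultimately have "v x * (\<Sum>l\<in>S. pmf \<sigma> l * G l x) \<le> 4 * \<delta> n"
      using bcce_dev[OF k(1) b(1)] own_sum G_eq by linarith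
    then show "(\<Sum>l\<in>S. pmf \<sigma> l * G l x) \<le> 4 * \<delta> n / v x"
      using vx by (simp add: pos_le_divide_eq mult.commute)
    have "0 \<le> surplus fmt (X l 0) 0 (vn n k)" for l
      using X_bounds(3)[of l 0] vn_range[of k n] k by (cases fmt) auto
    then have "0 \<le> (\<Sum>l\<in>S. pmf \<sigma> l * surplus fmt (X l 0) 0 (vn n k))"
      by (intro sum_nonneg mult_nonneg_nonneg pmf_nonneg)
    moreover have "(\<Sum>l\<in>S. pmf \<sigma> l * V l x) \<le> (\<Sum>l\<in>S. pmf \<sigma> l * v x)"
    proof (intro sum_mono mult_left_mono pmf_nonneg)
      fix l
      define y where "y = lo l (\<beta> x) ^ (N - 1)"
      have y: "y \<le> 1" using lo_01 by (simp add: y_def power_le_one)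
      have "y * v x \<le> v x" using mult_right_mono[OF y, of "v x"] vx by simp
      moreover have "y * (v x - \<beta> x) \<le> v x - \<beta> x"
        using mult_right_mono[OF y, of "v x - \<beta> x"] \<beta>x by simp
      ultimately have "surplus fmt y (\<beta> x) (v x) \<le> v x" using \<beta>x(1) by (cases fmt) simp_all
      then show "V l x \<le> v x" by (simp only: V_def y_def)
    qed
    ultimately have "v x * (\<Sum>l\<in>S. pmf \<sigma> l * G l x) \<le> v x * 1"
      using bcce_dev[OF k(1) Bn_zero] own_sum G_eq by (simp add: sum_\<sigma> flip: sum_distrib_right)
    then show "(\<Sum>l\<in>S. pmf \<sigma> l * G l x) \<le> 1"
      using vx by (simp only: mult_le_cancel_left_pos)
  qed

  define h where "h = F (4 * \<delta> n)"
  \<comment> \<open>For \<open>x < h\<close> the value lies below 4 * \<delta> n, so 1 is the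
    smaller of the two bounds there.\<close>
  define e where "e x = (if x < h then 1 else 4 * \<delta> n / v x)" for x
  have h: "0 < h" "h \<le> 1" unfolding h_def using F_pos delta_pos[of n] F_le_1 by auto
  have e_int: "(e has_integral h + integral {h..1} (\<lambda>\<theta>. 4 * \<delta> n / v \<theta>)) {0..1}"
  proof (rule has_integral_combine)
    show "0 \<le> h" "h \<le> 1" using h by auto
    have "((\<lambda>_. 1::real) has_integral h) {0..h}" using has_integral_const_real[of "1::real" 0 h] h by simp
    then show "(e has_integral h) {0..h}"
      by (rule has_integral_spike_finite[of "{h}", rotated 2]) (auto simp: e_def)
    have "((\<lambda>\<theta>. 4 * \<delta> n / v \<theta>) has_integral integral {h..1} (\<lambda>\<theta>. 4 * \<delta> n / v \<theta>)) {h..1}"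
      by (rule integrable_integral[OF inverse_v_integrable[OF h(1)]])
    then show "(e has_integral integral {h..1} (\<lambda>\<theta>. 4 * \<delta> n / v \<theta>)) {h..1}"
      by (rule has_integral_eq[rotated]) (auto simp: e_def)
  qed
  define pts where "pts = cut n ` {..Suc (K n)}"
  have in_cell: "\<exists>k\<le>K n. cut n k < x \<and> x < cut n (Suc k)" if "x \<in> {0..1}" "x \<notin> pts" for x
  proof -
    have "\<exists>k\<le>j. cut n k < x \<and> x < cut n (Suc k)" if "x < cut n (Suc j)" "j \<le> K n" for j
      using that
    proof (induction j)
      case 0
      have "cut n 0 \<noteq> x" using \<open>x \<notin> pts\<close> by (auto simp: pts_def)
      then show ?case using 0 \<open>x \<in> {0..1}\<close> bid_cells.t_0[OF cells_n] by auto
    next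
      case (Suc j)
      have "cut n (Suc j) \<noteq> x" using \<open>x \<notin> pts\<close> Suc.prems(2) by (auto simp: pts_def)
      then show ?case
        using Suc.IH Suc.prems by (cases "x < cut n (Suc j)") (auto intro: le_SucI)
    qed
    moreover have "x < cut n (Suc (K n))"
      using that bid_cells.t_last[OF cells_n] by (cases "x = 1") (auto simp: pts_def intro: image_eqI[of _ _ "Suc (K n)"])
    ultimately show ?thesis by blast
  qed
  have "((\<lambda>x. \<Sum>l\<in>S. pmf \<sigma> l * G l x) has_integral (\<Sum>l\<in>S. pmf \<sigma> l * Z l)) {0..1}"
    by (intro has_integral_sum[OF finS] has_integral_mult_right Z)
  \<comment> \<open>At the finitely many cut points the gain is not controlled, so it is replaced by
    \<open>e\<close> there.\<close>
  then have "((\<lambda>x. if x \<in> pts then e x else \<Sum>l\<in>S. pmf \<sigma> l * G l x) has_integral (\<Sum>l\<in>S. pmf \<sigma> l * Z l)) {0..1}"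
    by (rule has_integral_spike_finite[of pts, rotated 2]) (auto simp: pts_def)
  then have "(\<Sum>l\<in>S. pmf \<sigma> l * Z l) \<le> h + integral {h..1} (\<lambda>\<theta>. 4 * \<delta> n / v \<theta>)"
  proof (rule has_integral_le[OF _ e_int])
    fix x :: real assume x: "x \<in> {0..1}"
    show "(if x \<in> pts then e x else \<Sum>l\<in>S. pmf \<sigma> l * G l x) \<le> e x"
    proof (cases "x \<in> pts")
      case False
      then obtain k where "k \<le> K n" "cut n k < x" "x < cut n (Suc k)" using in_cell[OF x] by blast
      then show ?thesis using expected_gain[of k x] False by (simp add: e_def)
    qed simp
  qed
  moreover have "M * (\<Sum>l\<in>S. pmf \<sigma> l * Q l) \<le> (\<Sum>l\<in>S. pmf \<sigma> l * Z l)"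
  proof -
    have "M * (\<Sum>l\<in>S. pmf \<sigma> l * Q l) = (\<Sum>l\<in>S. pmf \<sigma> l * (M * Q l))"
      by (simp add: sum_distrib_left mult_ac)
    also have "\<dots> \<le> (\<Sum>l\<in>S. pmf \<sigma> l * Z l)"
      by (intro sum_mono mult_left_mono Z pmf_nonneg)
    finally show ?thesis .
  qed
  ultimately have "M * (\<Sum>l\<in>S. pmf \<sigma> l * Q l) \<le> h + integral {h..1} (\<lambda>\<theta>. 4 * \<delta> n / v \<theta>)" by linarith
  then show ?thesis
    using M by (simp add: pos_le_divide_eq mult.commute Q_def h_def S_def)
qed

end

theorem theorem5p7:
  fixes fmt :: auction_format and N :: nat and f F v :: "real \<Rightarrow> real" and bmax :: real
    and \<delta> :: "nat \<Rightarrow> real" and K :: "nat \<Rightarrow> nat" and vn :: "nat \<Rightarrow> nat \<Rightarrow> real"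
    and Bn :: "nat \<Rightarrow> real set" and Fn :: "nat \<Rightarrow> real pmf"
    and n :: nat and \<sigma> :: "(nat \<Rightarrow> real \<Rightarrow> real) pmf"
  assumes "fine_discretisations N f F v bmax \<delta> K vn Bn Fn"
    and "fmt = AP \<and>
           (\<exists>c<0. \<forall>\<theta>\<in>{0<..1}. vector_derivative (\<lambda>t. 1 / v t) (at \<theta> within {0<..1}) \<le> c)
         \<or> fmt = FP \<and>
           strict_antimono_on {0<..1} (\<lambda>t. t / v t) \<and>
           (\<exists>c<0. \<forall>\<theta>\<in>{0<..1}. vector_derivative (\<lambda>t. t / v t) (at \<theta> within {0<..1}) \<le> c)"
    and "BCCE fmt N (grid (K n) (vn n)) (Bn n) (Fn n) \<sigma>"
    and "\<forall>l. 0 < pmf \<sigma> l \<longrightarrow> symmetric_profile N l"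
  shows "(\<Sum>l\<in>{l \<in> profiles N (grid (K n) (vn n)) (Bn n). symmetric_profile N l}.
            pmf \<sigma> l *
            (\<Sum>i<N. integral {0..1}
               (\<lambda>\<theta>. \<theta> ^ (N - 2) *
                  ((induced v (K n) (vn n) (l i) \<theta> - canonical_bid fmt N v \<theta>)\<^sup>2 / 2))))
         \<le> real N * (F (4 * \<delta> n) + integral {F (4 * \<delta> n)..1} (\<lambda>\<theta>. 4 * \<delta> n / v \<theta>))
             / min (const_C fmt N v bmax) (const_D fmt N v)"
proof -
  interpret fine_discretisations N f F v bmax \<delta> K vn Bn Fn by (rule assms(1))
  define Q where "Q l i = integral {0..1} (\<lambda>\<theta>. \<theta> ^ (N - 2) *
      ((induced v (K n) (vn n) (l i) \<theta> - canonical_bid fmt N v \<theta>)\<^sup>2 / 2))" for l :: "nat \<Rightarrow> real \<Rightarrow> real" and i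
  let ?P = "{l \<in> profiles N (grid (K n) (vn n)) (Bn n). symmetric_profile N l}"
  let ?M = "min (const_C fmt N v bmax) (const_D fmt N v)"
  let ?E = "F (4 * \<delta> n) + integral {F (4 * \<delta> n)..1} (\<lambda>\<theta>. 4 * \<delta> n / v \<theta>)"
  have sym: "symmetric_profile N l" if "l \<in> set_pmf \<sigma>" for l
    using assms(4) that by (simp add: pmf_positive)
  have bound: "(\<Sum>l\<in>set_pmf \<sigma>. pmf \<sigma> l * Q l 0) \<le> ?E / ?M"
    using assms(2)
  proof (elim disjE conjE exE)
    fix c assume *: "fmt = AP" "c < 0"
      "\<forall>\<theta>\<in>{0<..1}. vector_derivative (\<lambda>t. 1 / v t) (at \<theta> within {0<..1}) \<le> c"
    note AP = AP_dual_core[OF *(2) *(3)[rule_format]]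
    obtain \<beta>' J m' r' k' where core: "dual_core N (min (const_C AP N v bmax) (const_D AP N v)) bmax
        (canonical_bid AP N v) \<beta>' (\<lambda>x. 1 / v x) m' J (\<lambda>_. 1) (\<lambda>_. 1) r' k'"
      using AP(2) by blast
    show ?thesis
      unfolding Q_def *(1)
      by (rule certificate_bound[OF core AP(1) AP(3) _ assms(3)[unfolded *(1)] sym]) auto
  next
    fix c assume *: "fmt = FP" "strict_antimono_on {0<..1} (\<lambda>t. t / v t)" "c < 0"
      "\<forall>\<theta>\<in>{0<..1}. vector_derivative (\<lambda>t. t / v t) (at \<theta> within {0<..1}) \<le> c"
    note FP = FP_dual_core[OF *(2,3) *(4)[rule_format]]
    obtain \<beta>' m' r' k' where core: "dual_core N (min (const_C FP N v bmax) (const_D FP N v)) bmax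
        (canonical_bid FP N v) \<beta>' (\<lambda>x. 1 / v x) m' (\<lambda>x. x / v x)
        (\<lambda>x. 1 - canonical_bid FP N v x / v x) (\<lambda>x. x ^ (N - 1)) r' k'"
      using FP(2) by blast
    show ?thesis
      unfolding Q_def *(1)
      by (rule certificate_bound[OF core FP(1) FP(3) _ assms(3)[unfolded *(1)] sym]) auto
  qed
  \<comment> \<open>The symmetric support lies inside the index set, and the remaining profiles have
    weight 0. All buyers then contribute equally, which yields the factor N.\<close>
  have "(\<Sum>l\<in>?P. pmf \<sigma> l * (\<Sum>i<N. Q l i)) = (\<Sum>l\<in>set_pmf \<sigma>. pmf \<sigma> l * (\<Sum>i<N. Q l i))"
  proof (rule sum.mono_neutral_right)
    show "finite ?P" using finite_profiles[OF finite_grid Bn_finite] by simp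
    show "set_pmf \<sigma> \<subseteq> ?P" using assms(3) sym unfolding BCCE_def by blast
  qed (simp add: set_pmf_iff)
  also have "\<dots> = (\<Sum>l\<in>set_pmf \<sigma>. pmf \<sigma> l * (real N * Q l 0))"
  proof (rule sum.cong[OF refl])
    fix l assume "l \<in> set_pmf \<sigma>"
    then have eq: "Q l i = Q l 0" if "i < N" for i
      using symmetric_profile_eq[OF sym that] by (simp add: Q_def)
    have "(\<Sum>i<N. Q l i) = (\<Sum>i<N. Q l 0)" by (intro sum.cong refl eq) simp
    then show "pmf \<sigma> l * (\<Sum>i<N. Q l i) = pmf \<sigma> l * (real N * Q l 0)" by simp
  qed
  also have "\<dots> = real N * (\<Sum>l\<in>set_pmf \<sigma>. pmf \<sigma> l * Q l 0)"
    by (simp add: sum_distrib_left mult_ac)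
  also have "\<dots> \<le> real N * (?E / ?M)" by (intro mult_left_mono bound) simp
  finally show ?thesis by (simp add: Q_def)
qed

end
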